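(* Let $f:\overline{\mathbb R}^d\to[0,\infty]$ be a non-negative, continuous and $1$-homogeneous function such that $f(x)<\infty$ for $x\in\mathbb R^d$. Then a distribution is strictly $f$-implicit max-stable if and only if it is an $(f,\mu)$-implicit extreme value distribution, where $\mu$ is supported on $\mathbb R^d\setminus\{f=0\}$ and satisfies the scaling property $\mu(\lambda\,\cdot)=\lambda^{-\alpha}\mu(\cdot)$ for all $\lambda>0$ and some $\alpha>0$.
   Context: $\overline{\mathbb R}=[-\infty,\infty]$ carries its usual compact topology and $\overline{\mathbb R}^d$ the product topology. $1$-homogeneous means $f(\lambda x)=\lambda f(x)$ for all $\lambda>0$. Given iid random vectors $X_1,\dots,X_n$ in $\mathbb R^d$, $k(n)$ denotes the smallest index $k\in\{1,\dots,n\}$ with $f(X_k)=\max_{1\le i\le n}f(X_i)$. $f$-implicit max-stable: an $\mathbb R^d$-valued random vector $X$ (or its law) is (strictly) $f$-implicit max-stable if for every $n$ there exists $a_n>0$ with $a_n^{-1}X_{k(n)}\stackrel{d}{=}X$, where $X_1,\dots,X_n$ are independent copies of $X$. Regular variation: put $D:=\{f=0\}$, a closed cone in $\overline{\mathbb R}^d$ (that is, a closed set with $\lambda D\subset D$ for all $\lambda>0$), and $\overline{\mathbb R}^d_D:=\overline{\mathbb R}^d\setminus D$ with the relative topology. Radon measures on $\overline{\mathbb R}^d_D$ are Borel measures finite on compacts; $\nu_n\stackrel{v}{\to}\nu$ means $\int h\,d\nu_n\to\int h\,d\nu$ for every continuous compactly supported $h:\overline{\mathbb R}^d_D\to\mathbb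 R$. A random vector $X$ in $\mathbb R^d$ satisfies $X\in RV_\alpha(\{a_n\},D,\mu)$, $\alpha>0$, if $\mu$ is a non-trivial Radon measure on $\overline{\mathbb R}^d_D$ supported on $\mathbb R^d\setminus D$, $a_n>0$ is a regularly varying sequence with exponent $1/\alpha$, and $nP(a_n^{-1}X\in\cdot)\stackrel{v}{\to}\mu$ on $\overline{\mathbb R}^d_D$. $(f,\mu)$-implicit extreme value distribution (for $f$ as in the claim): the law of a random vector $Y$ arising as a limit in distribution $a_n^{-1}X_{k(n)}\Rightarrow Y$, where $X_1,X_2,\dots$ are independent copies of some $X\in RV_\alpha(\{a_n\},\{f=0\},\mu)$; explicitly it is the probability law $P_Y(dx)=e^{-Cf(x)^{-\alpha}}\,\mu(dx)$ on $\mathbb R^d\setminus\{f=0\}$ with $C=\mu\{f>1\}$.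
   Formalization: The stable side also requires that f(X) is not almost surely constant; otherwise (e.g. X = 0) k(n) = 1 a.s. and X is trivially stable with a_n = 1, yet not an implicit extreme value law, since f(Y) is then Fréchet. *)

theory Defs
  imports "HOL-Probability.Probability"
begin

text \<open>
  The compactified space \<open>[-\<infinity>,\<infinity>]\<^sup>d\<close> is the type \<^typ>\<open>ereal ^ 'd\<close>, whose topology is the
  product topology.  A distribution of a random vector in \<open>\<real>\<^sup>d\<close> is a probability measure on
  the Borel sets of \<^typ>\<open>real ^ 'd\<close>.
\<close>

definition vec_ereal :: "real ^ 'd \<Rightarrow> ereal ^ 'd" where
  "vec_ereal x = (\<chi> i. ereal (x $ i))"

definition scale_ereal :: "real \<Rightarrow> ereal ^ 'd \<Rightarrow> ereal ^ 'd" where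
  "scale_ereal c x = (\<chi> i. ereal c * x $ i)"

definition one_homogeneous :: "(ereal ^ 'd \<Rightarrow> ennreal) \<Rightarrow> bool" where
  "one_homogeneous f \<longleftrightarrow> (\<forall>c>0. \<forall>x. f (scale_ereal c x) = ennreal c * f x)"

definition first_argmax :: "(ereal ^ 'd \<Rightarrow> ennreal) \<Rightarrow> (nat \<Rightarrow> real ^ 'd) \<Rightarrow> nat \<Rightarrow> nat" where
  "first_argmax f x n =
     (LEAST k. k \<in> {1..n} \<and> f (vec_ereal (x k)) = Max ((\<lambda>i. f (vec_ereal (x i))) ` {1..n}))"

text \<open>
  The law of \<open>a\<^sup>-\<^sup>1 X\<^bsub>k(n)\<^esub>\<close> for iid \<open>X\<^sub>1, \<dots>, X\<^sub>n\<close> with distribution \<open>P\<close>.  The \<open>X\<^sub>i\<close> are realised as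
  the coordinates of the product space; lemma \<open>implicit_max_law_iid\<close> below shows that any
  other iid sample gives the same law.
\<close>

definition implicit_max_law ::
  "(ereal ^ 'd \<Rightarrow> ennreal) \<Rightarrow> (real ^ 'd) measure \<Rightarrow> nat \<Rightarrow> real \<Rightarrow> (real ^ 'd::finite) measure" where
  "implicit_max_law f P n a =
     distr (\<Pi>\<^sub>M i\<in>{1..n}. P) borel (\<lambda>x. x (first_argmax f x n) /\<^sub>R a)"

text \<open>
  If \<open>f(X)\<close> is almost surely constant, then \<open>k(n) = 1\<close> almost surely and the law of \<open>X\<close> is trivially
  stable with \<open>a\<^sub>n = 1\<close> (e.g. the point mass at 0, or any law on the unit sphere when \<open>f\<close> is a norm).
  Such a law is never an implicit extreme value distribution, because \<open>f(Y)\<close> is then Frechet.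
  The characterization is therefore about laws for which \<open>f(X)\<close> is non-degenerate.
\<close>

definition implicit_max_stable ::
  "(ereal ^ 'd \<Rightarrow> ennreal) \<Rightarrow> (real ^ 'd::finite) measure \<Rightarrow> bool" where
  "implicit_max_stable f P \<longleftrightarrow> (\<forall>n\<ge>1. \<exists>a>0. implicit_max_law f P n a = P)"

definition regularly_varying_seq :: "(nat \<Rightarrow> real) \<Rightarrow> real \<Rightarrow> bool" where
  "regularly_varying_seq a \<rho> \<longleftrightarrow>
     (\<forall>n\<ge>1. a n > 0) \<and>
     (\<forall>c>0. (\<lambda>n. a (nat \<lfloor>c * real n\<rfloor>) / a n) \<longlonglongrightarrow> c powr \<rho>)"

text \<open>
  Measures on a subspace \<open>S\<close> of a topological space are measures on
  \<^term>\<open>restrict_space borel S\<close>; a subset of \<open>S\<close> is compact in the relative topology iff it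
  is compact in the ambient space.
\<close>

definition radon_measure_on :: "'a::topological_space set \<Rightarrow> 'a measure \<Rightarrow> bool" where
  "radon_measure_on S \<mu> \<longleftrightarrow>
     sets \<mu> = sets (restrict_space borel S) \<and>
     (\<forall>K. compact K \<longrightarrow> K \<subseteq> S \<longrightarrow> emeasure \<mu> K < \<infinity>)"

definition vague_conv_on ::
  "'a::topological_space set \<Rightarrow> (nat \<Rightarrow> 'a measure) \<Rightarrow> 'a measure \<Rightarrow> bool" where
  "vague_conv_on S \<nu> \<mu> \<longleftrightarrow>
     (\<forall>h :: 'a \<Rightarrow> real. continuous_on S h \<longrightarrow>
        (\<exists>K. compact K \<and> K \<subseteq> S \<and> (\<forall>x\<in>S - K. h x = 0)) \<longrightarrow>
        (\<lambda>n. \<integral>x. h x \<partial>\<nu> n) \<longlonglongrightarrow> (\<integral>x. h x \<partial>\<mu>))"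

text \<open>
  \<open>X \<in> RV\<^sub>\<alpha>({a\<^sub>n}, D, \<mu>)\<close> for a random vector \<open>X\<close> with distribution \<open>Q\<close>.  The \<open>n\<close>-th measure of
  the vaguely convergent sequence is \<open>n P(a\<^sub>n\<^sup>-\<^sup>1 X \<in> \<cdot>)\<close>, restricted to the complement of \<open>D\<close>.
\<close>

definition regularly_varying_law ::
  "real \<Rightarrow> (nat \<Rightarrow> real) \<Rightarrow> (ereal ^ 'd) set \<Rightarrow> (ereal ^ 'd) measure \<Rightarrow>
     (real ^ 'd::finite) measure \<Rightarrow> bool" where
  "regularly_varying_law \<alpha> a D \<mu> Q \<longleftrightarrow>
     prob_space Q \<and> sets Q = sets borel \<and> \<alpha> > 0 \<and>
     radon_measure_on (- D) \<mu> \<and>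
     emeasure \<mu> (- D) > 0 \<and>
     emeasure \<mu> (- D - range vec_ereal) = 0 \<and>
     regularly_varying_seq a (1 / \<alpha>) \<and>
     vague_conv_on (- D)
       (\<lambda>n. scale_measure (of_nat n)
              (restrict_space (distr Q borel (\<lambda>x. vec_ereal (x /\<^sub>R a n))) (- D)))
       \<mu>"

definition conv_in_distribution ::
  "(nat \<Rightarrow> 'a::topological_space measure) \<Rightarrow> 'a measure \<Rightarrow> bool" where
  "conv_in_distribution \<nu> P \<longleftrightarrow>
     (\<forall>g :: 'a \<Rightarrow> real. continuous_on UNIV g \<longrightarrow> bounded (range g) \<longrightarrow>
        (\<lambda>n. \<integral>x. g x \<partial>\<nu> n) \<longlonglongrightarrow> (\<integral>x. g x \<partial>P))"

definition implicit_extreme_value ::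
  "(ereal ^ 'd \<Rightarrow> ennreal) \<Rightarrow> real \<Rightarrow> (ereal ^ 'd) measure \<Rightarrow> (real ^ 'd::finite) measure \<Rightarrow> bool"
  where
  "implicit_extreme_value f \<alpha> \<mu> P \<longleftrightarrow>
     prob_space P \<and> sets P = sets borel \<and>
     (\<exists>Q a. regularly_varying_law \<alpha> a {x. f x = 0} \<mu> Q \<and>
            conv_in_distribution (\<lambda>n. implicit_max_law f Q n (a n)) P)"

definition scaling_property :: "real \<Rightarrow> (ereal ^ 'd::finite) measure \<Rightarrow> bool" where
  "scaling_property \<alpha> \<mu> \<longleftrightarrow>
     (\<forall>c>0. \<forall>A\<in>sets \<mu>. emeasure \<mu> (scale_ereal c ` A) = ennreal (c powr - \<alpha>) * emeasure \<mu> A)"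

lemma borel_measurable_vec_ereal [measurable]:
  "(vec_ereal :: real ^ 'd::finite \<Rightarrow> _) \<in> borel_measurable borel"
  unfolding vec_ereal_def
  by (intro borel_measurable_continuous_onI continuous_intros)

lemma first_argmax_in:
  assumes "n \<ge> 1"
  shows "first_argmax f x n \<in> {1..n}"
proof -
  let ?g = "\<lambda>i. f (vec_ereal (x i))"
  have "Max (?g ` {1..n}) \<in> ?g ` {1..n}"
    using assms by (intro Max_in) auto
  then have "\<exists>k. k \<in> {1..n} \<and> ?g k = Max (?g ` {1..n})"
    by force
  then show ?thesis
    unfolding first_argmax_def using LeastI_ex by (metis (mono_tags, lifting))
qed

lemma measurable_implicit_max:
  fixes f :: "ereal ^ 'd::finite \<Rightarrow> ennreal"
  assumes f: "continuous_on UNIV f" and n: "n \<ge> 1"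
    and P: "sets P = sets (borel :: (real ^ 'd) measure)"
  shows "(\<lambda>x. x (first_argmax f x n) /\<^sub>R a) \<in> borel_measurable (\<Pi>\<^sub>M i\<in>{1..n}. P)"
proof -
  let ?M = "\<Pi>\<^sub>M i\<in>{1..n}. P"
  have [measurable]: "f \<in> borel_measurable borel"
    using f by (rule borel_measurable_continuous_onI)
  have comp [measurable]: "(\<lambda>x. x i) \<in> borel_measurable ?M" if "i \<in> {1..n}" for i
    using measurable_component_singleton[OF that, of "\<lambda>_. P"] measurable_cong_sets[OF refl P]
    by blast
  have g [measurable]: "(\<lambda>x. f (vec_ereal (x i))) \<in> borel_measurable ?M" if "i \<in> {1..n}" for i
    using that by measurable
  have mx [measurable]: "(\<lambda>x. Max ((\<lambda>i. f (vec_ereal (x i))) ` {1..n})) \<in> borel_measurable ?M"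
    using g by (intro borel_measurable_Max) auto
  have pr: "Measurable.pred ?M (\<lambda>x. k \<in> {1..n} \<and>
      f (vec_ereal (x k)) = Max ((\<lambda>i. f (vec_ereal (x i))) ` {1..n}))" for k
  proof (cases "k \<in> {1..n}")
    case True
    from g[OF this] mx have "{x \<in> space ?M. f (vec_ereal (x k)) =
        Max ((\<lambda>i. f (vec_ereal (x i))) ` {1..n})} \<in> sets ?M"
      by (rule borel_measurable_eq)
    with True show ?thesis
      by (simp add: pred_def)
  next
    case False
    then show ?thesis
      by (simp only: simp_thms measurable_const[of False] space_count_space UNIV_I)
  qed
  have am: "(\<lambda>x. first_argmax f x n) \<in> measurable ?M (count_space UNIV)"
    unfolding first_argmax_def by (rule measurable_Least) (rule pr)
  then have am': "(\<lambda>x. first_argmax f x n) \<in> measurable ?M (count_space {1..n})"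
    using measurable_restrict_space2[OF _ am, of "{1..n}"] first_argmax_in[OF n, of f]
    by (simp add: restrict_count_space)
  show ?thesis
  proof (rule measurable_compose_countable'[OF _ am'])
    show "(\<lambda>x. x i /\<^sub>R a) \<in> borel_measurable ?M" if "i \<in> {1..n}" for i
      using comp[OF that] by (rule borel_measurable_scaleR[OF borel_measurable_const])
  qed simp
qed

lemma (in prob_space) implicit_max_law_iid:
  fixes f :: "ereal ^ 'd::finite \<Rightarrow> ennreal" and X :: "nat \<Rightarrow> 'a \<Rightarrow> real ^ 'd"
  assumes f: "continuous_on UNIV f" and n: "n \<ge> 1"
    and ind: "indep_vars (\<lambda>_. borel) X {1..n}"
    and law: "\<And>i. i \<in> {1..n} \<Longrightarrow> distr M borel (X i) = P"
  shows "distr M borel (\<lambda>\<omega>. X (first_argmax f (\<lambda>i. X i \<omega>) n) \<omega> /\<^sub>R a) = implicit_max_law f P n a"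
proof -
  let ?F = "\<lambda>x. x (first_argmax f x n) /\<^sub>R a"
  let ?X = "\<lambda>\<omega>. \<lambda>i\<in>{1..n}. X i \<omega>"
  have rv: "random_variable borel (X i)" if "i \<in> {1..n}" for i
    using ind that unfolding indep_vars_def by blast
  have P: "sets P = sets (borel :: (real ^ 'd) measure)"
    using law[of 1] n by auto
  have "distr M (\<Pi>\<^sub>M i\<in>{1..n}. borel) ?X = (\<Pi>\<^sub>M i\<in>{1..n}. distr M borel (X i))"
    using indep_vars_iff_distr_eq_PiM'[of "{1..n}" X "\<lambda>_. borel"] ind rv n by auto
  also have "\<dots> = (\<Pi>\<^sub>M i\<in>{1..n}. P)"
    by (intro PiM_cong) (auto simp: law)
  finally have eq: "distr M (\<Pi>\<^sub>M i\<in>{1..n}. borel) ?X = (\<Pi>\<^sub>M i\<in>{1..n}. P)" .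
  have F: "?F \<in> borel_measurable (\<Pi>\<^sub>M i\<in>{1..n}. (borel :: (real ^ 'd) measure))"
    using measurable_implicit_max[OF f n refl] .
  have fa: "first_argmax f (?X \<omega>) n = first_argmax f (\<lambda>i. X i \<omega>) n" for \<omega>
    unfolding first_argmax_def by (intro arg_cong[where f = Least] ext conj_cong refl) auto
  have "implicit_max_law f P n a = distr (distr M (\<Pi>\<^sub>M i\<in>{1..n}. borel) ?X) borel ?F"
    unfolding implicit_max_law_def eq ..
  also have "\<dots> = distr M borel (?F \<circ> ?X)"
    using rv by (intro distr_distr F measurable_restrict) auto
  also have "?F \<circ> ?X = (\<lambda>\<omega>. X (first_argmax f (\<lambda>i. X i \<omega>) n) \<omega> /\<^sub>R a)"
    unfolding comp_def fa restrict_apply by (simp only: first_argmax_in[OF n, of f] if_True)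
  finally show ?thesis ..
qed

end

theory Submission
  imports Defs
begin

text \<open>
  Restricted to \<open>\<real>\<^sup>d\<close>, \<open>f\<close> is a continuous homogeneous function with finite values, called
  \<open>loss\<close> below.  Conditioning on the index of the maximum, the law of \<open>a\<^sup>-\<^sup>1 X\<^bsub>k(n)\<^esub>\<close> is squeezed between the
  images under \<open>x \<mapsto> x / a\<close> of \<open>n P(loss < loss(x))\<^sup>n\<^sup>-\<^sup>1 P(dx)\<close> and \<open>n P(loss \<le> loss(x))\<^sup>n\<^sup>-\<^sup>1 P(dx)\<close>;
  the two differ only by ties.

  If \<open>P\<close> is stable, the distribution function \<open>F\<close> of the loss satisfies \<open>F(a\<^sub>n t)\<^sup>n = F(t)\<close>, so it is
  Frechet with \<open>a\<^sub>n = n powr (1/\<alpha>)\<close>.  The squeeze then becomes an identity, which says exactly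
  that \<open>\<mu>(dx) = exp(C loss(x) powr -\<alpha>) P(dx)\<close> has the scaling property for the factors \<open>n powr (1/\<alpha>)\<close>,
  hence for all factors by continuity; and \<open>n P(a\<^sub>n\<^sup>-\<^sup>1 X \<in> dx) = exp(-C loss(x) powr -\<alpha> / n) \<mu>(dx)\<close>
  converges to \<open>\<mu>\<close>.

  Conversely, vague convergence gives \<open>n P(loss(a\<^sub>n\<^sup>-\<^sup>1 X) > t) \<longlongrightarrow> C t powr -\<alpha>\<close>, so both
  factors in the squeeze converge to \<open>exp(-C t powr -\<alpha>)\<close> locally uniformly in \<open>t = loss(x)\<close>.  Therefore the limit law is
  \<open>exp(-C loss(x) powr -\<alpha>) \<mu>(dx)\<close>, and the scaling of \<open>\<mu>\<close> makes it stable.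
\<close>

section \<open>The functional equation of the Frechet distribution\<close>

text \<open>Stability speaks only about integers \<open>n\<close>, and no continuity of the
  distribution function \<open>F\<close> of the loss is given. One level \<open>t\<^sub>0\<close>
  with \<open>0 < F t\<^sub>0 < 1\<close>, together with \<open>F\<close> tending to 1, has to force
  \<open>a\<close> to be multiplicative and strictly increasing, hence a power of \<open>n\<close>;
  monotonicity of \<open>F\<close> then fills the gaps between rational factors. In the converse
  direction the sampled law \<open>Q\<close> may have ties for every \<open>n\<close>, so the strict
  and the weak bound are carried along separately and merge only in the limit. Two kinds of test
  functions occur there. The set \<open>{loss \<ge> t}\<close> is in general unbounded in the real
  space, so its mass is reached through functions of \<open>f\<close> on the compactified space,
  where \<open>{f \<ge> t}\<close> is compact. The limit law is identified by functions with compact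
  support in \<open>{loss > 0}\<close>: there the loss stays in an interval \<open>[s, T]\<close>
  with \<open>s > 0\<close>, on which pointwise convergence of monotone functions to a continuous
  limit is uniform. On the zero set of \<open>f\<close> and at infinity, powers and real parts take
  default values; the limit measures give these sets no mass.\<close>

text \<open>Choosing \<open>j\<close> with \<open>n ^ j \<le> m ^ k < n ^ (j + 1)\<close> and
  applying \<open>a\<close> traps both \<open>ln m / ln n\<close> and
  \<open>ln (a m) / ln (a n)\<close> between \<open>j / k\<close> and \<open>(j + 1) / k\<close>. As
  \<open>k\<close> grows the two ratios must agree, so \<open>ln (a n) / ln n\<close> is the same
  for all \<open>n \<ge> 2\<close>.\<close>

lemma multiplicative_strict_mono_imp_powr:
  fixes a :: "nat \<Rightarrow> real"
  assumes pos: "\<And>n. n \<ge> 1 \<Longrightarrow> a n > 0"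
    and mult: "\<And>m n. m \<ge> 1 \<Longrightarrow> n \<ge> 1 \<Longrightarrow> a (m * n) = a m * a n"
    and less: "\<And>m n. 1 \<le> m \<Longrightarrow> m < n \<Longrightarrow> a m < a n"
  shows "\<exists>\<rho>>0. \<forall>n\<ge>1. a n = real n powr \<rho>"
proof -
  have a1: "a 1 = 1"
    using mult[of 1 1] pos[of 1] by simp
  have gt1: "a n > 1" if "n \<ge> 2" for n
    using less[of 1 n] a1 that by simp
  have le: "a m \<le> a n" if "1 \<le> m" "m \<le> n" for m n
    using less[of m n] that by (cases "m = n") auto
  have pow: "a (m ^ k) = a m ^ k" if "m \<ge> 1" for m k
    using that by (induction k) (auto simp: a1[simplified] mult)
  have ln_pos: "ln (real n) > 0" "ln (a n) > 0" if "n \<ge> 2" for n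
    using that gt1[OF that] by auto
  have close: "\<bar>ln (a m) / ln (a n) - ln (real m) / ln (real n)\<bar> \<le> 1 / real k"
    if mn: "m \<ge> 2" "n \<ge> 2" and k: "k \<ge> 1" for m n k
  proof -
    define j where "j = nat \<lfloor>real k * ln (real m) / ln (real n)\<rfloor>"
    have x0: "0 \<le> real k * ln (real m) / ln (real n)"
      using ln_pos(1)[OF mn(1)] ln_pos(1)[OF mn(2)] by simp
    have j: "real j \<le> real k * ln (real m) / ln (real n)" "real k * ln (real m) / ln (real n) < real j + 1"
      unfolding j_def using x0 by linarith+
    have "ln (real (n ^ j)) \<le> ln (real (m ^ k))"
      using j(1) ln_pos(1)[OF mn(2)] mn by (simp add: ln_realpow field_simps)
    then have "n ^ j \<le> m ^ k"
      using mn by (subst (asm) ln_le_cancel_iff) (auto simp flip: of_nat_power)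
    then have "a n ^ j \<le> a m ^ k"
      using le[of "n ^ j" "m ^ k"] mn by (simp add: pow)
    then have "ln (a n ^ j) \<le> ln (a m ^ k)"
      using gt1[OF mn(1)] gt1[OF mn(2)] by (subst ln_le_cancel_iff) auto
    then have u: "real j \<le> real k * ln (a m) / ln (a n)"
      using ln_pos(2)[OF mn(2)] gt1[OF mn(1)] gt1[OF mn(2)] by (simp add: ln_realpow field_simps)
    have "ln (real (m ^ k)) < ln (real (n ^ (j + 1)))"
      using j(2) ln_pos(1)[OF mn(2)] mn by (simp add: ln_realpow ln_mult field_simps)
    then have "real (m ^ k) < real (n ^ (j + 1))"
      using mn by (subst (asm) ln_less_cancel_iff) (auto simp del: power_Suc)
    then have "m ^ k < n ^ (j + 1)"
      by (simp only: of_nat_less_iff)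
    then have "a m ^ k \<le> a n ^ (j + 1)"
      using le[of "m ^ k" "n ^ (j + 1)"] mn pow[of m k] pow[of n "j + 1"] by simp
    then have "ln (a m ^ k) \<le> ln (a n ^ (j + 1))"
      using gt1[OF mn(1)] gt1[OF mn(2)] by (subst ln_le_cancel_iff) auto
    then have "real k * ln (a m) \<le> real (j + 1) * ln (a n)"
      using pos[of m] pos[of n] mn by (simp only: ln_realpow)
    then have v: "real k * ln (a m) / ln (a n) \<le> real j + 1"
      using ln_pos(2)[OF mn(2)] by (simp add: field_simps)
    have "\<bar>real k * ln (a m) / ln (a n) - real k * ln (real m) / ln (real n)\<bar> \<le> 1"
      using j u v by linarith
    moreover have "real k * ln (a m) / ln (a n) - real k * ln (real m) / ln (real n) =
        real k * (ln (a m) / ln (a n) - ln (real m) / ln (real n))"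
      by (simp add: algebra_simps)
    ultimately have "real k * \<bar>ln (a m) / ln (a n) - ln (real m) / ln (real n)\<bar> \<le> 1"
      by (simp only: abs_mult abs_of_nat)
    then show ?thesis
      using k by (simp only: pos_le_divide_eq mult.commute of_nat_0_less_iff)
  qed
  have eq: "ln (a m) / ln (a n) = ln (real m) / ln (real n)" if mn: "m \<ge> 2" "n \<ge> 2" for m n
  proof -
    let ?d = "\<bar>ln (a m) / ln (a n) - ln (real m) / ln (real n)\<bar>"
    have "?d \<le> 0"
    proof (rule LIMSEQ_le_const)
      show "(\<lambda>k. 1 / real k) \<longlonglongrightarrow> 0" by real_asymp
      show "\<exists>N. \<forall>k\<ge>N. ?d \<le> 1 / real k"
        using close[OF mn] by blast
    qed
    then show ?thesis by simp
  qed
  define \<rho> where "\<rho> = ln (a 2) / ln 2"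
  show ?thesis
  proof (intro exI[of _ \<rho>] conjI allI impI)
    show "\<rho> > 0"
      using ln_pos(2)[of 2] by (simp add: \<rho>_def)
    fix n :: nat assume "n \<ge> 1"
    then consider "n = 1" | "n \<ge> 2" by linarith
    then show "a n = real n powr \<rho>"
    proof cases
      case 2
      then have "ln (a n) = \<rho> * ln (real n)"
        using eq[of n 2] ln_pos(2)[of 2] by (simp add: \<rho>_def field_simps)
      then have "exp (ln (a n)) = real n powr \<rho>"
        using 2 by (simp add: powr_def)
      then show ?thesis
        using gt1[OF 2] by simp
    qed (use a1 in simp)
  qed
qed

text \<open>Scaling by \<open>a m * a n\<close> and by \<open>a (m * n)\<close> both turn
  \<open>F t\<close> into its root of order \<open>m * n\<close>; different scales would give
  \<open>F\<close> a multiplicative period, which its limit 1 excludes. So \<open>a\<close> is a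
  power of \<open>n\<close>, the value of \<open>F\<close> is known at all rational powers times
  \<open>t\<^sub>0\<close>, and monotonicity determines the rest.\<close>

lemma frechet_functional_equation:
  fixes F :: "real \<Rightarrow> real" and a :: "nat \<Rightarrow> real"
  assumes mono: "\<And>s t. s \<le> t \<Longrightarrow> F s \<le> F t"
    and F0: "\<And>t. F t \<ge> 0"
    and lim: "(F \<longlongrightarrow> 1) at_top"
    and t0: "t\<^sub>0 > 0" "0 < F t\<^sub>0" "F t\<^sub>0 < 1"
    and a: "\<And>n. n \<ge> 1 \<Longrightarrow> a n > 0"
    and eq: "\<And>n t. n \<ge> 1 \<Longrightarrow> F (a n * t) ^ n = F t"
  shows "\<exists>C \<alpha>. C > 0 \<and> \<alpha> > 0 \<and> (\<forall>n\<ge>1. a n = real n powr (1 / \<alpha>)) \<and>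
    (\<forall>t>0. F t = exp (- (C * t powr - \<alpha>)))"
proof -
  have eq': "F (a n * t) = F t powr (1 / real n)" if "n \<ge> 1" for n t
  proof (cases "F t = 0")
    case True
    then show ?thesis
      using eq[OF that, of t] that by simp
  next
    case False
    then have "F (a n * t) \<noteq> 0"
      using eq[OF that, of t] that by (auto simp: power_0_left)
    then have "F (a n * t) > 0"
      using F0[of "a n * t"] by simp
    then show ?thesis
      using that by (simp add: eq[OF that, of t, symmetric] powr_powr flip: powr_realpow)
  qed
  \<comment> \<open>A period \<open>r > 1\<close> would carry \<open>t\<^sub>0\<close> to infinity
    along \<open>r ^ k * t\<^sub>0\<close> without changing \<open>F\<close>, against the limit
    1.\<close>
  have no_period: "r \<le> 1" if r: "\<And>s. F (r * s) = F s" for r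
  proof (rule ccontr)
    assume "\<not> r \<le> 1"
    then have "r > 1" by simp
    have "F (r ^ k * t\<^sub>0) = F t\<^sub>0" for k
    proof (induction k)
      case (Suc k)
      then show ?case
        using r[of "r ^ k * t\<^sub>0"] by (simp add: mult.assoc)
    qed simp
    moreover have "filterlim (\<lambda>k. r ^ k * t\<^sub>0) at_top sequentially"
      using \<open>r > 1\<close> t0(1)
      by real_asymp
    then have "(\<lambda>k. F (r ^ k * t\<^sub>0)) \<longlonglongrightarrow> 1"
      using lim filterlim_compose by blast
    ultimately have "F t\<^sub>0 = 1"
      by (simp add: LIMSEQ_const_iff)
    with t0 show False by simp
  qed
  have mult: "a (m * n) = a m * a n" if mn: "m \<ge> 1" "n \<ge> 1" for m n
  proof -
    have same: "F (a (m * n) * t) = F (a m * a n * t)" for t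
    proof -
      have "F (a m * a n * t) = F (a m * (a n * t))"
        by (simp only: mult.assoc)
      also have "\<dots> = F t powr (1 / real (m * n))"
        using mn by (simp only: eq' powr_powr) (simp add: mult.commute)
      also have "\<dots> = F (a (m * n) * t)"
        using mn by (simp add: eq')
      finally show ?thesis ..
    qed
    have pos: "a (m * n) > 0" "a m * a n > 0"
      using a mn by simp_all
    \<comment> \<open>The quotient of the two scales and its inverse are both periods, so neither
      exceeds 1.\<close>
    have "a (m * n) / (a m * a n) \<le> 1"
    proof (rule no_period)
      show "F (a (m * n) / (a m * a n) * s) = F s" for s
        using same[of "s / (a m * a n)"] pos a[OF mn(1)] a[OF mn(2)] by simp
    qed
    moreover have "a m * a n / a (m * n) \<le> 1"
    proof (rule no_period)
      show "F (a m * a n / a (m * n) * s) = F s" for s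
        using same[of "s / a (m * n)"] pos by simp
    qed
    ultimately show ?thesis
      using pos by (simp add: field_simps)
  qed
  have less: "a m < a n" if mn: "1 \<le> m" "m < n" for m n
  proof (rule ccontr)
    assume "\<not> a m < a n"
    then have "F (a n * t\<^sub>0) \<le> F (a m * t\<^sub>0)"
      using t0 by (intro mono mult_right_mono) auto
    then have "F t\<^sub>0 powr (1 / real n) \<le> F t\<^sub>0 powr (1 / real m)"
      using mn by (simp add: eq')
    moreover have "F t\<^sub>0 powr (1 / real m) < F t\<^sub>0 powr (1 / real n)"
      using t0 mn by (intro powr_less_mono') (auto simp: field_simps)
    ultimately show False by simp
  qed
  obtain \<rho> where \<rho>: "\<rho> > 0" "\<And>n. n \<ge> 1 \<Longrightarrow> a n = real n powr \<rho>"
    using multiplicative_strict_mono_imp_powr[of a] a mult less by blast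
  define \<alpha> where "\<alpha> = 1 / \<rho>"
  have \<alpha>: "\<alpha> > 0" "\<rho> = 1 / \<alpha>"
    using \<rho> by (auto simp: \<alpha>_def)
  \<comment> \<open>With \<open>q = m / n\<close>, the points \<open>a m * t\<^sub>0\<close> and
    \<open>a n * (q powr \<rho> * t\<^sub>0)\<close> coincide.\<close>
  have rat: "F (q powr \<rho> * t\<^sub>0) = F t\<^sub>0 powr (1 / q)" if q: "q > 0" "q \<in> \<rat>" for q
  proof -
    obtain m n where mn: "n \<noteq> 0" "\<bar>q\<bar> = real m / real n"
      using q(2) by (rule Rats_abs_nat_div_natE)
    with q have mn: "m \<ge> 1" "n \<ge> 1" "q = real m / real n"
      by (auto simp: Suc_le_eq intro!: gr0I)
    have "F (a m * t\<^sub>0) = F (a n * (q powr \<rho> * t\<^sub>0))"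
      using mn \<rho> by (simp add: powr_divide)
    then have "F t\<^sub>0 powr (1 / real m) = F (q powr \<rho> * t\<^sub>0) powr (1 / real n)"
      using mn by (simp add: eq')
    then have "(F t\<^sub>0 powr (1 / real m)) powr real n = F (q powr \<rho> * t\<^sub>0)"
      using mn F0[of "q powr \<rho> * t\<^sub>0"] by (simp add: powr_powr)
    then show ?thesis
      using mn by (simp add: powr_powr)
  qed
  \<comment> \<open>The right side is continuous in \<open>c\<close> and the left side monotone, so
    a gap on either side is contradicted at a rational \<open>d\<close> close to
    \<open>c\<close>.\<close>
  have all: "F (c powr \<rho> * t\<^sub>0) = F t\<^sub>0 powr (1 / c)" if c: "c > 0" for c
  proof (rule antisym)
    let ?g = "\<lambda>c. F t\<^sub>0 powr (1 / c)"
    have g: "(?g \<longlongrightarrow> ?g c) (at c)"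
      using c t0 by (intro tendsto_intros) auto
    show "F (c powr \<rho> * t\<^sub>0) \<le> ?g c"
    proof (rule ccontr)
      assume "\<not> ?thesis"
      then have "eventually (\<lambda>d. ?g d < F (c powr \<rho> * t\<^sub>0)) (at_right c)"
        by (intro order_tendstoD(2)[OF tendsto_within_subset[OF g]]) auto
      then obtain b where b: "b > c" "\<And>d. c < d \<Longrightarrow> d < b \<Longrightarrow> ?g d < F (c powr \<rho> * t\<^sub>0)"
        unfolding eventually_at_right_field by blast
      obtain d where d: "d \<in> \<rat>" "c < d" "d < b"
        using Rats_dense_in_real[OF b(1)] by blast
      have "F (c powr \<rho> * t\<^sub>0) \<le> F (d powr \<rho> * t\<^sub>0)"
        using c d t0 \<rho> by (intro mono mult_right_mono powr_mono2) auto
      also have "\<dots> = ?g d"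
        using c d by (intro rat) auto
      also have "\<dots> < F (c powr \<rho> * t\<^sub>0)"
        using d by (intro b)
      finally show False by simp
    qed
    show "?g c \<le> F (c powr \<rho> * t\<^sub>0)"
    proof (rule ccontr)
      assume "\<not> ?thesis"
      then have "eventually (\<lambda>d. ?g d > F (c powr \<rho> * t\<^sub>0)) (at_left c)"
        by (intro order_tendstoD(1)[OF tendsto_within_subset[OF g]]) auto
      then obtain b where b: "b < c" "\<And>d. b < d \<Longrightarrow> d < c \<Longrightarrow> ?g d > F (c powr \<rho> * t\<^sub>0)"
        unfolding eventually_at_left_field by blast
      obtain d where d: "d \<in> \<rat>" "max b 0 < d" "d < c"
        using Rats_dense_in_real[of "max b 0" c] b(1) c by auto
      have "F (c powr \<rho> * t\<^sub>0) < ?g d"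
        using d by (intro b) auto
      also have "\<dots> = F (d powr \<rho> * t\<^sub>0)"
        using d by (intro rat[symmetric]) auto
      also have "\<dots> \<le> F (c powr \<rho> * t\<^sub>0)"
        using c d t0 \<rho> by (intro mono mult_right_mono powr_mono2) auto
      finally show False by simp
    qed
  qed
  \<comment> \<open>Solves \<open>F t\<^sub>0 = exp (- (C * t\<^sub>0 powr - \<alpha>))\<close> for
    \<open>C\<close>; it is positive because \<open>F t\<^sub>0 < 1\<close>.\<close>
  define C where "C = - ln (F t\<^sub>0) * t\<^sub>0 powr \<alpha>"
  have "F t = exp (- (C * t powr - \<alpha>))" if t: "t > 0" for t
  proof -
    have "F t = F t\<^sub>0 powr (1 / (t / t\<^sub>0) powr \<alpha>)"
      using all[of "(t / t\<^sub>0) powr \<alpha>"] t t0 \<alpha> by (simp add: powr_powr)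
    then show ?thesis
      using t t0 by (simp add: powr_def[of "F t\<^sub>0"] C_def powr_divide powr_minus field_simps)
  qed
  moreover have "C > 0"
    unfolding C_def using t0 by (intro mult_pos_pos) auto
  ultimately show ?thesis
    using \<alpha> \<rho> by (intro exI[of _ C] exI[of _ \<alpha>]) auto
qed

section \<open>Limits of monotone functions and test functions\<close>

text \<open>For small \<open>q\<close> the logarithm \<open>ln (1 - q)\<close> lies between
  \<open>- q - 2 * q ^ 2\<close> and \<open>- q\<close>, and the quadratic term disappears in the
  limit because \<open>q n\<close> tends to 0. The exponent \<open>n - 1\<close> counts the
  competitors of the observation that attains the maximum.\<close>

lemma tendsto_power_one_minus:
  fixes q :: "nat \<Rightarrow> real"
  assumes nonneg: "\<And>n. 0 \<le> q n" and lim: "(\<lambda>n. real n * q n) \<longlonglongrightarrow> c"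
  shows "(\<lambda>n. (1 - q n) ^ (n - 1)) \<longlonglongrightarrow> exp (- c)"
proof -
  have "(\<lambda>n. real n * q n * (1 / real n)) \<longlonglongrightarrow> c * 0"
    by (intro tendsto_mult lim) real_asymp
  moreover have "\<forall>\<^sub>F n in sequentially. real n * q n * (1 / real n) = q n"
    using eventually_gt_at_top[of 0] by eventually_elim simp
  ultimately have "q \<longlonglongrightarrow> c * 0"
    by (rule Lim_transform_eventually)
  then have q0: "q \<longlonglongrightarrow> 0"
    by simp
  then have small: "\<forall>\<^sub>F n in sequentially. q n < 1 / 2"
    by (rule order_tendstoD) simp
  have nq: "(\<lambda>n. (real n - 1) * q n) \<longlonglongrightarrow> c"
    using tendsto_diff[OF lim q0] by (simp add: algebra_simps)
  have nqq: "(\<lambda>n. (real n - 1) * q n + 2 * ((real n - 1) * q n * q n)) \<longlonglongrightarrow> c + 2 * (c * 0)"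
    by (intro tendsto_intros nq q0)
  have "(\<lambda>n. (real n - 1) * ln (1 - q n)) \<longlonglongrightarrow> - c"
  proof (rule tendsto_sandwich)
    show "(\<lambda>n. - ((real n - 1) * q n + 2 * ((real n - 1) * q n * q n))) \<longlonglongrightarrow> - c"
      using tendsto_minus[OF nqq] by simp
    show "(\<lambda>n. - ((real n - 1) * q n)) \<longlonglongrightarrow> - c"
      using nq by (rule tendsto_minus)
    show "\<forall>\<^sub>F n in sequentially. - ((real n - 1) * q n + 2 * ((real n - 1) * q n * q n))
        \<le> (real n - 1) * ln (1 - q n)"
      using small eventually_ge_at_top[of 1]
    proof eventually_elim
      case (elim n)
      then have "(real n - 1) * (- q n - 2 * (q n)\<^sup>2) \<le> (real n - 1) * ln (1 - q n)"
        using nonneg[of n] by (intro mult_left_mono ln_one_minus_pos_lower_bound) auto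
      then show ?case
        by (simp add: algebra_simps power2_eq_square)
    qed
    show "\<forall>\<^sub>F n in sequentially. (real n - 1) * ln (1 - q n) \<le> - ((real n - 1) * q n)"
      using small eventually_ge_at_top[of 1]
    proof eventually_elim
      case (elim n)
      then have "(real n - 1) * ln (1 - q n) \<le> (real n - 1) * - q n"
        using nonneg[of n] by (intro mult_left_mono ln_one_minus_pos_upper_bound) auto
      then show ?case by simp
    qed
  qed
  then have "(\<lambda>n. exp ((real n - 1) * ln (1 - q n))) \<longlonglongrightarrow> exp (- c)"
    by (rule tendsto_exp)
  moreover have "\<forall>\<^sub>F n in sequentially. exp ((real n - 1) * ln (1 - q n)) = (1 - q n) ^ (n - 1)"
    using small eventually_ge_at_top[of 1]
  proof eventually_elim
    case (elim n)
    then have "exp ((real n - 1) * ln (1 - q n)) = (1 - q n) powr real (n - 1)"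
      by (simp add: powr_def of_nat_diff)
    also have "\<dots> = (1 - q n) ^ (n - 1)"
      using elim by (intro powr_realpow) auto
    finally show ?case .
  qed
  ultimately show ?thesis
    by (rule Lim_transform_eventually)
qed

text \<open>Polya's argument: a monotone function is pinned between its values at the ends of a
  short interval, finitely many such ends suffice by compactness, and uniform continuity of
  \<open>u\<close> keeps the limits there close. The \<open>v n\<close> may jump, which allows for
  atoms of the loss.\<close>

lemma uniform_limit_monotone:
  fixes u :: "real \<Rightarrow> real" and v :: "nat \<Rightarrow> real \<Rightarrow> real"
  assumes mono: "\<And>n s t. s \<le> t \<Longrightarrow> v n s \<le> v n t"
    and cont: "continuous_on {\<delta>..T} u"
    and lim: "\<And>s. s \<in> {\<delta>..T} \<Longrightarrow> (\<lambda>n. v n s) \<longlonglongrightarrow> u s"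
  shows "uniform_limit {\<delta>..T} v u sequentially"
proof (rule uniform_limitI)
  fix e :: real assume e: "e > 0"
  obtain d where d: "d > 0" "\<And>s t. s \<in> {\<delta>..T} \<Longrightarrow> t \<in> {\<delta>..T} \<Longrightarrow> dist t s < d \<Longrightarrow> dist (u t) (u s) < e / 2"
    using compact_uniformly_continuous[OF cont compact_Icc] e
    unfolding uniformly_continuous_on_def by (meson half_gt_zero)
  obtain k where k: "finite k" "k \<subseteq> {\<delta>..T}" "{\<delta>..T} \<subseteq> (\<Union>x\<in>k. ball x (d / 2))"
  proof (rule compactE_image[OF compact_Icc[of \<delta> T], of "{\<delta>..T}" "\<lambda>x. ball x (d / 2)"])
    show "{\<delta>..T} \<subseteq> (\<Union>x\<in>{\<delta>..T}. ball x (d / 2))"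
      using d(1) by auto
  qed auto
  have lim': "\<forall>\<^sub>F n in sequentially. \<bar>v n s - u s\<bar> < e / 2" if "s \<in> {\<delta>..T}" for s
    using tendstoD[OF lim[OF that], of "e / 2"] e by (simp add: dist_real_def)
  \<comment> \<open>Convergence is evaluated at the two ends of each ball, clipped to the interval,
    because every \<open>s\<close> of the interval in that ball lies between them.\<close>
  have "\<forall>\<^sub>F n in sequentially. \<forall>x\<in>k.
      \<bar>v n (max \<delta> (x - d / 2)) - u (max \<delta> (x - d / 2))\<bar> < e / 2 \<and>
      \<bar>v n (min T (x + d / 2)) - u (min T (x + d / 2))\<bar> < e / 2"
    using k d(1) by (intro eventually_ball_finite ballI eventually_conj lim') auto
  then show "\<forall>\<^sub>F n in sequentially. \<forall>s\<in>{\<delta>..T}. dist (v n s) (u s) < e"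
  proof eventually_elim
    case (elim n)
    show ?case
    proof
      fix s assume s: "s \<in> {\<delta>..T}"
      then obtain x where x: "x \<in> k" "dist x s < d / 2"
        using k(3) by auto
      let ?p = "max \<delta> (x - d / 2)" and ?q = "min T (x + d / 2)"
      have "x - d / 2 \<le> s" "s \<le> x + d / 2"
        using x(2) unfolding dist_real_def by linarith+
      then have "?p \<le> s" "s \<le> ?q"
        using s by auto
      then have "v n ?p \<le> v n s" "v n s \<le> v n ?q"
        by (auto intro: mono)
      moreover have "dist (u ?p) (u s) < e / 2" "dist (u ?q) (u s) < e / 2"
      proof -
        have "x \<in> {\<delta>..T}"
          using x k(2) by blast
        then have "?p \<in> {\<delta>..T}" "?q \<in> {\<delta>..T}" "\<bar>?p - s\<bar> < d" "\<bar>?q - s\<bar> < d"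
          using s x(2) d(1) unfolding dist_real_def max_def min_def abs_less_iff by (auto simp: abs_less_iff)
        then show "dist (u ?p) (u s) < e / 2" "dist (u ?q) (u s) < e / 2"
          by (intro d(2)[OF s]; simp only: dist_real_def)+
      qed
      ultimately show "dist (v n s) (u s) < e"
        using elim x(1) unfolding dist_real_def by (smt (verit, best) field_sum_of_halves)
    qed
  qed
qed

text \<open>Indicators of open subsets of \<open>W\<close> are increasing limits of admissible test
  functions, which settles open sets. Inside an \<open>A i\<close> the measures are finite, so
  agreement on the generator of open sets suffices, and the null complement of \<open>W\<close>
  allows the passage to arbitrary Borel sets.\<close>

lemma measure_eqI_test_functions:
  fixes M N :: "'a::euclidean_space measure"
  assumes sets: "sets M = sets borel" "sets N = sets borel"
    and A: "incseq A" "\<And>i::nat. open (A i)" "(\<Union>i. A i) = W" "W \<noteq> UNIV"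
    and finite: "\<And>i. emeasure M (A i) < \<infinity>"
    and null: "emeasure M (- W) = 0" "emeasure N (- W) = 0"
    and test: "\<And>h :: 'a \<Rightarrow> real. \<And>K. continuous_on UNIV h \<Longrightarrow> (\<And>x. 0 \<le> h x) \<Longrightarrow> (\<And>x. h x \<le> 1) \<Longrightarrow>
      compact K \<Longrightarrow> K \<subseteq> W \<Longrightarrow> (\<And>x. x \<notin> K \<Longrightarrow> h x = 0) \<Longrightarrow>
      (\<integral>\<^sup>+x. ennreal (h x) \<partial>M) = (\<integral>\<^sup>+x. ennreal (h x) \<partial>N)"
  shows "M = N"
proof -
  note [measurable_cong] = sets
  have W: "open W"
    using A by (metis open_UN)
  have open_eq: "emeasure M U = emeasure N U" if U: "open U" "U \<subseteq> W" for U
  proof -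
    \<comment> \<open>The first factor cuts off near the complement of \<open>U\<close>, the second
      far from the origin. The shift by 1 makes \<open>h j\<close> vanish already at distance
      \<open>1 / j\<close> from the complement, so its support is a compact subset of
      \<open>U\<close>.\<close>
    define h where "h j x = max 0 (min 1 (real j * infdist x (- U) - 1)) * max 0 (min 1 (real j - norm x))" for j x
    \<comment> \<open>\<open>infdist\<close> to the empty set is 0 by convention, so
      \<open>U\<close> must not be the whole space; \<open>W \<noteq> UNIV\<close> provides
      this.\<close>
    have ne: "- U \<noteq> {}"
      using U A(4) by auto
    have cont: "continuous_on UNIV (h j)" for j
      unfolding h_def by (intro continuous_intros)
    then have [measurable]: "h j \<in> borel_measurable borel" for j
      by (rule borel_measurable_continuous_onI)
    have h01: "0 \<le> h j x" "h j x \<le> 1" for j x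
      unfolding h_def by (auto intro!: mult_le_one)
    have inc: "incseq (\<lambda>j. ennreal (h j x))" for x
    proof (rule incseq_SucI, rule ennreal_leI)
      fix j
      have le: "real j \<le> real (Suc j)"
        by simp
      show "h j x \<le> h (Suc j) x"
        unfolding h_def
        by (intro mult_mono max.mono min.mono diff_mono mult_right_mono infdist_nonneg
            le order_refl max.cobounded1)
    qed
    have Sup: "(SUP j. ennreal (h j x)) = indicator U x" for x
    proof (cases "x \<in> U")
      case True
      have pos: "infdist x (- U) > 0"
        using True U ne by (metis ComplD closed_Compl in_closed_iff_infdist_zero infdist_nonneg less_eq_real_def)
      obtain j :: nat where j: "real j \<ge> max (2 / infdist x (- U)) (norm x + 1)"
        using real_arch_simple by blast
      then have "2 \<le> real j * infdist x (- U)" "norm x + 1 \<le> real j"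
        using pos by (auto simp: pos_divide_le_eq)
      then have "min 1 (real j * infdist x (- U) - 1) = 1" "min 1 (real j - norm x) = 1"
        by (intro min_absorb1; linarith)+
      then have "h j x = 1"
        by (simp only: h_def max.absorb2 zero_le_one mult_1)
      then have "ennreal 1 \<le> (SUP j. ennreal (h j x))"
        by (intro SUP_upper2[of j]) auto
      moreover have "(SUP j. ennreal (h j x)) \<le> 1"
        using h01 by (intro SUP_least) simp
      ultimately show ?thesis
        using True by (intro antisym) simp_all
    next
      case False
      then have "h j x = 0" for j
        by (simp add: h_def)
      then show ?thesis
        using False by simp
    qed
    have "(\<integral>\<^sup>+x. ennreal (h j x) \<partial>M) = (\<integral>\<^sup>+x. ennreal (h j x) \<partial>N)" for j
    proof (rule test)
      let ?K = "{x. 1 \<le> real j * infdist x (- U)} \<inter> cball 0 (real j)"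
      have "closed {x. 1 \<le> real j * infdist x (- U)}"
        by (intro closed_Collect_le continuous_intros)
      then show "compact ?K"
        by (rule closed_Int_compact) simp
      have "x \<in> U" if "1 \<le> real j * infdist x (- U)" for x
      proof (rule ccontr)
        assume "x \<notin> U"
        then show False using that by simp
      qed
      then show "?K \<subseteq> W"
        using U by auto
      show "h j x = 0" if "x \<notin> ?K" for x
        using that by (auto simp: h_def not_le)
    qed (use cont h01 in auto)
    moreover have "emeasure L U = (SUP j. \<integral>\<^sup>+x. ennreal (h j x) \<partial>L)" if L [measurable_cong]: "sets L = sets borel" for L
    proof -
      have "emeasure L U = (\<integral>\<^sup>+x. (SUP j. ennreal (h j x)) \<partial>L)"
        unfolding Sup using U L by simp
      also have "\<dots> = (SUP j. \<integral>\<^sup>+x. ennreal (h j x) \<partial>L)"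
        using inc by (intro nn_integral_monotone_convergence_SUP) (auto simp: incseq_def le_fun_def)
      finally show ?thesis .
    qed
    ultimately show ?thesis
      using sets by simp
  qed
  have AX: "emeasure M (A i \<inter> X) = emeasure N (A i \<inter> X)" if X: "X \<in> sets borel" for i X
  proof -
    have Ai: "A i \<in> sets M" "A i \<in> sets N"
      using A sets by auto
    \<comment> \<open>Cutting down to \<open>A i\<close> by a density keeps the space
      \<open>UNIV\<close> and makes the measure finite, as the uniqueness theorem for generators
      wants it.\<close>
    have "density M (indicator (A i)) = density N (indicator (A i))"
    proof (rule measure_eqI_generator_eq[where E = "{S. open S}" and \<Omega> = UNIV and A = "\<lambda>_. UNIV"])
      show "Int_stable {S :: 'a set. open S}"
        by (auto simp: Int_stable_def)
      show "emeasure (density M (indicator (A i))) X = emeasure (density N (indicator (A i))) X"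
        if "X \<in> {S. open S}" for X
        using that A sets open_eq[of "A i \<inter> X"] by (subst (1 2) emeasure_restricted) auto
      show "emeasure (density M (indicator (A i))) UNIV \<noteq> \<infinity>"
        using finite[of i] Ai sets by (subst emeasure_restricted) auto
    qed (use sets in \<open>auto simp: borel_def\<close>)
    then show ?thesis
      using Ai X sets emeasure_restricted[of "A i" M X] emeasure_restricted[of "A i" N X] by simp
  qed
  have eq: "emeasure L X = (SUP i. emeasure L (A i \<inter> X))"
    if L: "sets L = sets borel" "emeasure L (- W) = 0" and X: "X \<in> sets borel" for L X
  proof -
    have "emeasure L (W \<inter> X) \<le> emeasure L X"
      using L X by (intro emeasure_mono) auto
    moreover have "(SUP i. emeasure L (A i \<inter> X)) = emeasure L (\<Union>i. A i \<inter> X)"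
      using A L X by (intro SUP_emeasure_incseq) (auto simp: incseq_def)
    moreover have "(\<Union>i. A i \<inter> X) = W \<inter> X"
      using A(3) by auto
    moreover have "emeasure L X \<le> emeasure L (W \<inter> X \<union> - W)"
      using L X W by (intro emeasure_mono) auto
    moreover have "emeasure L (W \<inter> X \<union> - W) \<le> emeasure L (W \<inter> X) + emeasure L (- W)"
      using L X W by (intro emeasure_subadditive) auto
    ultimately show ?thesis
      using L(2) by (intro antisym) auto
  qed
  show ?thesis
  proof (rule measure_eqI)
    show "emeasure M X = emeasure N X" if "X \<in> sets M" for X
      using that sets null eq[of M X] eq[of N X] AX[of X] by simp
  qed (simp add: sets)
qed

section \<open>The law of the implicit maximum\<close>

locale homogeneous_loss =
  fixes f :: "ereal ^ 'd::finite \<Rightarrow> ennreal"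
  assumes cont: "continuous_on UNIV f"
    and hom: "one_homogeneous f"
    and fin: "\<And>x :: real ^ 'd. f (vec_ereal x) < \<infinity>"
begin

definition loss :: "real ^ 'd \<Rightarrow> real" where
  "loss x = enn2real (f (vec_ereal x))"

lemma f_vec_ereal: "f (vec_ereal x) = ennreal (loss x)"
  using fin[of x] by (simp add: loss_def less_top)

lemma loss_nonneg [simp]: "0 \<le> loss x"
  by (simp add: loss_def)

lemma scale_vec_ereal: "scale_ereal c (vec_ereal x) = vec_ereal (c *\<^sub>R x)"
  by (simp add: scale_ereal_def vec_ereal_def vec_eq_iff)

lemma loss_scaleR: "c > 0 \<Longrightarrow> loss (c *\<^sub>R x) = c * loss x"
  using hom unfolding one_homogeneous_def loss_def
  by (simp add: enn2real_mult flip: scale_vec_ereal)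

lemma loss_0 [simp]: "loss 0 = 0"
  using loss_scaleR[of 2 0] by simp

lemma continuous_on_vec_ereal: "continuous_on UNIV (vec_ereal :: real ^ 'd \<Rightarrow> _)"
  unfolding vec_ereal_def by (intro continuous_intros)

lemma continuous_loss: "continuous_on UNIV loss"
proof -
  have "continuous_on UNIV (\<lambda>x. f (vec_ereal x))"
    by (rule continuous_on_compose2[OF cont continuous_on_vec_ereal]) auto
  then show ?thesis
    unfolding loss_def continuous_on_def using fin
    by (auto intro!: tendsto_enn2real simp: less_top)
qed

lemma measurable_loss [measurable]: "loss \<in> borel_measurable borel"
  using continuous_loss by (rule borel_measurable_continuous_onI)

lemma loss_first_argmax:
  assumes "n \<ge> 1" "i \<in> {1..n}"
  shows "loss (x i) \<le> loss (x (first_argmax f x n))"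
proof -
  let ?g = "\<lambda>i. f (vec_ereal (x i))"
  have "Max (?g ` {1..n}) \<in> ?g ` {1..n}"
    using assms by (intro Max_in) auto
  then have "\<exists>k. k \<in> {1..n} \<and> ?g k = Max (?g ` {1..n})"
    by force
  then have "?g (first_argmax f x n) = Max (?g ` {1..n})"
    unfolding first_argmax_def using LeastI_ex by (metis (mono_tags, lifting))
  then have "?g i \<le> ?g (first_argmax f x n)"
    using assms by simp
  then show ?thesis
    by (simp add: f_vec_ereal)
qed

end

text \<open>Tychonoff for the function space, carried over by the continuous surjection
  \<open>vec_lambda\<close>.\<close>

lemma compact_UNIV_ereal_vec: "compact (UNIV :: (ereal ^ 'd::finite) set)"
proof -
  have "compact_space (product_topology (\<lambda>_::'d. euclidean :: ereal topology) UNIV)"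
    unfolding compact_space_product_topology by (simp add: compact_space_def compact_UNIV)
  then have "compact (UNIV :: ('d \<Rightarrow> ereal) set)"
    by (simp add: compact_space_def euclidean_product_topology)
  moreover have "continuous_on UNIV (vec_lambda :: ('d \<Rightarrow> ereal) \<Rightarrow> _)"
    unfolding continuous_on_def
  proof (intro ballI vec_tendstoI)
    fix x :: "'d \<Rightarrow> ereal" and i
    have "continuous_on UNIV (\<lambda>x :: 'd \<Rightarrow> ereal. x i)"
      using continuous_on_product_then_coordinatewise[OF continuous_on_id] by simp
    then show "((\<lambda>x. vec_lambda x $ i) \<longlongrightarrow> vec_lambda x $ i) (at x)"
      by (simp add: continuous_on_def)
  qed
  moreover have "range (vec_lambda :: ('d \<Rightarrow> ereal) \<Rightarrow> _) = UNIV"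
    by (metis surjI vec_lambda_eta)
  ultimately show ?thesis
    by (metis compact_continuous_image)
qed

text \<open>Fubini with coordinate \<open>k\<close> integrated last: once its value \<open>z\<close>
  is fixed, each remaining coordinate enters through its own factor, and all these factors have the
  same integral.\<close>

lemma (in prob_space) nn_integral_PiM_pairwise:
  fixes g :: "'a \<Rightarrow> ennreal" and h :: "'a \<Rightarrow> 'a \<Rightarrow> ennreal"
  assumes I: "finite I" "k \<in> I"
    and g [measurable]: "g \<in> borel_measurable M"
    and h [measurable]: "case_prod h \<in> borel_measurable (M \<Otimes>\<^sub>M M)"
  shows "(\<integral>\<^sup>+x. g (x k) * (\<Prod>j\<in>I - {k}. h (x j) (x k)) \<partial>(\<Pi>\<^sub>M i\<in>I. M)) =
    (\<integral>\<^sup>+z. g z * (\<integral>\<^sup>+y. h y z \<partial>M) ^ (card I - 1) \<partial>M)"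
proof -
  interpret product_sigma_finite "\<lambda>_. M"
    by unfold_locales
  let ?F = "\<lambda>x. g (x k) * (\<Prod>j\<in>I - {k}. h (x j) (x k))"
  have F: "?F \<in> borel_measurable (\<Pi>\<^sub>M i\<in>I. M)"
  proof (intro borel_measurable_times_ennreal borel_measurable_prod_ennreal)
    show "(\<lambda>x. g (x k)) \<in> borel_measurable (\<Pi>\<^sub>M i\<in>I. M)"
      using I by measurable
    fix j assume "j \<in> I - {k}"
    then have "(\<lambda>x. (x j, x k)) \<in> measurable (\<Pi>\<^sub>M i\<in>I. M) (M \<Otimes>\<^sub>M M)"
      using I by (intro measurable_Pair measurable_component_singleton) auto
    from measurable_compose[OF this h] show "(\<lambda>x. h (x j) (x k)) \<in> borel_measurable (\<Pi>\<^sub>M i\<in>I. M)"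
      by simp
  qed
  have "(\<integral>\<^sup>+x. ?F x \<partial>(\<Pi>\<^sub>M i\<in>I. M)) =
      (\<integral>\<^sup>+z. (\<integral>\<^sup>+x. ?F (x(k := z)) \<partial>(\<Pi>\<^sub>M i\<in>I - {k}. M)) \<partial>M)"
    using product_nn_integral_insert_rev[of "I - {k}" k ?F] I F
    by (simp add: insert_absorb)
  also have "\<dots> = (\<integral>\<^sup>+z. g z * (\<integral>\<^sup>+y. h y z \<partial>M) ^ (card I - 1) \<partial>M)"
  proof (rule nn_integral_cong)
    fix z assume z [measurable]: "z \<in> space M"
    have hz [measurable]: "(\<lambda>y. h y z) \<in> borel_measurable M"
      by measurable
    have "(\<integral>\<^sup>+x. ?F (x(k := z)) \<partial>(\<Pi>\<^sub>M i\<in>I - {k}. M)) =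
        (\<integral>\<^sup>+x. g z * (\<Prod>j\<in>I - {k}. h (x j) z) \<partial>(\<Pi>\<^sub>M i\<in>I - {k}. M))"
      by (intro nn_integral_cong arg_cong2[where f = "(*)"] prod.cong) auto
    also have "\<dots> = g z * (\<integral>\<^sup>+x. (\<Prod>j\<in>I - {k}. h (x j) z) \<partial>(\<Pi>\<^sub>M i\<in>I - {k}. M))"
    proof (intro nn_integral_cmult borel_measurable_prod_ennreal)
      show "(\<lambda>x. h (x j) z) \<in> borel_measurable (\<Pi>\<^sub>M i\<in>I - {k}. M)" if "j \<in> I - {k}" for j
        using measurable_compose[OF measurable_component_singleton[OF that, of "\<lambda>_. M"] hz] .
    qed
    also have "(\<integral>\<^sup>+x. (\<Prod>j\<in>I - {k}. h (x j) z) \<partial>(\<Pi>\<^sub>M i\<in>I - {k}. M)) =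
        (\<Prod>j\<in>I - {k}. \<integral>\<^sup>+y. h y z \<partial>M)"
      using I by (intro product_nn_integral_prod) auto
    also have "\<dots> = (\<integral>\<^sup>+y. h y z \<partial>M) ^ (card I - 1)"
      using I by simp
    finally show "(\<integral>\<^sup>+x. ?F (x(k := z)) \<partial>(\<Pi>\<^sub>M i\<in>I - {k}. M)) =
      g z * (\<integral>\<^sup>+y. h y z \<partial>M) ^ (card I - 1)" .
  qed
  finally show ?thesis .
qed

context homogeneous_loss
begin

lemma
  assumes P: "prob_space P" "sets P = sets borel" and n: "n \<ge> 1"
  shows prob_space_implicit_max_law: "prob_space (implicit_max_law f P n a)"
    and sets_implicit_max_law [simp]: "sets (implicit_max_law f P n a) = sets borel"
    and nn_integral_implicit_max_law: "\<And>g. g \<in> borel_measurable borel \<Longrightarrow>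
      (\<integral>\<^sup>+x. g x \<partial>implicit_max_law f P n a) =
      (\<integral>\<^sup>+x. g (x (first_argmax f x n) /\<^sub>R a) \<partial>(\<Pi>\<^sub>M i\<in>{1..n}. P))"
proof -
  interpret P: prob_space P by fact
  interpret PM: prob_space "\<Pi>\<^sub>M i\<in>{1..n}. P"
    by (rule prob_space_PiM) (rule P(1))
  note [measurable] = measurable_implicit_max[OF cont n P(2), of a]
  show "prob_space (implicit_max_law f P n a)"
    unfolding implicit_max_law_def by (rule PM.prob_space_distr) measurable
  show "sets (implicit_max_law f P n a) = sets borel"
    by (simp add: implicit_max_law_def)
  show "(\<integral>\<^sup>+x. g x \<partial>implicit_max_law f P n a) =
      (\<integral>\<^sup>+x. g (x (first_argmax f x n) /\<^sub>R a) \<partial>(\<Pi>\<^sub>M i\<in>{1..n}. P))"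
    if [measurable]: "g \<in> borel_measurable borel" for g
    unfolding implicit_max_law_def by (rule nn_integral_distr) measurable
qed

text \<open>A pathwise comparison with a sum over candidate indices \<open>k\<close>. If all
  competitors must be strictly below \<open>x k\<close>, only the selected index can contribute, and
  nothing does when the maximum is tied. If equality is allowed, the selected index contributes
  fully and ties only add more. All indices have the same integral, hence the factor
  \<open>n\<close>.\<close>

lemma nn_integral_implicit_max_law_bounds:
  assumes P: "prob_space P" "sets P = sets borel" and n: "n \<ge> 1"
    and g [measurable]: "g \<in> borel_measurable borel"
  shows "(\<integral>\<^sup>+x. of_nat n * (g (x /\<^sub>R a) * emeasure P {y. loss y < loss x} ^ (n - 1)) \<partial>P)
      \<le> (\<integral>\<^sup>+x. g x \<partial>implicit_max_law f P n a)"
    and "(\<integral>\<^sup>+x. g x \<partial>implicit_max_law f P n a)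
      \<le> (\<integral>\<^sup>+x. of_nat n * (g (x /\<^sub>R a) * emeasure P {y. loss y \<le> loss x} ^ (n - 1)) \<partial>P)"
proof -
  interpret P: prob_space P by fact
  note [measurable_cong] = P(2)
  let ?M = "\<Pi>\<^sub>M i\<in>{1..n}. P"
  let ?lt = "\<lambda>y z. indicator {(y, z). loss y < loss z} (y, z) :: ennreal"
  let ?le = "\<lambda>y z. indicator {(y, z). loss y \<le> loss z} (y, z) :: ennreal"
  have meas [measurable]: "case_prod ?lt \<in> borel_measurable (P \<Otimes>\<^sub>M P)"
      "case_prod ?le \<in> borel_measurable (P \<Otimes>\<^sub>M P)"
    by measurable
  have gm [measurable]: "(\<lambda>x. g (x /\<^sub>R a)) \<in> borel_measurable P"
    by measurable
  have term_measurable: "(\<lambda>x. g (x k /\<^sub>R a) * (\<Prod>j\<in>{1..n} - {k}. h (x j) (x k))) \<in> borel_measurable ?M"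
    if h: "case_prod h \<in> borel_measurable (P \<Otimes>\<^sub>M P)" and k: "k \<in> {1..n}" for h k
  proof (intro borel_measurable_times_ennreal borel_measurable_prod_ennreal)
    show "(\<lambda>x. g (x k /\<^sub>R a)) \<in> borel_measurable ?M"
      using measurable_compose[OF measurable_component_singleton[OF k] gm] .
    fix j assume "j \<in> {1..n} - {k}"
    then have "(\<lambda>x. (x j, x k)) \<in> measurable ?M (P \<Otimes>\<^sub>M P)"
      using k by (intro measurable_Pair measurable_component_singleton) auto
    from measurable_compose[OF this h] show "(\<lambda>x. h (x j) (x k)) \<in> borel_measurable ?M"
      by simp
  qed
  have sum: "(\<integral>\<^sup>+x. (\<Sum>k\<in>{1..n}. g (x k /\<^sub>R a) * (\<Prod>j\<in>{1..n} - {k}. h (x j) (x k))) \<partial>?M) =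
      (\<integral>\<^sup>+x. of_nat n * (g (x /\<^sub>R a) * (\<integral>\<^sup>+y. h y x \<partial>P) ^ (n - 1)) \<partial>P)"
    if h: "case_prod h \<in> borel_measurable (P \<Otimes>\<^sub>M P)" for h
  proof -
    have [measurable]: "(\<lambda>x. \<integral>\<^sup>+y. h y x \<partial>P) \<in> borel_measurable P"
    proof (rule P.borel_measurable_nn_integral)
      show "(\<lambda>(x, y). h y x) \<in> borel_measurable (P \<Otimes>\<^sub>M P)"
        using measurable_compose[OF measurable_pair_swap' h] by (simp add: case_prod_unfold)
    qed
    have "(\<integral>\<^sup>+x. (\<Sum>k\<in>{1..n}. g (x k /\<^sub>R a) * (\<Prod>j\<in>{1..n} - {k}. h (x j) (x k))) \<partial>?M) =
        (\<Sum>k\<in>{1..n}. \<integral>\<^sup>+x. g (x k /\<^sub>R a) * (\<Prod>j\<in>{1..n} - {k}. h (x j) (x k)) \<partial>?M)"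
      using term_measurable[OF h] by (rule nn_integral_sum)
    also have "\<dots> = (\<Sum>k\<in>{1..n}. \<integral>\<^sup>+x. g (x /\<^sub>R a) * (\<integral>\<^sup>+y. h y x \<partial>P) ^ (n - 1) \<partial>P)"
      using P.nn_integral_PiM_pairwise[of "{1..n}" _ "\<lambda>x. g (x /\<^sub>R a)" h, OF _ _ gm h]
      by (intro sum.cong) auto
    also have "\<dots> = (\<integral>\<^sup>+x. of_nat n * (g (x /\<^sub>R a) * (\<integral>\<^sup>+y. h y x \<partial>P) ^ (n - 1)) \<partial>P)"
      by (subst nn_integral_cmult) auto
    finally show ?thesis .
  qed
  have lt: "(\<integral>\<^sup>+y. ?lt y x \<partial>P) = emeasure P {y. loss y < loss x}" for x
  proof -
    have "(\<integral>\<^sup>+y. ?lt y x \<partial>P) = (\<integral>\<^sup>+y. indicator {y. loss y < loss x} y \<partial>P)"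
      by (intro nn_integral_cong) (simp add: indicator_def)
    then show ?thesis
      by (simp add: P)
  qed
  have le: "(\<integral>\<^sup>+y. ?le y x \<partial>P) = emeasure P {y. loss y \<le> loss x}" for x
  proof -
    have "(\<integral>\<^sup>+y. ?le y x \<partial>P) = (\<integral>\<^sup>+y. indicator {y. loss y \<le> loss x} y \<partial>P)"
      by (intro nn_integral_cong) (simp add: indicator_def)
    then show ?thesis
      by (simp add: P)
  qed
  let ?K = "\<lambda>x. first_argmax f x n"
  have K: "?K x \<in> {1..n}" for x
    using first_argmax_in[OF n] .
  note max = loss_first_argmax[OF n]
  have split: "(\<Sum>k\<in>{1..n}. F k) = F (?K x) + (\<Sum>k\<in>{1..n} - {?K x}. F k)" for F :: "nat \<Rightarrow> ennreal" and x
    using K by (intro sum.remove) auto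
  have "(\<Sum>k\<in>{1..n}. g (x k /\<^sub>R a) * (\<Prod>j\<in>{1..n} - {k}. ?lt (x j) (x k))) \<le> g (x (?K x) /\<^sub>R a)" for x
  proof -
    \<comment> \<open>The selected index \<open>?K x\<close> is itself a competitor of
      \<open>k\<close>, and its loss is not strictly below that of \<open>x k\<close>.\<close>
    have "(\<Prod>j\<in>{1..n} - {k}. ?lt (x j) (x k)) = 0" if "k \<in> {1..n} - {?K x}" for k
    proof (rule prod_zero)
      show "\<exists>j\<in>{1..n} - {k}. ?lt (x j) (x k) = 0"
        using that K[of x] max[of k x] by (intro bexI[of _ "?K x"]) auto
    qed simp
    then have "(\<Sum>k\<in>{1..n}. g (x k /\<^sub>R a) * (\<Prod>j\<in>{1..n} - {k}. ?lt (x j) (x k))) =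
        g (x (?K x) /\<^sub>R a) * (\<Prod>j\<in>{1..n} - {?K x}. ?lt (x j) (x (?K x)))"
      unfolding split[of _ x] by (simp add: sum.neutral)
    also have "\<dots> \<le> g (x (?K x) /\<^sub>R a) * 1"
      by (intro mult_left_mono prod_le_1) (auto simp: indicator_def)
    finally show ?thesis by simp
  qed
  then have "(\<integral>\<^sup>+x. (\<Sum>k\<in>{1..n}. g (x k /\<^sub>R a) * (\<Prod>j\<in>{1..n} - {k}. ?lt (x j) (x k))) \<partial>?M) \<le>
      (\<integral>\<^sup>+x. g (x (?K x) /\<^sub>R a) \<partial>?M)"
    by (intro nn_integral_mono)
  then show "(\<integral>\<^sup>+x. of_nat n * (g (x /\<^sub>R a) * emeasure P {y. loss y < loss x} ^ (n - 1)) \<partial>P)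
      \<le> (\<integral>\<^sup>+x. g x \<partial>implicit_max_law f P n a)"
    unfolding sum[OF meas(1)] lt nn_integral_implicit_max_law[OF P n g] .
  have "g (x (?K x) /\<^sub>R a) \<le> (\<Sum>k\<in>{1..n}. g (x k /\<^sub>R a) * (\<Prod>j\<in>{1..n} - {k}. ?le (x j) (x k)))" for x
  proof -
    have "(\<Prod>j\<in>{1..n} - {?K x}. ?le (x j) (x (?K x))) = 1"
      using max by (intro prod.neutral) auto
    then show ?thesis
      unfolding split[of _ x] by simp
  qed
  then have "(\<integral>\<^sup>+x. g (x (?K x) /\<^sub>R a) \<partial>?M) \<le>
     (\<integral>\<^sup>+x. (\<Sum>k\<in>{1..n}. g (x k /\<^sub>R a) * (\<Prod>j\<in>{1..n} - {k}. ?le (x j) (x k))) \<partial>?M)"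
    by (intro nn_integral_mono)
  then show "(\<integral>\<^sup>+x. g x \<partial>implicit_max_law f P n a)
      \<le> (\<integral>\<^sup>+x. of_nat n * (g (x /\<^sub>R a) * emeasure P {y. loss y \<le> loss x} ^ (n - 1)) \<partial>P)"
    unfolding sum[OF meas(2)] le nn_integral_implicit_max_law[OF P n g] .
qed

text \<open>The selected observation attains the maximum, so its loss is at most a level exactly
  when all losses are. Ties do no harm here, and the identity is exact where the squeeze for general
  \<open>g\<close> is not.\<close>

lemma emeasure_implicit_max_law_loss_le:
  assumes P: "prob_space P" "sets P = sets borel" and n: "n \<ge> 1" and a: "a > 0"
  shows "emeasure (implicit_max_law f P n a) {x. loss x \<le> t} = emeasure P {x. loss x \<le> a * t} ^ n"
proof -
  interpret P: prob_space P by fact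
  note [measurable_cong] = P(2)
  interpret product_sigma_finite "\<lambda>_. P"
    by unfold_locales
  let ?K = "\<lambda>x. first_argmax f x n"
  have sp: "space P = UNIV"
    using sets_eq_imp_space_eq[OF P(2)] by simp
  have "emeasure (implicit_max_law f P n a) {x. loss x \<le> t} =
      emeasure (\<Pi>\<^sub>M i\<in>{1..n}. P) ((\<lambda>x. x (?K x) /\<^sub>R a) -` {x. loss x \<le> t} \<inter> space (\<Pi>\<^sub>M i\<in>{1..n}. P))"
    unfolding implicit_max_law_def
    by (rule emeasure_distr) (use measurable_implicit_max[OF cont n P(2), of a] in auto)
  also have "(\<lambda>x. x (?K x) /\<^sub>R a) -` {x. loss x \<le> t} \<inter> space (\<Pi>\<^sub>M i\<in>{1..n}. P) =
      (\<Pi>\<^sub>E i\<in>{1..n}. {x. loss x \<le> a * t})"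
  proof -
    have "loss (x (?K x) /\<^sub>R a) \<le> t \<longleftrightarrow> (\<forall>i\<in>{1..n}. loss (x i) \<le> a * t)" for x
    proof -
      have "loss (x (?K x) /\<^sub>R a) \<le> t \<longleftrightarrow> loss (x (?K x)) \<le> a * t"
        using a by (simp add: loss_scaleR field_simps)
      also have "\<dots> \<longleftrightarrow> (\<forall>i\<in>{1..n}. loss (x i) \<le> a * t)"
        using loss_first_argmax[OF n, of _ x] first_argmax_in[OF n, of f x] order_trans by blast
      finally show ?thesis .
    qed
    then show ?thesis
      by (auto simp: space_PiM sp PiE_iff)
  qed
  also have "emeasure (\<Pi>\<^sub>M i\<in>{1..n}. P) (\<Pi>\<^sub>E i\<in>{1..n}. {x. loss x \<le> a * t}) =
      (\<Prod>i\<in>{1..n}. emeasure P {x. loss x \<le> a * t})"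
    by (rule emeasure_PiM) (auto simp: P(2))
  finally show ?thesis by simp
qed

section \<open>Frechet distributed losses\<close>

text \<open>Since \<open>0 powr - \<alpha> = 0\<close>, the weight is 1 where the loss vanishes,
  although for positive \<open>C\<close> and \<open>\<alpha>\<close> it tends to 0 as the loss
  does.\<close>

definition frechet_weight :: "real \<Rightarrow> real \<Rightarrow> real ^ 'd \<Rightarrow> real" where
  "frechet_weight C \<alpha> x = exp (- (C * loss x powr - \<alpha>))"

lemma frechet_weight_pos: "frechet_weight C \<alpha> x > 0"
  by (simp add: frechet_weight_def)

lemma frechet_weight_nonneg [simp]: "0 \<le> frechet_weight C \<alpha> x"
  by (simp add: frechet_weight_def)

lemma frechet_weight_le_1: "C \<ge> 0 \<Longrightarrow> frechet_weight C \<alpha> x \<le> 1"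
  by (simp add: frechet_weight_def)

lemma measurable_frechet_weight [measurable]: "frechet_weight C \<alpha> \<in> borel_measurable borel"
  unfolding frechet_weight_def by measurable

text \<open>Max-stability of the Frechet distribution function: dividing by
  \<open>n powr (1 / \<alpha>)\<close> multiplies \<open>loss x powr - \<alpha>\<close> by
  \<open>n\<close>. The identity persists at loss 0, where both sides are 1.\<close>

lemma frechet_weight_scale:
  assumes "n \<ge> 1" "\<alpha> > 0"
  shows "frechet_weight C \<alpha> (x /\<^sub>R real n powr (1 / \<alpha>)) = frechet_weight C \<alpha> x ^ n"
proof -
  have "loss (x /\<^sub>R real n powr (1 / \<alpha>)) powr - \<alpha> = (real n powr (- (1 / \<alpha>))) powr - \<alpha> * loss x powr - \<alpha>"
    using assms by (simp add: loss_scaleR powr_mult flip: powr_minus)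
  also have "(real n powr (- (1 / \<alpha>))) powr - \<alpha> = real n"
    using assms by (simp add: powr_powr)
  finally show ?thesis
    by (simp add: frechet_weight_def mult_ac flip: exp_of_nat_mult)
qed

text \<open>A Frechet distribution function is continuous on the positive axis and tends to 0 at 0.
  So no single level of the loss carries mass, and the two sides of the squeeze coincide.\<close>

lemma
  assumes P: "prob_space P" "sets P = sets borel" and C: "C > 0" "\<alpha> > 0"
    and F: "\<And>t. t > 0 \<Longrightarrow> measure P {x. loss x \<le> t} = exp (- (C * t powr - \<alpha>))"
  shows emeasure_loss_zero: "emeasure P {x. loss x = 0} = 0"
    and nn_integral_implicit_max_law_frechet: "\<And>n a g. n \<ge> 1 \<Longrightarrow> g \<in> borel_measurable borel \<Longrightarrow>
      (\<integral>\<^sup>+x. g x \<partial>implicit_max_law f P n a) =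
      (\<integral>\<^sup>+x. of_nat n * (g (x /\<^sub>R a) * ennreal (frechet_weight C \<alpha> x) ^ (n - 1)) \<partial>P)"
proof -
  interpret P: prob_space P by fact
  note [measurable_cong] = P(2)
  have "measure P {x. loss x = 0} \<le> 0"
  proof (rule tendsto_lowerbound)
    show "((\<lambda>t. exp (- (C * t powr - \<alpha>))) \<longlongrightarrow> 0) (at_right 0)"
      using C by real_asymp
    show "\<forall>\<^sub>F t in at_right 0. measure P {x. loss x = 0} \<le> exp (- (C * t powr - \<alpha>))"
      unfolding eventually_at_right_field
    proof (intro exI[of _ 1] conjI allI impI)
      fix t :: real assume t: "0 < t" "t < 1"
      have "measure P {x. loss x = 0} \<le> measure P {x. loss x \<le> t}"
        using t by (intro P.finite_measure_mono) (auto simp: P)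
      with F[OF t(1)] show "measure P {x. loss x = 0} \<le> exp (- (C * t powr - \<alpha>))"
        by simp
    qed simp
  qed simp
  then have "measure P {x. loss x = 0} = 0"
    by (simp add: antisym)
  then show null: "emeasure P {x. loss x = 0} = 0"
    by (simp add: P.emeasure_eq_measure)
  have less: "measure P {x. loss x < t} = exp (- (C * t powr - \<alpha>))" if t: "t > 0" for t
  proof (rule antisym)
    have "measure P {x. loss x < t} \<le> measure P {x. loss x \<le> t}"
      by (intro P.finite_measure_mono) (auto simp: P)
    with F[OF t] show "measure P {x. loss x < t} \<le> exp (- (C * t powr - \<alpha>))"
      by simp
    show "exp (- (C * t powr - \<alpha>)) \<le> measure P {x. loss x < t}"
    proof (rule tendsto_upperbound)
      show "((\<lambda>s. exp (- (C * s powr - \<alpha>))) \<longlongrightarrow> exp (- (C * t powr - \<alpha>))) (at_left t)"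
        using t by (intro tendsto_intros) auto
      show "\<forall>\<^sub>F s in at_left t. exp (- (C * s powr - \<alpha>)) \<le> measure P {x. loss x < t}"
        unfolding eventually_at_left_field
      proof (intro exI[of _ 0] conjI allI impI)
        fix s :: real assume s: "0 < s" "s < t"
        have "measure P {x. loss x \<le> s} \<le> measure P {x. loss x < t}"
          using s by (intro P.finite_measure_mono) (auto simp: P)
        with F[OF s(1)] show "exp (- (C * s powr - \<alpha>)) \<le> measure P {x. loss x < t}"
          by simp
      qed (use t in simp)
    qed simp
  qed
  \<comment> \<open>The distribution function is identified with the weight only at positive levels,
    so the zero set has to be discarded first.\<close>
  have ae: "AE x in P. loss x \<noteq> 0"
    using null P by (intro AE_I[of _ _ "{x. loss x = 0}"]) auto
  fix n :: nat and a :: real and g :: "real ^ 'd \<Rightarrow> ennreal"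
  assume n: "n \<ge> 1" and g: "g \<in> borel_measurable borel"
  have "(\<integral>\<^sup>+x. of_nat n * (g (x /\<^sub>R a) * emeasure P {y. loss y < loss x} ^ (n - 1)) \<partial>P) =
      (\<integral>\<^sup>+x. of_nat n * (g (x /\<^sub>R a) * ennreal (frechet_weight C \<alpha> x) ^ (n - 1)) \<partial>P)"
    by (rule nn_integral_cong_AE, use ae in eventually_elim)
      (use loss_nonneg less in \<open>simp add: P.emeasure_eq_measure frechet_weight_def less_le\<close>)
  moreover have "(\<integral>\<^sup>+x. of_nat n * (g (x /\<^sub>R a) * emeasure P {y. loss y \<le> loss x} ^ (n - 1)) \<partial>P) =
      (\<integral>\<^sup>+x. of_nat n * (g (x /\<^sub>R a) * ennreal (frechet_weight C \<alpha> x) ^ (n - 1)) \<partial>P)"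
    by (rule nn_integral_cong_AE, use ae in eventually_elim)
      (use loss_nonneg F in \<open>simp add: P.emeasure_eq_measure frechet_weight_def less_le\<close>)
  ultimately show "(\<integral>\<^sup>+x. g x \<partial>implicit_max_law f P n a) =
      (\<integral>\<^sup>+x. of_nat n * (g (x /\<^sub>R a) * ennreal (frechet_weight C \<alpha> x) ^ (n - 1)) \<partial>P)"
    using nn_integral_implicit_max_law_bounds[OF P n g, of a] by (intro antisym) simp_all
qed

text \<open>For \<open>c = n powr (1/\<alpha>)\<close> the factor \<open>n w\<^sup>n\<close> in the density of the implicit maximum becomes
  \<open>n w(x/c)\<close>, and scaling of \<open>\<kappa>\<close> absorbs the \<open>n\<close>.\<close>
lemma implicit_max_law_eq_if_scaling:
  assumes \<kappa>: "sets \<kappa> = sets borel"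
    and scaling: "\<And>c g. c > 0 \<Longrightarrow> g \<in> borel_measurable borel \<Longrightarrow>
      (\<integral>\<^sup>+x. g (x /\<^sub>R c) \<partial>\<kappa>) = ennreal (c powr - \<alpha>) * (\<integral>\<^sup>+x. g x \<partial>\<kappa>)"
    and P: "P = density \<kappa> (\<lambda>x. ennreal (frechet_weight C \<alpha> x))" "prob_space P"
    and C: "C > 0" "\<alpha> > 0"
    and F: "\<And>t. t > 0 \<Longrightarrow> measure P {x. loss x \<le> t} = exp (- (C * t powr - \<alpha>))"
    and n: "n \<ge> 1"
  shows "implicit_max_law f P n (real n powr (1 / \<alpha>)) = P"
proof (rule measure_eqI)
  note [measurable_cong] = \<kappa>
  have sP: "sets P = sets borel"
    using P \<kappa> by simp
  let ?a = "real n powr (1 / \<alpha>)" and ?w = "\<lambda>x. ennreal (frechet_weight C \<alpha> x)"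
  have a: "?a > 0"
    using n by simp
  show "sets (implicit_max_law f P n ?a) = sets P"
    using sets_implicit_max_law[OF P(2) sP n] sP by simp
  fix X assume "X \<in> sets (implicit_max_law f P n ?a)"
  then have X [measurable]: "X \<in> sets borel"
    using sets_implicit_max_law[OF P(2) sP n] by simp
  have "emeasure (implicit_max_law f P n ?a) X = (\<integral>\<^sup>+x. indicator X x \<partial>implicit_max_law f P n ?a)"
    using X sets_implicit_max_law[OF P(2) sP n] by simp
  also have "\<dots> = (\<integral>\<^sup>+x. of_nat n * (indicator X (x /\<^sub>R ?a) * ?w x ^ (n - 1)) \<partial>P)"
    using n by (intro nn_integral_implicit_max_law_frechet[OF P(2) sP C F]) auto
  also have "\<dots> = (\<integral>\<^sup>+x. ?w x * (of_nat n * (indicator X (x /\<^sub>R ?a) * ?w x ^ (n - 1))) \<partial>\<kappa>)"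
    unfolding P(1) by (rule nn_integral_density) measurable
  also have "\<dots> = (\<integral>\<^sup>+x. of_nat n * (indicator X (x /\<^sub>R ?a) * ?w (x /\<^sub>R ?a)) \<partial>\<kappa>)"
  proof (rule nn_integral_cong)
    fix x
    have "?w (x /\<^sub>R ?a) = ?w x * ?w x ^ (n - 1)"
      using n C by (simp add: frechet_weight_scale power_eq_if[of _ n] ennreal_power flip: ennreal_mult)
    then show "?w x * (of_nat n * (indicator X (x /\<^sub>R ?a) * ?w x ^ (n - 1))) =
        of_nat n * (indicator X (x /\<^sub>R ?a) * ?w (x /\<^sub>R ?a))"
      by (simp add: mult_ac)
  qed
  also have "\<dots> = of_nat n * (\<integral>\<^sup>+x. (\<lambda>x. indicator X x * ?w x) (x /\<^sub>R ?a) \<partial>\<kappa>)"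
    by (subst nn_integral_cmult) auto
  also have "\<dots> = of_nat n * (ennreal (?a powr - \<alpha>) * (\<integral>\<^sup>+x. indicator X x * ?w x \<partial>\<kappa>))"
    using a by (subst scaling) auto
  also have "?a powr - \<alpha> = 1 / real n"
    using n C by (simp add: powr_powr powr_minus divide_inverse)
  also have "of_nat n * (ennreal (1 / real n) * (\<integral>\<^sup>+x. indicator X x * ?w x \<partial>\<kappa>)) = (\<integral>\<^sup>+x. indicator X x * ?w x \<partial>\<kappa>)"
  proof -
    have "of_nat n * ennreal (1 / real n) = 1"
      using n by (simp add: ennreal_of_nat_eq_real_of_nat flip: ennreal_mult)
    then show ?thesis
      by (simp flip: mult.assoc)
  qed
  also have "\<dots> = emeasure P X"
    using \<kappa> unfolding P(1) by (subst emeasure_density) (auto simp: mult.commute)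
  finally show "emeasure (implicit_max_law f P n ?a) X = emeasure P X" .
qed

section \<open>Stable laws are extreme value distributions\<close>

text \<open>The candidate for the limit measure \<open>\<mu>\<close>, viewed on \<open>\<real>\<^sup>d\<close>.\<close>
definition unweighted :: "real \<Rightarrow> real \<Rightarrow> (real ^ 'd) measure \<Rightarrow> (real ^ 'd) measure" where
  "unweighted C \<alpha> P = density P (\<lambda>x. ennreal (exp (C * loss x powr - \<alpha>)))"

lemma sets_unweighted [simp, measurable_cong]: "sets (unweighted C \<alpha> P) = sets P"
  by (simp add: unweighted_def)

lemma open_loss_gt: "open {x. s < loss x}"
  using continuous_loss by (intro open_Collect_less) auto

lemma compl_loss_pos: "- {x. 0 < loss x} = {x. loss x = 0}"
  using loss_nonneg by (auto simp: not_less order_antisym)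

text \<open>The open exhaustion with which \<open>measure_eqI_test_functions\<close> is applied to
  measures carried by \<open>{x. 0 < loss x}\<close>; the origin is a point outside it.\<close>

lemma exhaustion_loss_gt:
  shows "incseq (\<lambda>i. {x. 1 / real (Suc i) < loss x})"
    and "(\<Union>i. {x. 1 / real (Suc i) < loss x}) = {x. 0 < loss x}"
    and "{x. 0 < loss x} \<noteq> UNIV"
proof -
  show "incseq (\<lambda>i. {x. 1 / real (Suc i) < loss x})"
  proof (rule incseq_SucI, rule subsetI)
    fix i x assume "x \<in> {x. 1 / real (Suc i) < loss x}"
    moreover have "1 / real (Suc (Suc i)) \<le> 1 / real (Suc i)"
      by (intro divide_left_mono) auto
    ultimately show "x \<in> {x. 1 / real (Suc (Suc i)) < loss x}"
      by simp
  qed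
  show "(\<Union>i. {x. 1 / real (Suc i) < loss x}) = {x. 0 < loss x}"
  proof (intro equalityI subsetI)
    fix x assume "x \<in> {x. 0 < loss x}"
    then obtain i where "1 / real (Suc i) < loss x"
      using nat_approx_posE[of "loss x"] by auto
    then show "x \<in> (\<Union>i. {x. 1 / real (Suc i) < loss x})"
      by blast
  next
    fix x assume "x \<in> (\<Union>i. {x. 1 / real (Suc i) < loss x})"
    then obtain i where "1 / real (Suc i) < loss x"
      by blast
    then show "x \<in> {x. 0 < loss x}"
      using less_trans[of 0 "1 / real (Suc i)" "loss x"] by simp
  qed
  have "(0 :: real ^ 'd) \<notin> {x. 0 < loss x}"
    by simp
  then show "{x. 0 < loss x} \<noteq> UNIV"
    by blast
qed

lemma loss_gt_on_compact:
  assumes "compact K" "K \<subseteq> {x. 0 < loss x}"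
  obtains s t where "0 < s" "\<And>x. x \<in> K \<Longrightarrow> s \<le> loss x" "\<And>x. x \<in> K \<Longrightarrow> loss x \<le> t"
proof (cases "K = {}")
  case True
  then show ?thesis using that[of 1] by simp
next
  case False
  obtain x where "x \<in> K" "\<And>y. y \<in> K \<Longrightarrow> loss x \<le> loss y"
    using continuous_attains_inf[OF assms(1) False continuous_on_subset[OF continuous_loss]] by auto
  moreover obtain y where "\<And>z. z \<in> K \<Longrightarrow> loss z \<le> loss y"
    using continuous_attains_sup[OF assms(1) False continuous_on_subset[OF continuous_loss]] by auto
  ultimately show ?thesis
    using that[of "loss x" "loss y"] assms(2) by auto
qed

context
  fixes P :: "(real ^ 'd) measure" and C \<alpha> :: real
  assumes P: "prob_space P" "sets P = sets borel" and C: "C > 0" "\<alpha> > 0"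
    and F: "\<And>t. t > 0 \<Longrightarrow> measure P {x. loss x \<le> t} = exp (- (C * t powr - \<alpha>))"
begin

lemma nn_integral_unweighted:
  "g \<in> borel_measurable borel \<Longrightarrow>
    (\<integral>\<^sup>+x. g x \<partial>unweighted C \<alpha> P) = (\<integral>\<^sup>+x. ennreal (exp (C * loss x powr - \<alpha>)) * g x \<partial>P)"
  unfolding unweighted_def using P by (subst nn_integral_density) (auto cong: measurable_cong_sets)

lemma density_unweighted:
  "density (unweighted C \<alpha> P) (\<lambda>x. ennreal (frechet_weight C \<alpha> x)) = P"
proof -
  have "density (unweighted C \<alpha> P) (\<lambda>x. ennreal (frechet_weight C \<alpha> x)) =
      density P (\<lambda>x. ennreal (exp (C * loss x powr - \<alpha>)) * ennreal (frechet_weight C \<alpha> x))"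
    unfolding unweighted_def using P by (intro density_density_eq) (auto cong: measurable_cong_sets)
  also have "(\<lambda>x. ennreal (exp (C * loss x powr - \<alpha>)) * ennreal (frechet_weight C \<alpha> x)) = (\<lambda>_. 1)"
    by (simp add: frechet_weight_def exp_minus flip: ennreal_mult)
  finally show ?thesis
    by (simp add: density_1)
qed

text \<open>The density explodes only as the loss tends to 0; above level \<open>s\<close> it is
  bounded by \<open>exp (C * s powr - \<alpha>)\<close>.\<close>

lemma emeasure_unweighted_gt:
  assumes s: "s > 0"
  shows "emeasure (unweighted C \<alpha> P) {x. s < loss x} < \<infinity>"
proof -
  interpret prob_space P by fact
  have "emeasure (unweighted C \<alpha> P) {x. s < loss x} =
      (\<integral>\<^sup>+x. ennreal (exp (C * loss x powr - \<alpha>)) * indicator {x. s < loss x} x \<partial>P)"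
    using P nn_integral_unweighted[of "indicator {x. s < loss x}"] by simp
  also have "\<dots> \<le> (\<integral>\<^sup>+x. ennreal (exp (C * s powr - \<alpha>)) \<partial>P)"
  proof (rule nn_integral_mono)
    fix x
    have "loss x powr - \<alpha> \<le> s powr - \<alpha>" if "s < loss x"
      using that s C by (intro powr_mono2') auto
    then show "ennreal (exp (C * loss x powr - \<alpha>)) * indicator {x. s < loss x} x \<le> ennreal (exp (C * s powr - \<alpha>))"
      using C by (auto simp: indicator_def intro!: ennreal_leI)
  qed
  also have "\<dots> < \<infinity>"
    by (simp add: emeasure_space_1)
  finally show ?thesis .
qed

lemma emeasure_unweighted_zero: "emeasure (unweighted C \<alpha> P) {x. loss x = 0} = 0"
proof -
  have "emeasure P {x. loss x = 0} = 0"
    using emeasure_loss_zero[OF P C F] .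
  then have "AE x in P. loss x \<noteq> 0"
    using P by (intro AE_I[of _ _ "{x. loss x = 0}"]) auto
  then have "(\<integral>\<^sup>+x. ennreal (exp (C * loss x powr - \<alpha>)) * indicator {x. loss x = 0} x \<partial>P) = (\<integral>\<^sup>+x. 0 \<partial>P)"
    by (intro nn_integral_cong_AE) auto
  then show ?thesis
    using P nn_integral_unweighted[of "indicator {x. loss x = 0}"] by simp
qed

section \<open>Scaling of the unweighted measure\<close>

context
  assumes stable: "\<And>n. n \<ge> 1 \<Longrightarrow> implicit_max_law f P n (real n powr (1 / \<alpha>)) = P"
begin

text \<open>Stability is tested on \<open>g\<close> times the density of the unweighted measure.
  After rescaling that density is the inverse of \<open>?w x ^ n\<close>; the \<open>n - 1\<close>
  competitors cancel all but one factor, and the density at \<open>x\<close> itself remains.\<close>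

lemma unweighted_scaling_nat:
  assumes n: "n \<ge> 1" and g [measurable]: "g \<in> borel_measurable borel"
  shows "(\<integral>\<^sup>+x. g x \<partial>unweighted C \<alpha> P) = of_nat n * (\<integral>\<^sup>+x. g (x /\<^sub>R real n powr (1 / \<alpha>)) \<partial>unweighted C \<alpha> P)"
proof -
  note [measurable_cong] = P(2)
  let ?a = "real n powr (1 / \<alpha>)" and ?w = "\<lambda>x. frechet_weight C \<alpha> x"
  let ?e = "\<lambda>x. exp (C * loss x powr - \<alpha>)"
  have e: "?e x = inverse (?w x)" for x
    by (simp add: frechet_weight_def exp_minus)
  have "(\<integral>\<^sup>+x. g x \<partial>unweighted C \<alpha> P) = (\<integral>\<^sup>+x. ennreal (?e x) * g x \<partial>P)"
    by (rule nn_integral_unweighted) fact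
  also have "\<dots> = (\<integral>\<^sup>+x. ennreal (?e x) * g x \<partial>implicit_max_law f P n ?a)"
    by (simp add: stable[OF n])
  also have "\<dots> = (\<integral>\<^sup>+x. of_nat n * ((ennreal (?e (x /\<^sub>R ?a)) * g (x /\<^sub>R ?a)) * ennreal (?w x) ^ (n - 1)) \<partial>P)"
    by (rule nn_integral_implicit_max_law_frechet[OF P C F n]) measurable
  also have "\<dots> = (\<integral>\<^sup>+x. of_nat n * (ennreal (?e x) * g (x /\<^sub>R ?a)) \<partial>P)"
  proof (rule nn_integral_cong)
    fix x
    have "?w (x /\<^sub>R ?a) = ?w x * ?w x ^ (n - 1)"
      using n C by (simp add: frechet_weight_scale power_eq_if[of _ n])
    then have "?e (x /\<^sub>R ?a) * ?w x ^ (n - 1) = ?e x"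
      unfolding e using frechet_weight_pos[of C \<alpha> x] by (simp add: field_simps)
    then have eq: "ennreal (?e (x /\<^sub>R ?a)) * ennreal (?w x) ^ (n - 1) = ennreal (?e x)"
      by (simp add: ennreal_power flip: ennreal_mult)
    show "of_nat n * ((ennreal (?e (x /\<^sub>R ?a)) * g (x /\<^sub>R ?a)) * ennreal (?w x) ^ (n - 1)) =
        of_nat n * (ennreal (?e x) * g (x /\<^sub>R ?a))"
      unfolding eq[symmetric] by (simp only: mult_ac)
  qed
  also have "\<dots> = of_nat n * (\<integral>\<^sup>+x. ennreal (?e x) * g (x /\<^sub>R ?a) \<partial>P)"
    by (rule nn_integral_cmult) measurable
  also have "(\<integral>\<^sup>+x. ennreal (?e x) * g (x /\<^sub>R ?a) \<partial>P) = (\<integral>\<^sup>+x. g (x /\<^sub>R ?a) \<partial>unweighted C \<alpha> P)"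
    by (rule nn_integral_unweighted[symmetric]) measurable
  finally show ?thesis .
qed

text \<open>For \<open>q = m / n\<close> the scale of \<open>n\<close> times
  \<open>q powr (1 / \<alpha>)\<close> is the scale of \<open>m\<close>, so the integer identities
  for \<open>n\<close> and for \<open>m\<close> meet in the same integral.\<close>

lemma unweighted_scaling_rat:
  assumes q: "q > 0" "q \<in> \<rat>" and g [measurable]: "g \<in> borel_measurable borel"
  shows "(\<integral>\<^sup>+x. g (x /\<^sub>R q powr (1 / \<alpha>)) \<partial>unweighted C \<alpha> P) =
    ennreal (1 / q) * (\<integral>\<^sup>+x. g x \<partial>unweighted C \<alpha> P)"
proof -
  obtain m n where mn: "n \<noteq> 0" "\<bar>q\<bar> = real m / real n"
    using q(2) by (rule Rats_abs_nat_div_natE)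
  with q have mn: "m \<ge> 1" "n \<ge> 1" "q = real m / real n"
    by (auto simp: Suc_le_eq intro!: gr0I)
  let ?a = "\<lambda>n. real n powr (1 / \<alpha>)" and ?I = "\<lambda>g. \<integral>\<^sup>+x. g x \<partial>unweighted C \<alpha> P"
  have "?I (\<lambda>x. g (x /\<^sub>R q powr (1 / \<alpha>))) = of_nat n * ?I (\<lambda>x. g ((x /\<^sub>R ?a n) /\<^sub>R q powr (1 / \<alpha>)))"
    using mn by (intro unweighted_scaling_nat) auto
  also have "(\<lambda>x. g ((x /\<^sub>R ?a n) /\<^sub>R q powr (1 / \<alpha>))) = (\<lambda>x. g (x /\<^sub>R ?a m))"
    using mn by (simp add: powr_divide inverse_eq_divide)
  also have "of_nat n * ?I (\<lambda>x. g (x /\<^sub>R ?a m)) = ennreal (1 / q) * (of_nat m * ?I (\<lambda>x. g (x /\<^sub>R ?a m)))"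
    using mn by (simp add: ennreal_of_nat_eq_real_of_nat flip: mult.assoc ennreal_mult)
  also have "of_nat m * ?I (\<lambda>x. g (x /\<^sub>R ?a m)) = ?I g"
    using mn by (intro unweighted_scaling_nat[symmetric]) auto
  finally show ?thesis .
qed

text \<open>Continuity in the scale is available for continuous compactly supported functions only.
  The rational identity is therefore passed to the limit for those, read as equality of two
  measures, and applied to \<open>g\<close> afterwards.\<close>

lemma unweighted_scaling:
  assumes c: "c > 0" and g [measurable]: "g \<in> borel_measurable borel"
  shows "(\<integral>\<^sup>+x. g (x /\<^sub>R c) \<partial>unweighted C \<alpha> P) = ennreal (c powr - \<alpha>) * (\<integral>\<^sup>+x. g x \<partial>unweighted C \<alpha> P)"
proof -
  note [measurable_cong] = P(2)
  let ?\<kappa> = "unweighted C \<alpha> P" and ?W = "{x. 0 < loss x}"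
  let ?N = "scale_measure (ennreal (c powr \<alpha>)) (distr ?\<kappa> borel (\<lambda>x. x /\<^sub>R c))"
  \<comment> \<open>Approximation from above keeps \<open>r j \<ge> c\<close>, so that the rescaled
    test functions share one dominating function.\<close>
  have q: "\<exists>q. q \<in> \<rat> \<and> c powr \<alpha> < q \<and> q < c powr \<alpha> + 1 / real (Suc j)" for j
    using Rats_dense_in_real[of "c powr \<alpha>" "c powr \<alpha> + 1 / real (Suc j)"] by auto
  then obtain q where q: "\<And>j. q j \<in> \<rat>" "\<And>j. c powr \<alpha> < q j" "\<And>j. q j < c powr \<alpha> + 1 / real (Suc j)"
    by metis
  have ca: "c powr \<alpha> > 0"
    using c by simp
  have qpos: "q j > 0" for j
    using less_trans[OF ca q(2)] .
  have q_lim: "q \<longlonglongrightarrow> c powr \<alpha>"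
  proof (rule tendsto_sandwich[OF _ _ tendsto_const])
    show "(\<lambda>j. c powr \<alpha> + 1 / real (Suc j)) \<longlonglongrightarrow> c powr \<alpha>"
      by real_asymp
    show "\<forall>\<^sub>F j in sequentially. c powr \<alpha> \<le> q j"
      using q(2) by (intro always_eventually allI less_imp_le)
    show "\<forall>\<^sub>F j in sequentially. q j \<le> c powr \<alpha> + 1 / real (Suc j)"
      using q(3) by (intro always_eventually allI less_imp_le)
  qed
  define r where "r j = q j powr (1 / \<alpha>)" for j
  have r: "r \<longlonglongrightarrow> c" "c \<le> r j" "r j > 0" for j
  proof -
    have "r \<longlonglongrightarrow> (c powr \<alpha>) powr (1 / \<alpha>)"
      unfolding r_def using ca by (intro tendsto_intros q_lim) auto
    then show "r \<longlonglongrightarrow> c"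
      using c C by (simp add: powr_powr)
    have "(c powr \<alpha>) powr (1 / \<alpha>) \<le> r j"
      unfolding r_def using q(2)[of j] C by (intro powr_mono2) auto
    then show "c \<le> r j"
      using c C by (simp add: powr_powr)
    then show "r j > 0"
      using c by simp
  qed
  have test: "(\<integral>\<^sup>+x. ennreal (h x) \<partial>?\<kappa>) = (\<integral>\<^sup>+x. ennreal (h x) \<partial>?N)"
    if h: "continuous_on UNIV h" "\<And>x. 0 \<le> h x" "\<And>x. h x \<le> 1"
      and K: "compact K" "K \<subseteq> ?W" "\<And>x. x \<notin> K \<Longrightarrow> h x = 0" for h :: "real ^ 'd \<Rightarrow> real" and K
  proof -
    have [measurable]: "h \<in> borel_measurable borel"
      using h(1) by (rule borel_measurable_continuous_onI)
    obtain s T where s: "0 < s" "\<And>x. x \<in> K \<Longrightarrow> s \<le> loss x" "\<And>x. x \<in> K \<Longrightarrow> loss x \<le> T"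
      using loss_gt_on_compact[OF K(1,2)] by blast
    have lim: "(\<lambda>j. \<integral>\<^sup>+x. ennreal (h (x /\<^sub>R r j)) \<partial>?\<kappa>) \<longlonglongrightarrow> (\<integral>\<^sup>+x. ennreal (h (x /\<^sub>R c)) \<partial>?\<kappa>)"
    proof (rule nn_integral_dominated_convergence[where w = "indicator {x. s * c / 2 < loss x}"])
      \<comment> \<open>If \<open>x / r j\<close> lies in \<open>K\<close>, then
        \<open>loss x \<ge> s * r j \<ge> s * c\<close>; halving makes this strict and gives a set
        of finite mass.\<close>
      show "AE x in ?\<kappa>. ennreal (h (x /\<^sub>R r j)) \<le> indicator {x. s * c / 2 < loss x} x" for j
      proof (rule AE_I2)
        fix x
        show "ennreal (h (x /\<^sub>R r j)) \<le> indicator {x. s * c / 2 < loss x} x"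
        proof (cases "x /\<^sub>R r j \<in> K")
          case True
          then have "s \<le> loss x / r j"
            using s(2)[OF True] r(3)[of j] by (simp add: loss_scaleR divide_inverse mult.commute)
          then have "s * r j \<le> loss x"
            using r(3)[of j] by (simp add: pos_le_divide_eq)
          moreover have "s * c \<le> s * r j"
            using r(2)[of j] s(1) by (intro mult_left_mono) auto
          moreover have "s * c > 0"
            using s(1) c by simp
          ultimately have "s * c / 2 < loss x"
            by linarith
          then show ?thesis
            using h(3) by simp
        next
          case False
          then show ?thesis
            using K(3) by simp
        qed
      qed
      show "(\<integral>\<^sup>+x. indicator {x. s * c / 2 < loss x} x \<partial>?\<kappa>) < \<infinity>"
        using emeasure_unweighted_gt[of "s * c / 2"] s c P by simp
      show "AE x in ?\<kappa>. (\<lambda>j. ennreal (h (x /\<^sub>R r j))) \<longlonglongrightarrow> ennreal (h (x /\<^sub>R c))"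
      proof (rule AE_I2)
        fix x :: "real ^ 'd"
        have "(\<lambda>j. x /\<^sub>R r j) \<longlonglongrightarrow> x /\<^sub>R c"
          using c by (intro tendsto_scaleR tendsto_inverse tendsto_const r(1)) simp
        then have "(\<lambda>j. h (x /\<^sub>R r j)) \<longlonglongrightarrow> h (x /\<^sub>R c)"
          using h(1) by (intro continuous_on_tendsto_compose[OF h(1)]) auto
        then show "(\<lambda>j. ennreal (h (x /\<^sub>R r j))) \<longlonglongrightarrow> ennreal (h (x /\<^sub>R c))"
          by (rule tendsto_ennrealI)
      qed
    qed measurable
    let ?I = "\<integral>\<^sup>+x. ennreal (h x) \<partial>?\<kappa>"
    have "(\<lambda>j. ennreal (1 / q j) * ?I) \<longlonglongrightarrow> ennreal (1 / c powr \<alpha>) * ?I"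
      using ca by (intro tendsto_mult_ennreal tendsto_ennrealI tendsto_divide tendsto_const q_lim) auto
    moreover have "ennreal (1 / q j) * ?I = (\<integral>\<^sup>+x. ennreal (h (x /\<^sub>R r j)) \<partial>?\<kappa>)" for j
      unfolding r_def using unweighted_scaling_rat[OF qpos q(1), of "\<lambda>x. ennreal (h x)" j] by simp
    ultimately have "(\<integral>\<^sup>+x. ennreal (h (x /\<^sub>R c)) \<partial>?\<kappa>) = ennreal (1 / c powr \<alpha>) * ?I"
      using lim LIMSEQ_unique by auto
    moreover have "(\<integral>\<^sup>+x. ennreal (h x) \<partial>?N) = ennreal (c powr \<alpha>) * (\<integral>\<^sup>+x. ennreal (h (x /\<^sub>R c)) \<partial>?\<kappa>)"
      by (simp add: nn_integral_scale_measure nn_integral_distr)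
    moreover have "ennreal (c powr \<alpha>) * ennreal (1 / c powr \<alpha>) = 1"
      using ca by (simp flip: ennreal_mult)
    ultimately show ?thesis
      by (simp flip: mult.assoc)
  qed
  have "?\<kappa> = ?N"
  proof (rule measure_eqI_test_functions[where A = "\<lambda>i. {x. 1 / real (Suc i) < loss x}" and W = ?W])
    show "emeasure ?\<kappa> (- ?W) = 0"
      unfolding compl_loss_pos by (rule emeasure_unweighted_zero)
    have "(\<lambda>x. x /\<^sub>R c) -` {x. loss x = 0} \<inter> space ?\<kappa> = {x. loss x = 0}"
      using c P sets_eq_imp_space_eq[of ?\<kappa> borel] by (auto simp: loss_scaleR)
    then show "emeasure ?N (- ?W) = 0"
      unfolding compl_loss_pos using emeasure_unweighted_zero by (simp add: emeasure_distr)
  qed (use P open_loss_gt emeasure_unweighted_gt test exhaustion_loss_gt in simp_all)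
  then have "(\<integral>\<^sup>+x. g x \<partial>?\<kappa>) = (\<integral>\<^sup>+x. g x \<partial>?N)"
    by (rule arg_cong)
  also have "\<dots> = ennreal (c powr \<alpha>) * (\<integral>\<^sup>+x. g (x /\<^sub>R c) \<partial>?\<kappa>)"
    by (simp add: nn_integral_scale_measure nn_integral_distr)
  finally have "(\<integral>\<^sup>+x. g x \<partial>?\<kappa>) = ennreal (c powr \<alpha>) * (\<integral>\<^sup>+x. g (x /\<^sub>R c) \<partial>?\<kappa>)" .
  moreover have "ennreal (c powr - \<alpha>) * ennreal (c powr \<alpha>) = 1"
    using c by (simp add: powr_minus flip: ennreal_mult)
  ultimately show ?thesis
    by (simp flip: mult.assoc)
qed

end
end
end

section \<open>From the real space to the compactified space\<close>

lemma integral_scale_measure: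
  fixes g :: "'a \<Rightarrow> real"
  assumes [measurable]: "g \<in> borel_measurable M"
  shows "(\<integral>x. g x \<partial>scale_measure (of_nat n) M) = real n * (\<integral>x. g x \<partial>M)"
proof -
  have "scale_measure (of_nat n) M = density M (\<lambda>_. ennreal (real n))"
    by (rule measure_eqI) (simp_all add: emeasure_density nn_integral_cmult_indicator ennreal_of_nat_eq_real_of_nat)
  then show ?thesis
    by (simp add: integral_density)
qed

context homogeneous_loss
begin

text \<open>The image measure lives on \<open>range vec_ereal\<close>, so points at infinity get no
  mass; the restriction yields the space on which \<open>regularly_varying_law\<close> expects its
  limit.\<close>

definition extended :: "(real ^ 'd) measure \<Rightarrow> (ereal ^ 'd) measure" where
  "extended \<kappa> = restrict_space (distr \<kappa> borel vec_ereal) (- {x. f x = 0})"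

lemma borel_measurable_f [measurable]: "f \<in> borel_measurable borel"
  using cont by (rule borel_measurable_continuous_onI)

lemma sets_compl_zero: "- {x. f x = 0} \<in> sets borel"
  using borel_measurable_f by measurable

lemma sets_extended: "sets (extended \<kappa>) = sets (restrict_space borel (- {x. f x = 0}))"
  by (simp add: extended_def sets_restrict_space)

lemma space_extended: "space (extended \<kappa>) = - {x. f x = 0}"
  using sets_eq_imp_space_eq[OF sets_extended] by (simp add: space_restrict_space)

lemma sets_extended_iff: "A \<in> sets (extended \<kappa>) \<longleftrightarrow> A \<in> sets borel \<and> A \<subseteq> - {x. f x = 0}"
  using sets_compl_zero by (subst sets_extended, subst sets_restrict_space_iff) auto

lemma emeasure_extended:
  assumes "sets \<kappa> = sets borel" "A \<in> sets (extended \<kappa>)"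
  shows "emeasure (extended \<kappa>) A = emeasure \<kappa> (vec_ereal -` A)"
proof -
  note [measurable_cong] = assms(1)
  have A: "A \<in> sets borel" "A \<subseteq> - {x. f x = 0}"
    using assms(2) by (simp_all add: sets_extended_iff)
  then have "emeasure (extended \<kappa>) A = emeasure (distr \<kappa> borel vec_ereal) A"
    unfolding extended_def using sets_compl_zero by (subst emeasure_restrict_space) auto
  also have "\<dots> = emeasure \<kappa> (vec_ereal -` A)"
    using A assms(1) sets_eq_imp_space_eq[OF assms(1)] by (subst emeasure_distr) auto
  finally show ?thesis .
qed

lemma loss_eq_0_iff: "loss x = 0 \<longleftrightarrow> f (vec_ereal x) = 0"
  by (simp add: f_vec_ereal ennreal_eq_0_iff order_antisym_conv)

text \<open>On a nonempty compact set off the zero set \<open>f\<close> attains a positive minimum.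
  That minimum may be infinite, so a finite level strictly below it is chosen.\<close>

lemma compact_f_ge:
  assumes "compact K" "K \<subseteq> - {x. f x = 0}"
  obtains s where "s > 0" "K \<subseteq> {x. ennreal s < f x}"
proof (cases "K = {}")
  case True
  then show ?thesis using that[of 1] by simp
next
  case False
  obtain x where x: "x \<in> K" "\<And>y. y \<in> K \<Longrightarrow> f x \<le> f y"
    using continuous_attains_inf[OF assms(1) False continuous_on_subset[OF cont]] by auto
  then have "0 < f x"
    using assms(2) by (auto simp: zero_less_iff_neq_zero)
  then obtain s where s: "0 < s" "s < f x"
    using dense by blast
  have "s < \<top>"
    using s(2) top_greatest by (rule less_le_trans)
  with s have "ennreal (enn2real s) = s" "enn2real s > 0"
    by (auto simp: enn2real_positive_iff)
  then show ?thesis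
    using that[of "enn2real s"] s x(2) by (auto intro: less_le_trans)
qed

lemma range_vec_ereal: "range (vec_ereal :: real ^ 'd \<Rightarrow> _) = {x. \<forall>i. x $ i \<in> {-\<infinity> <..< \<infinity>}}"
proof (intro equalityI subsetI)
  fix x :: "ereal ^ 'd" assume x: "x \<in> {x. \<forall>i. x $ i \<in> {-\<infinity> <..< \<infinity>}}"
  have "\<bar>x $ i\<bar> \<noteq> \<infinity>" for i
    using x by (cases "x $ i") (auto dest!: spec[of _ i])
  then have "x = vec_ereal (\<chi> i. real_of_ereal (x $ i))"
    by (simp add: vec_ereal_def vec_eq_iff ereal_real)
  then show "x \<in> range vec_ereal" by blast
qed (auto simp: vec_ereal_def)

lemma open_range_vec_ereal: "open (range (vec_ereal :: real ^ 'd \<Rightarrow> _))"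
  unfolding range_vec_ereal by (intro open_vector_box allI open_greaterThanLessThan)

lemma sets_range_vec_ereal: "range (vec_ereal :: real ^ 'd \<Rightarrow> _) \<in> sets borel"
  using open_range_vec_ereal by simp

lemma vec_ereal_inject: "vec_ereal x = vec_ereal y \<longleftrightarrow> x = y"
  by (simp add: vec_ereal_def vec_eq_iff)

lemma scale_ereal_inverse:
  assumes "c > 0"
  shows "scale_ereal c (scale_ereal (1 / c) x) = x" "scale_ereal (1 / c) (scale_ereal c x) = x"
  using assms by (simp_all add: scale_ereal_def vec_eq_iff one_ereal_def[symmetric] flip: mult.assoc)

lemma f_scale_ereal: "c > 0 \<Longrightarrow> f (scale_ereal c x) = ennreal c * f x"
  using hom by (simp add: one_homogeneous_def)

lemma f_scale_ereal_eq_0_iff: "c > 0 \<Longrightarrow> f (scale_ereal c x) = 0 \<longleftrightarrow> f x = 0"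
  by (simp add: f_scale_ereal ennreal_eq_0_iff)

lemma scale_ereal_image: "c > 0 \<Longrightarrow> scale_ereal c ` A = scale_ereal (1 / c) -` A"
  by (auto simp: scale_ereal_inverse intro!: image_eqI)

lemma measurable_scale_ereal [measurable]: "(scale_ereal c :: ereal ^ 'd \<Rightarrow> _) \<in> borel_measurable borel"
proof (rule borel_measurable_continuous_onI)
  show "continuous_on UNIV (scale_ereal c :: ereal ^ 'd \<Rightarrow> _)"
    unfolding continuous_on_def
  proof (intro ballI vec_tendstoI)
    fix x :: "ereal ^ 'd" and i
    show "((\<lambda>x. scale_ereal c x $ i) \<longlongrightarrow> scale_ereal c x $ i) (at x within UNIV)"
      by (simp add: scale_ereal_def) (intro tendsto_cmult_ereal tendsto_intros; simp)
  qed
qed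

text \<open>A test function is controlled only off the zero set of \<open>f\<close>; the indicator
  removes its arbitrary values there.\<close>

lemma measurable_test_function:
  fixes h :: "ereal ^ 'd \<Rightarrow> real"
  assumes "continuous_on (- {x. f x = 0}) h"
  shows "(\<lambda>x. indicator (- {x. f x = 0}) x * h x) \<in> borel_measurable borel"
  using borel_measurable_continuous_on_restrict[OF assms] sets_compl_zero
  by (subst (asm) borel_measurable_restrict_space_iff) auto

lemma integral_restrict_compl_zero:
  fixes h :: "ereal ^ 'd \<Rightarrow> real"
  assumes "sets N = sets borel"
  shows "(\<integral>x. h x \<partial>restrict_space N (- {x. f x = 0})) = (\<integral>x. indicator (- {x. f x = 0}) x * h x \<partial>N)"
  using assms sets_compl_zero sets_eq_imp_space_eq[OF assms]
  by (subst integral_restrict_space) auto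

lemma integral_test_function:
  fixes h :: "ereal ^ 'd \<Rightarrow> real"
  assumes Q [measurable_cong]: "sets Q = sets borel" and h: "continuous_on (- {x. f x = 0}) h"
  shows "(\<integral>x. h x \<partial>scale_measure (of_nat n)
      (restrict_space (distr Q borel (\<lambda>x. vec_ereal (x /\<^sub>R a))) (- {x. f x = 0}))) =
    real n * (\<integral>x. indicator (- {x. f x = 0}) (vec_ereal (x /\<^sub>R a)) * h (vec_ereal (x /\<^sub>R a)) \<partial>Q)"
proof -
  let ?D = "{x. f x = 0}"
  have "h \<in> borel_measurable (restrict_space (distr Q borel (\<lambda>x. vec_ereal (x /\<^sub>R a))) (- ?D))"
    using borel_measurable_continuous_on_restrict[OF h]
    by (subst measurable_cong_sets[OF _ refl]) (auto simp: sets_restrict_space)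
  then show ?thesis
    using integral_distr[OF _ measurable_test_function[OF h], of "\<lambda>x. vec_ereal (x /\<^sub>R a)" Q]
    by (simp add: integral_scale_measure integral_restrict_compl_zero)
qed

lemma scaling_property_extended:
  assumes \<kappa>: "sets \<kappa> = sets borel"
    and scaling: "\<And>c g. c > 0 \<Longrightarrow> g \<in> borel_measurable borel \<Longrightarrow>
      (\<integral>\<^sup>+x. g (x /\<^sub>R c) \<partial>\<kappa>) = ennreal (c powr - \<alpha>) * (\<integral>\<^sup>+x. g x \<partial>\<kappa>)"
  shows "scaling_property \<alpha> (extended \<kappa>)"
  unfolding scaling_property_def
proof (intro allI impI ballI)
  fix c :: real and A assume c: "c > 0" and A: "A \<in> sets (extended \<kappa>)"
  note [measurable_cong] = \<kappa>
  have Ab: "A \<in> sets borel" and A0: "A \<subseteq> - {x. f x = 0}"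
    using A by (simp_all add: sets_extended_iff)
  have cA: "scale_ereal c ` A \<in> sets (extended \<kappa>)"
  proof -
    have "scale_ereal (1 / c) -` A \<inter> space borel \<in> sets borel"
      using Ab by (intro measurable_sets[OF measurable_scale_ereal])
    then have "scale_ereal c ` A \<in> sets borel"
      using c by (simp add: scale_ereal_image)
    moreover have "scale_ereal c ` A \<subseteq> - {x. f x = 0}"
      using A0 c by (auto simp: f_scale_ereal_eq_0_iff)
    ultimately show ?thesis
      by (simp add: sets_extended_iff)
  qed
  have [measurable]: "vec_ereal -` A \<in> sets (borel :: (real ^ 'd) measure)"
    using measurable_sets[OF borel_measurable_vec_ereal Ab] by simp
  have "vec_ereal -` (scale_ereal c ` A) = {x. x /\<^sub>R c \<in> vec_ereal -` A}"
    using c by (auto simp: scale_ereal_image scale_vec_ereal inverse_eq_divide)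
  then have "emeasure (extended \<kappa>) (scale_ereal c ` A) = emeasure \<kappa> {x. x /\<^sub>R c \<in> vec_ereal -` A}"
    using emeasure_extended[OF \<kappa> cA] by simp
  also have "\<dots> = (\<integral>\<^sup>+x. indicator {x. x /\<^sub>R c \<in> vec_ereal -` A} x \<partial>\<kappa>)"
  proof (rule nn_integral_indicator[symmetric])
    have "{x. x /\<^sub>R c \<in> vec_ereal -` A} = (\<lambda>x. x /\<^sub>R c) -` (vec_ereal -` A) \<inter> space borel"
      by auto
    also have "\<dots> \<in> sets borel"
      by (rule measurable_sets[of _ borel borel]) measurable
    finally show "{x. x /\<^sub>R c \<in> vec_ereal -` A} \<in> sets \<kappa>"
      by (simp only: \<kappa>)
  qed
  also have "\<dots> = (\<integral>\<^sup>+x. indicator (vec_ereal -` A) (x /\<^sub>R c) \<partial>\<kappa>)"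
    by (intro nn_integral_cong) (simp add: indicator_def)
  also have "\<dots> = ennreal (c powr - \<alpha>) * (\<integral>\<^sup>+x. indicator (vec_ereal -` A) x \<partial>\<kappa>)"
    using c by (intro scaling) auto
  also have "(\<integral>\<^sup>+x. indicator (vec_ereal -` A) x \<partial>\<kappa>) = emeasure (extended \<kappa>) A"
    using \<kappa> emeasure_extended[OF \<kappa> A] by simp
  finally show "emeasure (extended \<kappa>) (scale_ereal c ` A) = ennreal (c powr - \<alpha>) * emeasure (extended \<kappa>) A" .
qed

lemma regularly_varying_seq_powr: "regularly_varying_seq (\<lambda>n. real n powr \<rho>) \<rho>"
  unfolding regularly_varying_seq_def
proof (intro conjI allI impI)
  fix c :: real assume c: "c > 0"
  have "(\<lambda>n. real (nat \<lfloor>c * real n\<rfloor>) / real n) \<longlonglongrightarrow> c"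
  proof (rule tendsto_sandwich)
    show "(\<lambda>n. c - 1 / real n) \<longlonglongrightarrow> c" "(\<lambda>n. c) \<longlonglongrightarrow> c"
      by real_asymp+
    show "\<forall>\<^sub>F n in sequentially. c - 1 / real n \<le> real (nat \<lfloor>c * real n\<rfloor>) / real n"
      using eventually_gt_at_top[of 0]
    proof eventually_elim
      case (elim n)
      have "c * real n - 1 \<le> real (nat \<lfloor>c * real n\<rfloor>)"
        by linarith
      then have "(c * real n - 1) / real n \<le> real (nat \<lfloor>c * real n\<rfloor>) / real n"
        by (intro divide_right_mono) auto
      then show ?case
        using elim by (simp add: diff_divide_distrib)
    qed
    show "\<forall>\<^sub>F n in sequentially. real (nat \<lfloor>c * real n\<rfloor>) / real n \<le> c"
      using eventually_gt_at_top[of 0]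
    proof eventually_elim
      case (elim n)
      have "0 \<le> c * real n"
        using c by simp
      then have "real (nat \<lfloor>c * real n\<rfloor>) \<le> c * real n"
        by linarith
      then show ?case
        using elim by (simp add: pos_divide_le_eq)
    qed
  qed
  then have "(\<lambda>n. (real (nat \<lfloor>c * real n\<rfloor>) / real n) powr \<rho>) \<longlonglongrightarrow> c powr \<rho>"
    using c by (intro tendsto_powr tendsto_const) auto
  then show "(\<lambda>n. real (nat \<lfloor>c * real n\<rfloor>) powr \<rho> / real n powr \<rho>) \<longlonglongrightarrow> c powr \<rho>"
    by (simp add: powr_divide)
qed simp

text \<open>The regularly varying law is \<open>P\<close> itself, normalised by
  \<open>n powr (1 / \<alpha>)\<close>. All implicit maxima with \<open>n \<ge> 1\<close> then have
  law \<open>P\<close>, so convergence in distribution is trivial and the work lies in the vague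
  convergence.\<close>

lemma implicit_extreme_value_if_stable:
  assumes P: "prob_space P" "sets P = sets borel" and C: "C > 0" "\<alpha> > 0"
    and F: "\<And>t. t > 0 \<Longrightarrow> measure P {x. loss x \<le> t} = exp (- (C * t powr - \<alpha>))"
    and stable: "\<And>n. n \<ge> 1 \<Longrightarrow> implicit_max_law f P n (real n powr (1 / \<alpha>)) = P"
  defines "\<mu> \<equiv> extended (unweighted C \<alpha> P)"
  shows "implicit_extreme_value f \<alpha> \<mu> P"
    and "emeasure \<mu> (space \<mu> - vec_ereal ` {x. f (vec_ereal x) \<noteq> 0}) = 0"
    and "scaling_property \<alpha> \<mu>"
proof -
  interpret P: prob_space P by fact
  note [measurable_cong] = P(2)
  let ?\<kappa> = "unweighted C \<alpha> P" and ?D = "{x. f x = 0}" and ?a = "\<lambda>n. real n powr (1 / \<alpha>)"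
  have \<kappa> [measurable_cong]: "sets ?\<kappa> = sets borel"
    using P by simp
  have compact_bound: "emeasure ?\<kappa> (vec_ereal -` {x. ennreal s < f x}) < \<infinity>" if "s > 0" for s
  proof -
    have "vec_ereal -` {x. ennreal s < f x} = {x. s < loss x}"
      using that by (auto simp: f_vec_ereal ennreal_less_iff)
    then show ?thesis
      using emeasure_unweighted_gt[OF P C F that] by simp
  qed
  have f_gt: "{x. ennreal s < f x} \<in> sets (extended ?\<kappa>)" if "s > 0" for s
    by (auto simp: sets_extended_iff)
  have radon: "radon_measure_on (- ?D) \<mu>"
    unfolding radon_measure_on_def
  proof (intro conjI allI impI)
    fix K assume "compact K" "K \<subseteq> - ?D"
    then obtain s where s: "s > 0" "K \<subseteq> {x. ennreal s < f x}"
      by (rule compact_f_ge)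
    have "emeasure \<mu> K \<le> emeasure \<mu> {x. ennreal s < f x}"
      unfolding \<mu>_def using s f_gt by (intro emeasure_mono)
    also have "\<dots> < \<infinity>"
      unfolding \<mu>_def using compact_bound[OF s(1)] emeasure_extended[OF \<kappa> f_gt[OF s(1)]] by simp
    finally show "emeasure \<mu> K < \<infinity>" .
  qed (simp add: \<mu>_def sets_extended)
  have space_meas: "- ?D \<in> sets (extended ?\<kappa>)"
    using sets_compl_zero by (simp add: sets_extended_iff)
  \<comment> \<open>If \<open>\<mu>\<close> were trivial, the unweighted measure would vanish, and
    with it \<open>P\<close>, which is recovered from it by a density.\<close>
  have pos: "emeasure \<mu> (- ?D) > 0"
  proof (rule ccontr)
    assume "\<not> emeasure \<mu> (- ?D) > 0"
    then have "emeasure ?\<kappa> (vec_ereal -` (- ?D)) = 0"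
      unfolding \<mu>_def emeasure_extended[OF \<kappa> space_meas] by simp
    moreover have "vec_ereal -` (- ?D) = - {x. loss x = 0}"
      by (auto simp: loss_eq_0_iff)
    ultimately have "emeasure ?\<kappa> (- {x. loss x = 0}) = 0"
      by simp
    with emeasure_unweighted_zero[OF P C F] have "emeasure ?\<kappa> ({x. loss x = 0} \<union> - {x. loss x = 0}) = 0"
      using \<kappa> by (intro emeasure_Un_null_set[THEN trans] null_setsI) auto
    then have "emeasure ?\<kappa> (space ?\<kappa>) = 0"
      using sets_eq_imp_space_eq[OF \<kappa>] by (simp add: Un_commute)
    then have "AE x in ?\<kappa>. False"
      by (intro AE_I[of _ _ "space ?\<kappa>"] sets.top) auto
    then have "(\<integral>\<^sup>+x. ennreal (frechet_weight C \<alpha> x) \<partial>?\<kappa>) = (\<integral>\<^sup>+x. 0 \<partial>?\<kappa>)"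
      by (intro nn_integral_cong_AE) auto
    moreover have "(\<integral>\<^sup>+x. ennreal (frechet_weight C \<alpha> x) \<partial>?\<kappa>) = emeasure (density ?\<kappa> (\<lambda>x. ennreal (frechet_weight C \<alpha> x))) UNIV"
      using \<kappa> by (subst emeasure_density) auto
    moreover have "emeasure (density ?\<kappa> (\<lambda>x. ennreal (frechet_weight C \<alpha> x))) UNIV = emeasure P UNIV"
      by (simp only: density_unweighted[OF P C F])
    moreover have "emeasure P UNIV = 1"
      using P.emeasure_space_1 sets_eq_imp_space_eq[OF P(2)] by simp
    ultimately show False
      by simp
  qed
  have null: "emeasure \<mu> (- ?D - range vec_ereal) = 0"
    unfolding \<mu>_def using sets_compl_zero sets_range_vec_ereal
    by (subst emeasure_extended[OF \<kappa>]) (auto simp: sets_extended_iff vimage_def)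
  have "space \<mu> - vec_ereal ` {x. f (vec_ereal x) \<noteq> 0} = - ?D - range vec_ereal"
    by (auto simp: \<mu>_def space_extended)
  with null show "emeasure \<mu> (space \<mu> - vec_ereal ` {x. f (vec_ereal x) \<noteq> 0}) = 0"
    by simp
  show "scaling_property \<alpha> \<mu>"
    unfolding \<mu>_def by (rule scaling_property_extended[OF \<kappa> unweighted_scaling[OF P C F stable]])
  have vague: "vague_conv_on (- ?D) (\<lambda>n. scale_measure (of_nat n)
      (restrict_space (distr P borel (\<lambda>x. vec_ereal (x /\<^sub>R ?a n))) (- ?D))) \<mu>"
    unfolding vague_conv_on_def
  proof (intro allI impI)
    fix h :: "ereal ^ 'd \<Rightarrow> real"
    assume h: "continuous_on (- ?D) h" and "\<exists>K. compact K \<and> K \<subseteq> - ?D \<and> (\<forall>x\<in>- ?D - K. h x = 0)"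
    then obtain K where K: "compact K" "K \<subseteq> - ?D" "\<And>x. x \<notin> ?D \<Longrightarrow> x \<notin> K \<Longrightarrow> h x = 0"
      by blast
    obtain s where s: "s > 0" "K \<subseteq> {x. ennreal s < f x}"
      using K(1,2) by (rule compact_f_ge)
    obtain B where B: "\<And>x. x \<in> K \<Longrightarrow> \<bar>h x\<bar> \<le> B"
      using compact_imp_bounded[OF compact_continuous_image[OF continuous_on_subset[OF h K(2)] K(1)]]
      by (auto simp: bounded_iff)
    let ?h = "\<lambda>x. indicator (- ?D) x * h x"
    have hm [measurable]: "?h \<in> borel_measurable borel"
      using h by (rule measurable_test_function)
    define k where "k x = ?h (vec_ereal x)" for x
    have km [measurable]: "k \<in> borel_measurable borel"
      unfolding k_def by measurable
    have k_bound: "\<bar>k x\<bar> \<le> max B 0 * indicator {x. s < loss x} x" for x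
    proof (cases "vec_ereal x \<in> K")
      case True
      then have "s < loss x"
        using s by (auto simp: f_vec_ereal ennreal_less_iff)
      then show ?thesis
        using B[OF True] by (auto simp: k_def indicator_def)
    next
      case False
      then show ?thesis
        using K(3)[of "vec_ereal x"] by (auto simp: k_def indicator_def)
    qed
    have "(\<integral>x. h x \<partial>\<mu>) = (\<integral>x. k x \<partial>?\<kappa>)"
      unfolding \<mu>_def extended_def k_def by (subst integral_restrict_compl_zero) (auto simp: integral_distr)
    \<comment> \<open>The weight at \<open>x\<close> is the root of order \<open>n\<close> of the
      weight at \<open>x / ?a n\<close>. Substituting \<open>y = x / ?a n\<close> in the unweighted
      measure costs a factor \<open>1 / n\<close>, which cancels the \<open>n\<close> in
      front.\<close>
    moreover have "(\<integral>x. h x \<partial>scale_measure (of_nat n) (restrict_space (distr P borel (\<lambda>x. vec_ereal (x /\<^sub>R ?a n))) (- ?D))) =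
        (\<integral>x. frechet_weight C \<alpha> x powr (1 / real n) * k x \<partial>?\<kappa>)" if n: "n \<ge> 1" for n
    proof -
      have a: "?a n > 0"
        using n by simp
      have "(\<integral>x. h x \<partial>scale_measure (of_nat n) (restrict_space (distr P borel (\<lambda>x. vec_ereal (x /\<^sub>R ?a n))) (- ?D))) =
          real n * (\<integral>x. k (x /\<^sub>R ?a n) \<partial>P)"
        unfolding k_def by (rule integral_test_function[OF P(2) h])
      also have "(\<integral>x. k (x /\<^sub>R ?a n) \<partial>P) = (\<integral>x. k (x /\<^sub>R ?a n) \<partial>density ?\<kappa> (\<lambda>x. ennreal (frechet_weight C \<alpha> x)))"
        by (simp only: density_unweighted[OF P C F])
      also have "\<dots> = (\<integral>x. frechet_weight C \<alpha> x * k (x /\<^sub>R ?a n) \<partial>?\<kappa>)"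
        by (subst integral_density) auto
      also have "\<dots> = (\<integral>x. (\<lambda>y. frechet_weight C \<alpha> y powr (1 / real n) * k y) (x /\<^sub>R ?a n) \<partial>?\<kappa>)"
        using n C frechet_weight_pos[of C \<alpha>]
        by (intro Bochner_Integration.integral_cong)
          (simp_all add: frechet_weight_scale powr_powr flip: powr_realpow)
      also have "real n * \<dots> = (\<integral>y. frechet_weight C \<alpha> y powr (1 / real n) * k y \<partial>?\<kappa>)"
      proof -
        let ?g = "\<lambda>y. frechet_weight C \<alpha> y powr (1 / real n) * k y"
        have "?\<kappa> = scale_measure (of_nat n) (distr ?\<kappa> borel (\<lambda>x. x /\<^sub>R ?a n))" (is "_ = ?N")
        proof (rule measure_eqI)
          fix X assume "X \<in> sets ?\<kappa>"
          then have [measurable]: "X \<in> sets borel"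
            using \<kappa> by simp
          have "emeasure ?\<kappa> X = (\<integral>\<^sup>+x. indicator X x \<partial>?\<kappa>)"
            using \<kappa> by simp
          also have "\<dots> = of_nat n * (\<integral>\<^sup>+x. indicator X (x /\<^sub>R ?a n) \<partial>?\<kappa>)"
            using n by (intro unweighted_scaling_nat[OF P C F stable]) auto
          also have "\<dots> = (\<integral>\<^sup>+x. indicator X x \<partial>?N)"
            by (simp add: nn_integral_scale_measure nn_integral_distr del: nn_integral_indicator)
          also have "\<dots> = emeasure ?N X"
            by (rule nn_integral_indicator) simp
          finally show "emeasure ?\<kappa> X = emeasure ?N X" .
        qed (simp add: P)
        then have "(\<integral>y. ?g y \<partial>?\<kappa>) = (\<integral>y. ?g y \<partial>?N)"
          by (rule arg_cong)
        also have "\<dots> = real n * (\<integral>x. ?g (x /\<^sub>R ?a n) \<partial>?\<kappa>)"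
          by (simp add: integral_scale_measure integral_distr)
        finally show ?thesis ..
      qed
      finally show ?thesis .
    qed
    \<comment> \<open>The root of the weight is at most 1 and tends to 1 because the weight is
      positive, while \<open>k\<close> is bounded and vanishes off a set of finite mass.\<close>
    moreover have "(\<lambda>n. \<integral>x. frechet_weight C \<alpha> x powr (1 / real n) * k x \<partial>?\<kappa>) \<longlonglongrightarrow> (\<integral>x. k x \<partial>?\<kappa>)"
    proof (rule integral_dominated_convergence[where w = "\<lambda>x. max B 0 * indicator {x. s < loss x} x"])
      show "integrable ?\<kappa> (\<lambda>x. max B 0 * indicator {x. s < loss x} x)"
        using emeasure_unweighted_gt[OF P C F s(1)] \<kappa> by (intro integrable_mult_right) (simp add: integrable_indicator_iff)
      show "AE x in ?\<kappa>. (\<lambda>n. frechet_weight C \<alpha> x powr (1 / real n) * k x) \<longlonglongrightarrow> k x"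
      proof (rule AE_I2)
        fix x
        have "(\<lambda>n. frechet_weight C \<alpha> x powr (1 / real n) * k x) \<longlonglongrightarrow> frechet_weight C \<alpha> x powr 0 * k x"
          using frechet_weight_pos[of C \<alpha> x]
          by (intro tendsto_mult tendsto_powr tendsto_const lim_1_over_n) auto
        then show "(\<lambda>n. frechet_weight C \<alpha> x powr (1 / real n) * k x) \<longlonglongrightarrow> k x"
          using frechet_weight_pos[of C \<alpha> x] by simp
      qed
      show "AE x in ?\<kappa>. norm (frechet_weight C \<alpha> x powr (1 / real n) * k x) \<le> max B 0 * indicator {x. s < loss x} x" for n
      proof (rule AE_I2)
        fix x
        have "frechet_weight C \<alpha> x powr (1 / real n) \<le> 1"
          using C frechet_weight_le_1[of C \<alpha> x] by (intro powr_le1) auto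
        then have "\<bar>frechet_weight C \<alpha> x powr (1 / real n)\<bar> * \<bar>k x\<bar> \<le> 1 * \<bar>k x\<bar>"
          by (intro mult_right_mono) auto
        with k_bound[of x] show "norm (frechet_weight C \<alpha> x powr (1 / real n) * k x) \<le> max B 0 * indicator {x. s < loss x} x"
          by (simp add: abs_mult)
      qed
    qed measurable
    ultimately show "(\<lambda>n. \<integral>x. h x \<partial>scale_measure (of_nat n) (restrict_space (distr P borel (\<lambda>x. vec_ereal (x /\<^sub>R ?a n))) (- ?D)))
        \<longlonglongrightarrow> (\<integral>x. h x \<partial>\<mu>)"
      by (auto elim!: Lim_transform_eventually intro!: eventually_mono[OF eventually_ge_at_top[of 1]])
  qed
  have "regularly_varying_law \<alpha> ?a ?D \<mu> P"
    unfolding regularly_varying_law_def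
    using P C radon pos null regularly_varying_seq_powr vague by blast
  moreover have "conv_in_distribution (\<lambda>n. implicit_max_law f P n (?a n)) P"
    unfolding conv_in_distribution_def
  proof (intro allI impI)
    fix g :: "real ^ 'd \<Rightarrow> real"
    have "\<forall>\<^sub>F n in sequentially. (\<integral>x. g x \<partial>implicit_max_law f P n (?a n)) = (\<integral>x. g x \<partial>P)"
      using eventually_ge_at_top[of 1] by eventually_elim (simp add: stable)
    then show "(\<lambda>n. \<integral>x. g x \<partial>implicit_max_law f P n (?a n)) \<longlonglongrightarrow> (\<integral>x. g x \<partial>P)"
      by (rule tendsto_eventually)
  qed
  ultimately show "implicit_extreme_value f \<alpha> \<mu> P"
    unfolding implicit_extreme_value_def using P by blast
qed

section \<open>Extreme value distributions\<close>

context
  fixes P Q \<kappa> :: "(real ^ 'd) measure" and a :: "nat \<Rightarrow> real" and C \<alpha> :: real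
  assumes P: "prob_space P" "sets P = sets borel"
    and Q: "prob_space Q" "sets Q = sets borel"
    and \<kappa>: "sets \<kappa> = sets borel" "\<And>s. s > 0 \<Longrightarrow> emeasure \<kappa> {x. s < loss x} < \<infinity>" "emeasure \<kappa> {x. loss x = 0} = 0"
    and a: "\<And>n. n \<ge> 1 \<Longrightarrow> a n > 0"
    and C: "C > 0" "\<alpha> > 0"
    and tail_ge: "\<And>t. t > 0 \<Longrightarrow> (\<lambda>n. real n * measure Q {x. loss (x /\<^sub>R a n) \<ge> t}) \<longlonglongrightarrow> C * t powr - \<alpha>"
    and tail_gt: "\<And>t. t > 0 \<Longrightarrow> (\<lambda>n. real n * measure Q {x. loss (x /\<^sub>R a n) > t}) \<longlonglongrightarrow> C * t powr - \<alpha>"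
    and vague: "\<And>h K. continuous_on UNIV h \<Longrightarrow> (\<And>x. 0 \<le> h x) \<Longrightarrow> (\<And>x. h x \<le> 1) \<Longrightarrow>
      compact K \<Longrightarrow> K \<subseteq> {x. 0 < loss x} \<Longrightarrow> (\<And>x. x \<notin> K \<Longrightarrow> h x = 0) \<Longrightarrow>
      (\<lambda>n. real n * (\<integral>x. h (x /\<^sub>R a n) \<partial>Q)) \<longlonglongrightarrow> (\<integral>x. h x \<partial>\<kappa>)"
    and conv: "conv_in_distribution (\<lambda>n. implicit_max_law f Q n (a n)) P"
begin

text \<open>Complements of the two tails. The exponent \<open>n - 1\<close> is that of the squeeze;
  the exponent \<open>n\<close> belongs to the distribution function of the loss of the rescaled
  maximum and differs by a factor tending to 1.\<close>

lemma tendsto_cdf_power: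
  assumes t: "t > 0"
  shows "(\<lambda>n. measure Q {x. loss (x /\<^sub>R a n) \<le> t} ^ (n - 1)) \<longlonglongrightarrow> exp (- (C * t powr - \<alpha>))"
    and "(\<lambda>n. measure Q {x. loss (x /\<^sub>R a n) < t} ^ (n - 1)) \<longlonglongrightarrow> exp (- (C * t powr - \<alpha>))"
    and "(\<lambda>n. measure Q {x. loss (x /\<^sub>R a n) \<le> t} ^ n) \<longlonglongrightarrow> exp (- (C * t powr - \<alpha>))"
proof -
  interpret prob_space Q by fact
  have sp: "space Q = UNIV"
    using sets_eq_imp_space_eq[OF Q(2)] by simp
  have meas: "{x. loss (x /\<^sub>R c) > t} \<in> events" "{x. loss (x /\<^sub>R c) \<ge> t} \<in> events" for c
    unfolding Q(2) by measurable
  have le: "measure Q {x. loss (x /\<^sub>R c) \<le> t} = 1 - measure Q {x. loss (x /\<^sub>R c) > t}" for c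
    using prob_compl[OF meas(1), of c] by (simp add: sp Compl_eq_Diff_UNIV[symmetric] Collect_neg_eq[symmetric] not_less)
  have less: "measure Q {x. loss (x /\<^sub>R c) < t} = 1 - measure Q {x. loss (x /\<^sub>R c) \<ge> t}" for c
    using prob_compl[OF meas(2), of c] by (simp add: sp Compl_eq_Diff_UNIV[symmetric] Collect_neg_eq[symmetric] not_le)
  show 1: "(\<lambda>n. measure Q {x. loss (x /\<^sub>R a n) \<le> t} ^ (n - 1)) \<longlonglongrightarrow> exp (- (C * t powr - \<alpha>))"
    unfolding le by (intro tendsto_power_one_minus tail_gt t measure_nonneg)
  show "(\<lambda>n. measure Q {x. loss (x /\<^sub>R a n) < t} ^ (n - 1)) \<longlonglongrightarrow> exp (- (C * t powr - \<alpha>))"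
    unfolding less by (intro tendsto_power_one_minus tail_ge t measure_nonneg)
  have "(\<lambda>n. real n * measure Q {x. loss (x /\<^sub>R a n) > t} * (1 / real n)) \<longlonglongrightarrow> C * t powr - \<alpha> * 0"
    by (intro tendsto_mult[OF tail_gt[OF t]] lim_1_over_n)
  moreover have "\<forall>\<^sub>F n in sequentially. real n * measure Q {x. loss (x /\<^sub>R a n) > t} * (1 / real n) =
      measure Q {x. loss (x /\<^sub>R a n) > t}"
    using eventually_gt_at_top[of 0] by eventually_elim simp
  ultimately have "(\<lambda>n. measure Q {x. loss (x /\<^sub>R a n) > t}) \<longlonglongrightarrow> C * t powr - \<alpha> * 0"
    by (rule Lim_transform_eventually)
  then have "(\<lambda>n. measure Q {x. loss (x /\<^sub>R a n) \<le> t}) \<longlonglongrightarrow> 1 - C * t powr - \<alpha> * 0"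
    unfolding le by (intro tendsto_diff tendsto_const)
  from tendsto_mult[OF 1 this]
  have "(\<lambda>n. measure Q {x. loss (x /\<^sub>R a n) \<le> t} ^ (n - 1) * measure Q {x. loss (x /\<^sub>R a n) \<le> t})
      \<longlonglongrightarrow> exp (- (C * t powr - \<alpha>))"
    by simp
  moreover have "\<forall>\<^sub>F n in sequentially. measure Q {x. loss (x /\<^sub>R a n) \<le> t} ^ (n - 1) * measure Q {x. loss (x /\<^sub>R a n) \<le> t} =
      measure Q {x. loss (x /\<^sub>R a n) \<le> t} ^ n"
    using eventually_ge_at_top[of 1] by eventually_elim (simp add: power_eq_if)
  ultimately show "(\<lambda>n. measure Q {x. loss (x /\<^sub>R a n) \<le> t} ^ n) \<longlonglongrightarrow> exp (- (C * t powr - \<alpha>))"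
    by (rule Lim_transform_eventually)
qed

text \<open>Convergence in distribution controls only continuous functions, so an indicator is
  replaced by a linear ramp in the loss between the levels \<open>s\<close> and \<open>t\<close>.
  The levels are merged in \<open>cdf_implicit_limit\<close> by continuity of the Frechet
  distribution function.\<close>

lemma cdf_implicit_limit_bounds:
  assumes st: "0 < s" "s < t"
  shows "measure P {x. loss x \<le> s} \<le> exp (- (C * t powr - \<alpha>))"
    and "exp (- (C * s powr - \<alpha>)) \<le> measure P {x. loss x \<le> t}"
proof -
  interpret P: prob_space P by fact
  interpret Q: prob_space Q by fact
  define \<psi> where "\<psi> x = max 0 (min 1 ((t - loss x) / (t - s)))" for x
  have cont_\<psi>: "continuous_on UNIV \<psi>"
    unfolding \<psi>_def using st by (intro continuous_intros continuous_loss) auto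
  have \<psi>: "indicator {x. loss x \<le> s} x \<le> \<psi> x" "\<psi> x \<le> indicator {x. loss x \<le> t} x" for x
  proof -
    have "1 \<le> (t - loss x) / (t - s)" if "loss x \<le> s"
      using that st by (simp add: pos_le_divide_eq)
    then show "indicator {x. loss x \<le> s} x \<le> \<psi> x"
      by (auto simp: \<psi>_def indicator_def)
    have "(t - loss x) / (t - s) \<le> 0" if "\<not> loss x \<le> t"
      using that st by (intro divide_nonpos_nonneg) auto
    then show "\<psi> x \<le> indicator {x. loss x \<le> t} x"
      by (auto simp: \<psi>_def indicator_def)
  qed
  have \<psi>01: "0 \<le> \<psi> x" "\<psi> x \<le> 1" for x
    by (auto simp: \<psi>_def)
  have [measurable]: "\<psi> \<in> borel_measurable borel"
    using cont_\<psi> by (rule borel_measurable_continuous_onI)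
  have bounds: "measure R {x. loss x \<le> s} \<le> (\<integral>x. \<psi> x \<partial>R) \<and> (\<integral>x. \<psi> x \<partial>R) \<le> measure R {x. loss x \<le> t}"
    if R: "prob_space R" and [measurable_cong]: "sets R = sets borel" for R
  proof -
    interpret R: prob_space R by fact
    have int: "integrable R \<psi>"
      using \<psi>01 by (intro R.integrable_const_bound[where B = 1]) auto
    have ind: "integrable R (indicator {x. loss x \<le> u} :: _ \<Rightarrow> real)" for u
      by (intro R.integrable_const_bound[where B = 1]) (auto simp: indicator_def)
    have "(\<integral>x. indicator {x. loss x \<le> u} x \<partial>R) = measure R {x. loss x \<le> u}" for u
      using that(2) sets_eq_imp_space_eq[OF that(2)] by simp
    then show ?thesis
      using integral_mono[OF ind int \<psi>(1)] integral_mono[OF int ind \<psi>(2)] by simp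
  qed
  have law: "measure (implicit_max_law f Q n (a n)) {x. loss x \<le> u} = measure Q {x. loss (x /\<^sub>R a n) \<le> u} ^ n"
    if n: "n \<ge> 1" for n u
  proof -
    have "{x. loss x \<le> a n * u} = {x. loss (x /\<^sub>R a n) \<le> u}"
      using a[OF n] by (auto simp: loss_scaleR field_simps)
    then have "ennreal (measure (implicit_max_law f Q n (a n)) {x. loss x \<le> u}) =
        ennreal (measure Q {x. loss (x /\<^sub>R a n) \<le> u} ^ n)"
      using emeasure_implicit_max_law_loss_le[OF Q n a[OF n], of u]
        prob_space.finite_measure[OF prob_space_implicit_max_law[OF Q n]]
      by (simp add: finite_measure.emeasure_eq_measure Q.emeasure_eq_measure ennreal_power)
    then show ?thesis
      by simp
  qed
  have "bounded (range \<psi>)"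
    using \<psi>01 by (intro boundedI[of _ 1]) auto
  then have lim: "(\<lambda>n. \<integral>x. \<psi> x \<partial>implicit_max_law f Q n (a n)) \<longlonglongrightarrow> (\<integral>x. \<psi> x \<partial>P)"
    using conv cont_\<psi> unfolding conv_in_distribution_def by blast
  have b: "measure Q {x. loss (x /\<^sub>R a n) \<le> s} ^ n \<le> (\<integral>x. \<psi> x \<partial>implicit_max_law f Q n (a n))"
      "(\<integral>x. \<psi> x \<partial>implicit_max_law f Q n (a n)) \<le> measure Q {x. loss (x /\<^sub>R a n) \<le> t} ^ n" if n: "n \<ge> 1" for n
    using bounds[OF prob_space_implicit_max_law[OF Q n] sets_implicit_max_law[OF Q n], of "a n"] law[OF n] by simp_all
  have "(\<integral>x. \<psi> x \<partial>P) \<le> exp (- (C * t powr - \<alpha>))"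
    using st b(2) by (intro LIMSEQ_le[OF lim tendsto_cdf_power(3)[of t]]) auto
  with bounds[OF P] show "measure P {x. loss x \<le> s} \<le> exp (- (C * t powr - \<alpha>))"
    by simp
  have "exp (- (C * s powr - \<alpha>)) \<le> (\<integral>x. \<psi> x \<partial>P)"
    using st b(1) by (intro LIMSEQ_le[OF tendsto_cdf_power(3)[of s] lim]) auto
  with bounds[OF P] show "exp (- (C * s powr - \<alpha>)) \<le> measure P {x. loss x \<le> t}"
    by simp
qed

lemma cdf_implicit_limit:
  assumes t: "t > 0"
  shows "measure P {x. loss x \<le> t} = exp (- (C * t powr - \<alpha>))"
proof (rule antisym)
  have lim: "((\<lambda>s. exp (- (C * s powr - \<alpha>))) \<longlongrightarrow> exp (- (C * t powr - \<alpha>))) (at t)"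
    using t by (intro tendsto_intros) auto
  show "measure P {x. loss x \<le> t} \<le> exp (- (C * t powr - \<alpha>))"
  proof (rule tendsto_lowerbound)
    show "((\<lambda>s. exp (- (C * s powr - \<alpha>))) \<longlongrightarrow> exp (- (C * t powr - \<alpha>))) (at_right t)"
      using lim by (rule tendsto_within_subset) simp
    show "\<forall>\<^sub>F s in at_right t. measure P {x. loss x \<le> t} \<le> exp (- (C * s powr - \<alpha>))"
      using t cdf_implicit_limit_bounds(1) unfolding eventually_at_right_field
      by (intro exI[of _ "t + 1"]) auto
  qed simp
  show "exp (- (C * t powr - \<alpha>)) \<le> measure P {x. loss x \<le> t}"
  proof (rule tendsto_upperbound)
    show "((\<lambda>s. exp (- (C * s powr - \<alpha>))) \<longlongrightarrow> exp (- (C * t powr - \<alpha>))) (at_left t)"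
      using lim by (rule tendsto_within_subset) simp
    show "\<forall>\<^sub>F s in at_left t. exp (- (C * s powr - \<alpha>)) \<le> measure P {x. loss x \<le> t}"
      using t cdf_implicit_limit_bounds(2) unfolding eventually_at_left_field
      by (intro exI[of _ 0]) auto
  qed simp
qed

text \<open>On \<open>K\<close> the loss stays in \<open>[s, T]\<close>, where both powers in the
  squeeze are eventually within \<open>e\<close> of the weight. Hence the integral
  \<open>L n\<close> before the limit differs from \<open>J n\<close> by at most
  \<open>e * I n\<close>; as \<open>I n\<close> converges, \<open>e\<close> can be sent to
  0.\<close>

lemma integral_implicit_limit:
  assumes h: "continuous_on UNIV h" "\<And>x. 0 \<le> h x" "\<And>x. h x \<le> 1"
    and K: "compact K" "K \<subseteq> {x. 0 < loss x}" "\<And>x. x \<notin> K \<Longrightarrow> h x = 0"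
  shows "(\<integral>x. h x \<partial>P) = (\<integral>x. h x * frechet_weight C \<alpha> x \<partial>\<kappa>)"
proof -
  interpret P: prob_space P by fact
  interpret Q: prob_space Q by fact
  note [measurable_cong] = P(2) Q(2)
  let ?w = "frechet_weight C \<alpha>"
  have hm [measurable]: "h \<in> borel_measurable borel"
    using h(1) by (rule borel_measurable_continuous_onI)
  have w1: "?w x \<le> 1" for x
    using C by (intro frechet_weight_le_1) simp
  obtain s T where sT: "0 < s" "\<And>x. x \<in> K \<Longrightarrow> s \<le> loss x" "\<And>x. x \<in> K \<Longrightarrow> loss x \<le> T"
    using loss_gt_on_compact[OF K(1,2)] by blast
  \<comment> \<open>The weight jumps to 1 on the zero set of the loss. The product is continuous
    nevertheless, because \<open>h\<close> vanishes on the open complement of \<open>K\<close>,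
    which covers that set.\<close>
  have hw: "continuous_on UNIV (\<lambda>x. h x * ?w x)"
  proof -
    have "continuous_on {x. 0 < loss x} (\<lambda>x. h x * ?w x)"
      unfolding frechet_weight_def
      by (intro continuous_intros continuous_on_subset[OF h(1)] continuous_on_subset[OF continuous_loss]) auto
    moreover have "continuous_on (- K) (\<lambda>x. h x * ?w x)"
      using K(3) by (subst continuous_on_cong[OF refl, where g = "\<lambda>_. 0"]) auto
    ultimately have "continuous_on ({x. 0 < loss x} \<union> - K) (\<lambda>x. h x * ?w x)"
      using open_loss_gt[of 0] K(1) by (intro continuous_on_open_Un) (auto intro: compact_imp_closed)
    moreover have "{x. 0 < loss x} \<union> - K = UNIV"
      using K(2) by auto
    ultimately show ?thesis by simp
  qed
  define I where "I n = real n * (\<integral>x. h (x /\<^sub>R a n) \<partial>Q)" for n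
  define J where "J n = real n * (\<integral>x. h (x /\<^sub>R a n) * ?w (x /\<^sub>R a n) \<partial>Q)" for n
  define L where "L n = (\<integral>x. h x \<partial>implicit_max_law f Q n (a n))" for n
  have I: "I \<longlonglongrightarrow> (\<integral>x. h x \<partial>\<kappa>)"
    unfolding I_def using h K by (rule vague)
  have J: "J \<longlonglongrightarrow> (\<integral>x. h x * ?w x \<partial>\<kappa>)"
    unfolding J_def
  proof (rule vague[OF hw _ _ K(1,2)])
    show "0 \<le> h x * ?w x" for x
      using h(2) by simp
    show "h x * ?w x \<le> 1" for x
      using h(2,3) w1 by (intro mult_le_one) auto
  qed (simp add: K(3))
  have "bounded (range h)"
    using h(2,3) by (intro boundedI[of _ 1]) auto
  then have L: "L \<longlonglongrightarrow> (\<integral>x. h x \<partial>P)"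
    unfolding L_def using conv h(1) unfolding conv_in_distribution_def by blast
  define U where "U n t = measure Q {x. loss (x /\<^sub>R a n) \<le> t} ^ (n - 1)" for n t
  define V where "V n t = measure Q {x. loss (x /\<^sub>R a n) < t} ^ (n - 1)" for n t
  have cdf_mono: "measure Q {x. loss (x /\<^sub>R c) \<le> u} \<le> measure Q {x. loss (x /\<^sub>R c) \<le> v}"
    "measure Q {x. loss (x /\<^sub>R c) < u} \<le> measure Q {x. loss (x /\<^sub>R c) < v}" if "u \<le> v" for c u v
  proof -
    have "{x. loss (x /\<^sub>R c) \<le> v} \<in> sets borel" "{x. loss (x /\<^sub>R c) < v} \<in> sets borel"
      by measurable
    then show "measure Q {x. loss (x /\<^sub>R c) \<le> u} \<le> measure Q {x. loss (x /\<^sub>R c) \<le> v}"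
      "measure Q {x. loss (x /\<^sub>R c) < u} \<le> measure Q {x. loss (x /\<^sub>R c) < v}"
      using that by (auto intro!: Q.finite_measure_mono simp: Q)
  qed
  have cu: "continuous_on {s..T} (\<lambda>t. exp (- (C * t powr - \<alpha>)))"
    using sT(1) by (intro continuous_intros) auto
  have unif: "uniform_limit {s..T} U (\<lambda>t. exp (- (C * t powr - \<alpha>))) sequentially"
    "uniform_limit {s..T} V (\<lambda>t. exp (- (C * t powr - \<alpha>))) sequentially"
    unfolding U_def V_def using sT(1)
    by (intro uniform_limit_monotone cu power_mono cdf_mono measure_nonneg tendsto_cdf_power; simp)+
  have close: "\<forall>\<^sub>F n in sequentially. J n - e * I n \<le> L n \<and> L n \<le> J n + e * I n" if e: "e > 0" for e
  proof -
    have "\<forall>\<^sub>F n in sequentially. \<forall>t\<in>{s..T}. dist (U n t) (exp (- (C * t powr - \<alpha>))) < e"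
      "\<forall>\<^sub>F n in sequentially. \<forall>t\<in>{s..T}. dist (V n t) (exp (- (C * t powr - \<alpha>))) < e"
      using unif e by (auto dest: uniform_limitD)
    then show ?thesis
      using eventually_ge_at_top[of 1]
    proof eventually_elim
      case (elim n)
      have U: "h x * U n (loss x) \<le> h x * (?w x + e)" and V: "h x * (?w x - e) \<le> h x * V n (loss x)" for x
      proof -
        have "U n (loss x) \<le> ?w x + e" "?w x - e \<le> V n (loss x)" if "x \<in> K"
          using that sT elim(1,2) by (force simp: dist_real_def frechet_weight_def)+
        then show "h x * U n (loss x) \<le> h x * (?w x + e)" "h x * (?w x - e) \<le> h x * V n (loss x)"
          using K(3)[of x] h(2)[of x] by (cases "x \<in> K"; simp add: mult_left_mono)+
      qed
      \<comment> \<open>Dividing both points by \<open>a n\<close> does not change which loss is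
        larger, so the powers in the squeeze are \<open>U n\<close> and \<open>V n\<close> at the
        rescaled loss.\<close>
      have Un: "{y. loss y \<le> loss x} = {y. loss (y /\<^sub>R a n) \<le> loss (x /\<^sub>R a n)}"
        "{y. loss y < loss x} = {y. loss (y /\<^sub>R a n) < loss (x /\<^sub>R a n)}" for x
        using a[OF elim(3)] by (auto simp: loss_scaleR)
      let ?M = "implicit_max_law f Q n (a n)"
      interpret M: prob_space ?M
        using prob_space_implicit_max_law[OF Q elim(3)] .
      note [measurable_cong] = sets_implicit_max_law[OF Q elim(3), of "a n"]
      have L_nn: "(\<integral>\<^sup>+x. ennreal (h x) \<partial>?M) = ennreal (L n)"
        unfolding L_def using h by (intro nn_integral_eq_integral M.integrable_const_bound[where B = 1]) auto
      have L0: "L n \<ge> 0"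
        unfolding L_def using h by (intro Bochner_Integration.integral_nonneg) auto
      have int: "integrable Q (\<lambda>x. h (x /\<^sub>R a n))" "integrable Q (\<lambda>x. h (x /\<^sub>R a n) * ?w (x /\<^sub>R a n))"
        using h w1 by (intro Q.integrable_const_bound[where B = 1] AE_I2; auto intro!: mult_le_one)+
      have JI: "real n * (\<integral>x. h (x /\<^sub>R a n) * (?w (x /\<^sub>R a n) + d) \<partial>Q) = J n + d * I n" for d
        using int by (simp add: J_def I_def distrib_left mult.commute)
      have int_d: "integrable Q (\<lambda>x. h (x /\<^sub>R a n) * (?w (x /\<^sub>R a n) + d))" for d
        using int by (simp add: distrib_left)
      have V01: "0 \<le> V n t" "V n t \<le> 1" for t
        unfolding V_def by (auto intro!: power_le_one)
      have "mono (V n)"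
        unfolding V_def by (intro monoI power_mono cdf_mono measure_nonneg)
      then have [measurable]: "V n \<in> borel_measurable borel"
        by (rule borel_measurable_mono)
      have int_V: "integrable Q (\<lambda>x. real n * (h (x /\<^sub>R a n) * V n (loss (x /\<^sub>R a n))))"
        using h V01 by (intro integrable_mult_right Q.integrable_const_bound[where B = 1] AE_I2)
          (auto intro!: mult_le_one simp: abs_mult)
      have "ennreal (L n) \<le> (\<integral>\<^sup>+x. of_nat n * (ennreal (h (x /\<^sub>R a n)) * emeasure Q {y. loss y \<le> loss x} ^ (n - 1)) \<partial>Q)"
        unfolding L_nn[symmetric] by (rule nn_integral_implicit_max_law_bounds(2)[OF Q elim(3)]) simp
      also have "\<dots> = (\<integral>\<^sup>+x. ennreal (real n * (h (x /\<^sub>R a n) * U n (loss (x /\<^sub>R a n)))) \<partial>Q)"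
        using h(2) by (intro nn_integral_cong)
          (simp add: Q.emeasure_eq_measure U_def Un ennreal_power ennreal_of_nat_eq_real_of_nat flip: ennreal_mult)
      also have "\<dots> \<le> (\<integral>\<^sup>+x. ennreal (real n * (h (x /\<^sub>R a n) * (?w (x /\<^sub>R a n) + e))) \<partial>Q)"
        by (intro nn_integral_mono ennreal_leI mult_left_mono[of _ _ "real n"] U) simp
      also have "\<dots> = ennreal (\<integral>x. real n * (h (x /\<^sub>R a n) * (?w (x /\<^sub>R a n) + e)) \<partial>Q)"
        using h(2) e by (intro nn_integral_eq_integral integrable_mult_right int_d AE_I2) (simp add: add_nonneg_nonneg)
      also have "\<dots> = ennreal (J n + e * I n)"
        by (simp add: JI)
      finally have up: "ennreal (L n) \<le> ennreal (J n + e * I n)" .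
      have IJ0: "I n \<ge> 0" "J n \<ge> 0"
        unfolding I_def J_def using h by (auto intro!: mult_nonneg_nonneg Bochner_Integration.integral_nonneg)
      \<comment> \<open>The factor \<open>?w - e\<close> may be negative, so the lower estimate is
        made for real integrals. Truncation by \<open>ennreal\<close> afterwards is harmless because
        \<open>L n\<close> is nonnegative.\<close>
      have "(\<integral>x. real n * (h (x /\<^sub>R a n) * (?w (x /\<^sub>R a n) + - e)) \<partial>Q) \<le>
          (\<integral>x. real n * (h (x /\<^sub>R a n) * V n (loss (x /\<^sub>R a n))) \<partial>Q)" (is "?l \<le> ?r")
      proof (rule integral_mono)
        show "real n * (h (x /\<^sub>R a n) * (?w (x /\<^sub>R a n) + - e)) \<le> real n * (h (x /\<^sub>R a n) * V n (loss (x /\<^sub>R a n)))" for x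
          using V[of "x /\<^sub>R a n"] by (intro mult_left_mono[of _ _ "real n"]) auto
        show "integrable Q (\<lambda>x. real n * (h (x /\<^sub>R a n) * V n (loss (x /\<^sub>R a n))))"
          by (rule int_V)
      qed (intro integrable_mult_right int_d)
      then have "ennreal (J n - e * I n) \<le> ennreal ?r"
        using JI[of "- e"] by (intro ennreal_leI) simp
      also have "\<dots> = (\<integral>\<^sup>+x. ennreal (real n * (h (x /\<^sub>R a n) * V n (loss (x /\<^sub>R a n)))) \<partial>Q)"
        using h(2) V01 by (intro nn_integral_eq_integral[symmetric] int_V AE_I2) simp
      also have "\<dots> = (\<integral>\<^sup>+x. of_nat n * (ennreal (h (x /\<^sub>R a n)) * emeasure Q {y. loss y < loss x} ^ (n - 1)) \<partial>Q)"
        using h(2) by (intro nn_integral_cong)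
          (simp add: Q.emeasure_eq_measure V_def Un ennreal_power ennreal_of_nat_eq_real_of_nat flip: ennreal_mult)
      also have "\<dots> \<le> ennreal (L n)"
        unfolding L_nn[symmetric] by (rule nn_integral_implicit_max_law_bounds(1)[OF Q elim(3)]) simp
      finally have lo: "ennreal (J n - e * I n) \<le> ennreal (L n)" .
      have "0 \<le> J n + e * I n"
        using IJ0 e by simp
      then show ?case
        using up lo L0 by (simp add: ennreal_le_iff del: ennreal_plus)
    qed
  qed
  have "\<bar>(\<integral>x. h x \<partial>P) - (\<integral>x. h x * ?w x \<partial>\<kappa>)\<bar> \<le> e * (\<integral>x. h x \<partial>\<kappa>)" if "e > 0" for e
  proof (rule tendsto_le[OF sequentially_bot])
    show "(\<lambda>n. \<bar>L n - J n\<bar>) \<longlonglongrightarrow> \<bar>(\<integral>x. h x \<partial>P) - (\<integral>x. h x * ?w x \<partial>\<kappa>)\<bar>"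
      by (intro tendsto_intros L J)
    show "(\<lambda>n. e * I n) \<longlonglongrightarrow> e * (\<integral>x. h x \<partial>\<kappa>)"
      by (intro tendsto_intros I)
    show "\<forall>\<^sub>F n in sequentially. \<bar>L n - J n\<bar> \<le> e * I n"
      using close[OF that] by eventually_elim (simp add: abs_le_iff)
  qed
  moreover have "((\<lambda>e. e * (\<integral>x. h x \<partial>\<kappa>)) \<longlongrightarrow> 0 * (\<integral>x. h x \<partial>\<kappa>)) (at_right 0)"
    by (intro tendsto_intros)
  ultimately have "\<bar>(\<integral>x. h x \<partial>P) - (\<integral>x. h x * ?w x \<partial>\<kappa>)\<bar> \<le> 0 * (\<integral>x. h x \<partial>\<kappa>)"
    by (intro tendsto_lowerbound[where F = "at_right 0"]) (auto simp: eventually_at_right_field intro!: exI[of _ 1])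
  then show ?thesis
    by simp
qed

text \<open>Neither side charges the zero set of the loss: for \<open>P\<close> this follows from
  the Frechet distribution of the loss, for the density from \<open>\<kappa>\<close>. On the rest
  test functions decide.\<close>

lemma implicit_limit_eq_density: "P = density \<kappa> (\<lambda>x. ennreal (frechet_weight C \<alpha> x))" (is "_ = ?N")
proof (rule measure_eqI_test_functions[where A = "\<lambda>i. {x. 1 / real (Suc i) < loss x}" and W = "{x. 0 < loss x}"])
  interpret P: prob_space P by fact
  note [measurable_cong] = P(2) \<kappa>(1)
  show "emeasure P (- {x. 0 < loss x}) = 0"
    unfolding compl_loss_pos using emeasure_loss_zero[OF P C cdf_implicit_limit] .
  have "AE x in \<kappa>. loss x \<noteq> 0"
    using \<kappa> by (intro AE_I[of _ _ "{x. loss x = 0}"]) auto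
  then have "(\<integral>\<^sup>+x. ennreal (frechet_weight C \<alpha> x) * indicator {x. loss x = 0} x \<partial>\<kappa>) = (\<integral>\<^sup>+x. 0 \<partial>\<kappa>)"
    by (intro nn_integral_cong_AE) auto
  then show "emeasure ?N (- {x. 0 < loss x}) = 0"
    unfolding compl_loss_pos by (subst emeasure_density) auto
  show "emeasure P {x. 1 / real (Suc i) < loss x} < \<infinity>" for i
    by (simp add: P.emeasure_eq_measure)
  fix h :: "real ^ 'd \<Rightarrow> real" and K
  assume h: "continuous_on UNIV h" "\<And>x. 0 \<le> h x" "\<And>x. h x \<le> 1"
    and K: "compact K" "K \<subseteq> {x. 0 < loss x}" "\<And>x. x \<notin> K \<Longrightarrow> h x = 0"
  have [measurable]: "h \<in> borel_measurable borel"
    using h(1) by (rule borel_measurable_continuous_onI)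
  obtain s T where s: "0 < s" "\<And>x. x \<in> K \<Longrightarrow> s \<le> loss x" "\<And>x. x \<in> K \<Longrightarrow> loss x \<le> T"
    using loss_gt_on_compact[OF K(1,2)] by blast
  have int: "integrable \<kappa> (\<lambda>x. h x * frechet_weight C \<alpha> x)"
  proof (rule Bochner_Integration.integrable_bound)
    show "integrable \<kappa> (indicator {x. s / 2 < loss x} :: _ \<Rightarrow> real)"
      using \<kappa>(1) \<kappa>(2)[of "s / 2"] s by (intro integrable_real_indicator) auto
    show "AE x in \<kappa>. norm (h x * frechet_weight C \<alpha> x) \<le> norm (indicator {x. s / 2 < loss x} x :: real)"
    proof (rule AE_I2)
      fix x
      have "h x * frechet_weight C \<alpha> x \<le> 1"
        using h(2,3) C by (intro mult_le_one frechet_weight_le_1) auto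
      moreover have "s / 2 < loss x" if "x \<in> K"
        using s(2)[OF that] s(1) by simp
      ultimately show "norm (h x * frechet_weight C \<alpha> x) \<le> norm (indicator {x. s / 2 < loss x} x :: real)"
        using K(3)[of x] h(2)[of x] by (cases "x \<in> K") auto
    qed
  qed measurable
  have "(\<integral>\<^sup>+x. ennreal (h x) \<partial>P) = ennreal (\<integral>x. h x \<partial>P)"
    using h by (intro nn_integral_eq_integral P.integrable_const_bound[where B = 1]) auto
  also have "\<dots> = ennreal (\<integral>x. h x * frechet_weight C \<alpha> x \<partial>\<kappa>)"
    using integral_implicit_limit[OF h K] by simp
  also have "\<dots> = (\<integral>\<^sup>+x. ennreal (h x * frechet_weight C \<alpha> x) \<partial>\<kappa>)"
    using int h(2) by (intro nn_integral_eq_integral[symmetric]) auto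
  also have "\<dots> = (\<integral>\<^sup>+x. ennreal (frechet_weight C \<alpha> x) * ennreal (h x) \<partial>\<kappa>)"
    using h(2) by (simp add: mult.commute flip: ennreal_mult)
  also have "\<dots> = (\<integral>\<^sup>+x. ennreal (h x) \<partial>?N)"
    by (subst nn_integral_density) auto
  finally show "(\<integral>\<^sup>+x. ennreal (h x) \<partial>P) = (\<integral>\<^sup>+x. ennreal (h x) \<partial>?N)" .
qed (use exhaustion_loss_gt in \<open>simp_all add: P \<kappa> open_loss_gt\<close>)

end

section \<open>From the compactified space back to the real space\<close>

text \<open>Infinite coordinates are sent to 0 by \<open>real_of_ereal\<close>. This keeps
  homogeneity valid at every point, and the limit measure gives the points with infinite coordinates
  no mass.\<close>

definition real_part :: "ereal ^ 'd \<Rightarrow> real ^ 'd" where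
  "real_part y = (\<chi> i. real_of_ereal (y $ i))"

lemma real_part_vec_ereal [simp]: "real_part (vec_ereal x) = x"
  by (simp add: real_part_def vec_ereal_def vec_eq_iff)

lemma real_part_scale_ereal: "real_part (scale_ereal c y) = c *\<^sub>R real_part y"
  by (simp add: real_part_def scale_ereal_def vec_eq_iff)

definition restricted :: "(ereal ^ 'd) measure \<Rightarrow> (real ^ 'd) measure" where
  "restricted \<mu> = distr \<mu> borel real_part"

lemma sets_restricted [simp, measurable_cong]: "sets (restricted \<mu>) = sets borel"
  by (simp add: restricted_def)

lemma measurable_real_part [measurable]: "real_part \<in> borel_measurable borel"
proof (rule borel_measurable_euclidean_space[THEN iffD2], rule ballI)
  fix b :: "real ^ 'd" assume "b \<in> Basis"
  then obtain i where b: "b = axis i 1"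
    by (auto simp: Basis_vec_def)
  have "continuous_on UNIV (\<lambda>y :: ereal ^ 'd. y $ i)"
    by (auto simp: continuous_on_def intro: tendsto_vec_nth)
  then have [measurable]: "(\<lambda>y :: ereal ^ 'd. y $ i) \<in> borel_measurable borel"
    by (rule borel_measurable_continuous_onI)
  show "(\<lambda>y. real_part y \<bullet> b) \<in> borel_measurable borel"
    unfolding b real_part_def by (simp add: inner_axis)
qed

lemma continuous_on_real_part: "continuous_on (range vec_ereal) real_part"
  unfolding continuous_on_def
proof (intro ballI vec_tendstoI)
  fix y :: "ereal ^ 'd" and i assume "y \<in> range vec_ereal"
  then have "\<bar>y $ i\<bar> \<noteq> \<infinity>"
    by (auto simp: vec_ereal_def)
  moreover have "((\<lambda>y. y $ i) \<longlongrightarrow> y $ i) (at y within range vec_ereal)"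
    by (rule tendsto_vec_nth) (rule tendsto_ident_at)
  ultimately show "((\<lambda>y. real_part y $ i) \<longlongrightarrow> real_part y $ i) (at y within range vec_ereal)"
    unfolding real_part_def vec_lambda_beta by (metis ereal_real lim_real_of_ereal)
qed

text \<open>Outside the bounded box containing \<open>K\<close> the extension by zero vanishes, including near infinity.\<close>
lemma continuous_extension_by_zero:
  fixes h :: "real ^ 'd \<Rightarrow> real"
  assumes h: "continuous_on UNIV h" and K: "compact K" "\<And>x. x \<notin> K \<Longrightarrow> h x = 0"
  shows "continuous_on UNIV (\<lambda>y. if y \<in> range vec_ereal then h (real_part y) else 0)" (is "continuous_on _ ?H")
proof -
  obtain B where B: "\<And>x. x \<in> K \<Longrightarrow> norm x \<le> B"
    using compact_imp_bounded[OF K(1)] by (auto simp: bounded_iff)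
  let ?V = "\<Union>i. {y :: ereal ^ 'd. y $ i \<in> {..< ereal (- B)} \<union> {ereal B <..}}"
  have "open {y :: ereal ^ 'd. y $ i \<in> {..< ereal (- B)} \<union> {ereal B <..}}" for i
    using open_vimage_vec_nth[of "{..< ereal (- B)} \<union> {ereal B <..}" i] by (simp add: vimage_def open_Un)
  then have V: "open ?V"
    by blast
  have "continuous_on (range vec_ereal) (\<lambda>y. h (real_part y))"
    by (rule continuous_on_compose2[OF h continuous_on_real_part]) auto
  then have 1: "continuous_on (range vec_ereal) ?H"
    by (rule continuous_on_eq) auto
  have "?H y = 0" if "y \<in> ?V" for y
  proof -
    have "x \<notin> K" if "y = vec_ereal x" for x
    proof
      assume "x \<in> K"
      obtain i where "y $ i \<in> {..< ereal (- B)} \<union> {ereal B <..}"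
        using \<open>y \<in> ?V\<close> by blast
      moreover have "\<bar>x $ i\<bar> \<le> B"
        using B[OF \<open>x \<in> K\<close>] component_le_norm_cart[of x i] by simp
      ultimately show False
        using \<open>y = vec_ereal x\<close> by (auto simp: vec_ereal_def abs_le_iff)
    qed
    then show ?thesis
      using K(2) by auto
  qed
  then have 2: "continuous_on ?V ?H"
    by (subst continuous_on_cong[OF refl, where g = "\<lambda>_. 0"]) auto
  have "y \<in> range vec_ereal \<union> ?V" for y
  proof (cases "\<forall>i. y $ i \<in> {-\<infinity> <..< \<infinity>}")
    case True
    then show ?thesis
      by (simp add: range_vec_ereal)
  next
    case False
    then obtain i where "y $ i = \<infinity> \<or> y $ i = -\<infinity>"
      by auto
    then have "y \<in> {y. y $ i \<in> {..< ereal (- B)} \<union> {ereal B <..}}"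
      by auto
    then show ?thesis by blast
  qed
  then have "range vec_ereal \<union> ?V = UNIV"
    by blast
  with continuous_on_open_Un[OF open_range_vec_ereal V 1 2] show ?thesis
    by simp
qed

text \<open>This is what compactification provides: a closed subset of a compact space, whereas the
  real vectors with loss at least \<open>s\<close> form an unbounded set in general.\<close>

lemma compact_f_ge_level: "compact {y. ennreal s \<le> f y}"
proof -
  have "closed {y. ennreal s \<le> f y}"
    using cont by (intro closed_Collect_le) auto
  then show ?thesis
    using closed_Int_compact[OF _ compact_UNIV_ereal_vec] by force
qed

section \<open>Tails of a regularly varying law\<close>

context
  fixes \<mu> :: "(ereal ^ 'd) measure" and Q P :: "(real ^ 'd) measure" and a \<alpha>
  assumes rv: "regularly_varying_law \<alpha> a {x. f x = 0} \<mu> Q"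
    and supp: "emeasure \<mu> (space \<mu> - vec_ereal ` {x. f (vec_ereal x) \<noteq> 0}) = 0"
    and scaling: "scaling_property \<alpha> \<mu>"
begin

lemma sets_\<mu>: "sets \<mu> = sets (restrict_space borel (- {x. f x = 0}))"
  using rv by (simp add: regularly_varying_law_def radon_measure_on_def)

lemma space_\<mu>: "space \<mu> = - {x. f x = 0}"
  using sets_eq_imp_space_eq[OF sets_\<mu>] by (simp add: space_restrict_space)

lemma sets_\<mu>_iff: "A \<in> sets \<mu> \<longleftrightarrow> A \<in> sets borel \<and> A \<subseteq> - {x. f x = 0}"
  using sets_compl_zero by (subst sets_\<mu>, subst sets_restrict_space_iff) auto

lemma measurable_\<mu>: "g \<in> borel_measurable borel \<Longrightarrow> g \<in> borel_measurable \<mu>"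
  by (subst measurable_cong_sets[OF sets_\<mu> refl]) (rule measurable_restrict_space1)

lemmas measurable_real_part_\<mu> [measurable] = measurable_\<mu>[OF measurable_real_part]

text \<open>The support condition discards the points at infinity, and the zero set is not part of
  the space; so identities under \<open>\<mu>\<close> need checking at real vectors only.\<close>

lemma AE_\<mu>: "AE y in \<mu>. \<exists>x. y = vec_ereal x \<and> loss x > 0"
proof (rule AE_I)
  have eq: "space \<mu> - vec_ereal ` {x. f (vec_ereal x) \<noteq> 0} = - {x. f x = 0} - range vec_ereal"
    by (auto simp: space_\<mu>)
  show "emeasure \<mu> (- {x. f x = 0} - range vec_ereal) = 0"
    using supp eq by simp
  show "- {x. f x = 0} - range vec_ereal \<in> sets \<mu>"
    using sets_compl_zero sets_range_vec_ereal by (auto simp: sets_\<mu>_iff)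
  show "{y \<in> space \<mu>. \<not> (\<exists>x. y = vec_ereal x \<and> 0 < loss x)} \<subseteq> - {x. f x = 0} - range vec_ereal"
    by (auto simp: space_\<mu> loss_eq_0_iff[symmetric] vec_ereal_inject not_less order_antisym)
qed

lemma nn_integral_restricted:
  "g \<in> borel_measurable borel \<Longrightarrow> (\<integral>\<^sup>+x. g x \<partial>restricted \<mu>) = (\<integral>\<^sup>+y. g (real_part y) \<partial>\<mu>)"
  unfolding restricted_def by (rule nn_integral_distr) measurable

lemma emeasure_restricted_eq:
  "B \<in> sets borel \<Longrightarrow> emeasure (restricted \<mu>) B = emeasure \<mu> {y \<in> space \<mu>. real_part y \<in> B}"
  unfolding restricted_def by (subst emeasure_distr) (auto intro: measurable_real_part_\<mu> arg_cong[where f = "emeasure \<mu>"])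

text \<open>\<open>real_part\<close> commutes with scaling, so the preimage of the rescaled set is
  the \<open>scale_ereal\<close> image of the preimage of \<open>B\<close>, to which the scaling
  property applies.\<close>

lemma emeasure_restricted_scale:
  assumes c: "c > 0" and B: "B \<in> sets borel"
  shows "emeasure (restricted \<mu>) {x. x /\<^sub>R c \<in> B} = ennreal (c powr - \<alpha>) * emeasure (restricted \<mu>) B"
proof -
  have m: "{x. x /\<^sub>R c \<in> B} \<in> sets borel"
  proof -
    have "(\<lambda>x. x /\<^sub>R c) -` B \<inter> space borel \<in> sets borel"
      using B by (rule measurable_sets[rotated]) measurable
    then show ?thesis
      by (simp add: vimage_def)
  qed
  have "{y \<in> space \<mu>. real_part y \<in> {x. x /\<^sub>R c \<in> B}} = scale_ereal c ` {y \<in> space \<mu>. real_part y \<in> B}"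
    unfolding scale_ereal_image[OF c]
    using c by (auto simp: space_\<mu> f_scale_ereal_eq_0_iff real_part_scale_ereal inverse_eq_divide)
  moreover have "{y \<in> space \<mu>. real_part y \<in> B} \<in> sets \<mu>"
    using measurable_sets[OF measurable_real_part_\<mu> B] by (simp add: vimage_def Int_def conj_commute)
  ultimately show ?thesis
    using scaling c B m unfolding scaling_property_def by (simp add: emeasure_restricted_eq)
qed

lemma nn_integral_restricted_scale:
  assumes c: "c > 0" and g [measurable]: "g \<in> borel_measurable borel"
  shows "(\<integral>\<^sup>+x. g (x /\<^sub>R c) \<partial>restricted \<mu>) = ennreal (c powr - \<alpha>) * (\<integral>\<^sup>+x. g x \<partial>restricted \<mu>)"
proof -
  have "distr (restricted \<mu>) borel (\<lambda>x. x /\<^sub>R c) = scale_measure (ennreal (c powr - \<alpha>)) (restricted \<mu>)"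
  proof (rule measure_eqI)
    fix B assume "B \<in> sets (distr (restricted \<mu>) borel (\<lambda>x. x /\<^sub>R c))"
    then have B: "B \<in> sets borel" by simp
    have "emeasure (distr (restricted \<mu>) borel (\<lambda>x. x /\<^sub>R c)) B = emeasure (restricted \<mu>) {x. x /\<^sub>R c \<in> B}"
      using B sets_eq_imp_space_eq[OF sets_restricted] by (subst emeasure_distr) (auto simp: vimage_def)
    then show "emeasure (distr (restricted \<mu>) borel (\<lambda>x. x /\<^sub>R c)) B = emeasure (scale_measure (ennreal (c powr - \<alpha>)) (restricted \<mu>)) B"
      using emeasure_restricted_scale[OF c B] by simp
  qed simp
  then have "(\<integral>\<^sup>+x. g x \<partial>distr (restricted \<mu>) borel (\<lambda>x. x /\<^sub>R c)) = (\<integral>\<^sup>+x. g x \<partial>scale_measure (ennreal (c powr - \<alpha>)) (restricted \<mu>))"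
    by simp
  then show ?thesis
    by (simp add: nn_integral_distr nn_integral_scale_measure)
qed

lemma emeasure_restricted_zero: "emeasure (restricted \<mu>) {x. loss x = 0} = 0"
proof -
  have "AE y in \<mu>. real_part y \<notin> {x. loss x = 0}"
    using AE_\<mu> by eventually_elim auto
  then have "(\<integral>\<^sup>+y. indicator {x. loss x = 0} (real_part y) \<partial>\<mu>) = (\<integral>\<^sup>+y. 0 \<partial>\<mu>)"
    by (intro nn_integral_cong_AE) (auto simp: indicator_def)
  then show ?thesis
    using nn_integral_restricted[of "indicator {x. loss x = 0}"] by simp
qed

text \<open>Up to a null set the preimage lies in the compact set \<open>{f \<ge> 1}\<close> off the
  zero set, where a Radon measure is finite.\<close>

lemma emeasure_restricted_gt_1: "emeasure (restricted \<mu>) {x. 1 < loss x} < \<infinity>"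
proof -
  let ?K = "{y. ennreal 1 \<le> f y}"
  have "emeasure (restricted \<mu>) {x. 1 < loss x} = emeasure \<mu> {y \<in> space \<mu>. real_part y \<in> {x. 1 < loss x}}"
    by (rule emeasure_restricted_eq) measurable
  also have "\<dots> \<le> emeasure \<mu> ?K"
  proof (rule emeasure_mono_AE)
    show "AE y in \<mu>. y \<in> {y \<in> space \<mu>. real_part y \<in> {x. 1 < loss x}} \<longrightarrow> y \<in> ?K"
      using AE_\<mu> by eventually_elim (auto simp: f_vec_ereal simp flip: ennreal_1)
    show "?K \<in> sets \<mu>"
      by (auto simp: sets_\<mu>_iff)
  qed
  also have "\<dots> < \<infinity>"
  proof -
    have "?K \<subseteq> - {x. f x = 0}"
      by auto
    then show ?thesis
      using rv compact_f_ge_level unfolding regularly_varying_law_def radon_measure_on_def by blast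
  qed
  finally show ?thesis .
qed

text \<open>The constant \<open>C\<close> in the density of the limit law, that is, the mass of
  \<open>{f > 1}\<close> under \<open>\<mu>\<close>.\<close>

definition tail_const :: real where
  "tail_const = measure (restricted \<mu>) {x. 1 < loss x}"

lemma emeasure_restricted_gt:
  assumes t: "t > 0"
  shows "emeasure (restricted \<mu>) {x. t < loss x} = ennreal (tail_const * t powr - \<alpha>)"
proof -
  have "{x. t < loss x} = {x. x /\<^sub>R t \<in> {x. 1 < loss x}}"
    using t by (auto simp: loss_scaleR field_simps)
  then have "emeasure (restricted \<mu>) {x. t < loss x} = ennreal (t powr - \<alpha>) * emeasure (restricted \<mu>) {x. 1 < loss x}"
    using emeasure_restricted_scale[OF t, of "{x. 1 < loss x}"] by simp
  also have "emeasure (restricted \<mu>) {x. 1 < loss x} = ennreal tail_const"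
    using emeasure_restricted_gt_1 unfolding tail_const_def by (intro emeasure_eq_ennreal_measure) auto
  also have "ennreal (t powr - \<alpha>) * ennreal tail_const = ennreal (tail_const * t powr - \<alpha>)"
    by (subst mult.commute) (simp add: ennreal_mult tail_const_def)
  finally show ?thesis .
qed

text \<open>By scaling, a vanishing tail at level 1 would vanish at all positive levels; these
  exhaust the space up to a null set, against the nontriviality of \<open>\<mu>\<close>.\<close>

lemma tail_const_pos: "tail_const > 0"
proof (rule ccontr)
  assume "\<not> tail_const > 0"
  then have "tail_const = 0"
    by (simp add: tail_const_def order_antisym not_less)
  then have "emeasure (restricted \<mu>) {x. 1 / real (Suc i) < loss x} = 0" for i
    by (subst emeasure_restricted_gt) auto
  then have "emeasure (restricted \<mu>) (\<Union>i. {x. 1 / real (Suc i) < loss x}) = 0"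
    by (intro emeasure_UN_eq_0) auto
  then have "emeasure (restricted \<mu>) {x. 0 < loss x} = 0"
    unfolding exhaustion_loss_gt(2) .
  then have "emeasure \<mu> {y \<in> space \<mu>. real_part y \<in> {x. 0 < loss x}} = 0"
    by (subst emeasure_restricted_eq[symmetric]) auto
  moreover have "emeasure \<mu> (space \<mu>) \<le> emeasure \<mu> {y \<in> space \<mu>. real_part y \<in> {x. 0 < loss x}}"
  proof (rule emeasure_mono_AE)
    show "AE y in \<mu>. y \<in> space \<mu> \<longrightarrow> y \<in> {y \<in> space \<mu>. real_part y \<in> {x. 0 < loss x}}"
      using AE_\<mu> by eventually_elim auto
    have "{x. 0 < loss x} \<in> sets borel"
      by measurable
    then show "{y \<in> space \<mu>. real_part y \<in> {x. 0 < loss x}} \<in> sets \<mu>"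
      using measurable_sets[OF measurable_real_part_\<mu>] by (simp add: vimage_def Int_def conj_commute)
  qed
  ultimately have "emeasure \<mu> (- {x. f x = 0}) = 0"
    by (simp add: space_\<mu>)
  then show False
    using rv by (simp add: regularly_varying_law_def)
qed

lemma vague_limit:
  fixes h :: "ereal ^ 'd \<Rightarrow> real"
  assumes h: "continuous_on UNIV h" and K: "compact K" "K \<subseteq> - {x. f x = 0}" "\<And>y. y \<notin> K \<Longrightarrow> h y = 0"
  shows "(\<lambda>n. real n * (\<integral>x. h (vec_ereal (x /\<^sub>R a n)) \<partial>Q)) \<longlonglongrightarrow> (\<integral>x. h (vec_ereal x) \<partial>restricted \<mu>)"
proof -
  let ?D = "{x. f x = 0}"
  have hD: "continuous_on (- ?D) h"
    using h by (rule continuous_on_subset) simp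
  have sQ: "sets Q = sets borel"
    using rv by (simp add: regularly_varying_law_def)
  have ind: "indicator (- ?D) y * h y = h y" for y
    using K by (cases "y \<in> K") (auto simp: indicator_def)
  have "(\<lambda>n. \<integral>x. h x \<partial>scale_measure (of_nat n)
      (restrict_space (distr Q borel (\<lambda>x. vec_ereal (x /\<^sub>R a n))) (- ?D))) \<longlonglongrightarrow> (\<integral>x. h x \<partial>\<mu>)"
    using rv hD K unfolding regularly_varying_law_def vague_conv_on_def by blast
  then have "(\<lambda>n. real n * (\<integral>x. h (vec_ereal (x /\<^sub>R a n)) \<partial>Q)) \<longlonglongrightarrow> (\<integral>x. h x \<partial>\<mu>)"
    unfolding integral_test_function[OF sQ hD] ind .
  moreover have "(\<integral>x. h (vec_ereal x) \<partial>restricted \<mu>) = (\<integral>x. h x \<partial>\<mu>)"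
  proof -
    have hm: "h \<in> borel_measurable borel"
      using h by (rule borel_measurable_continuous_onI)
    have hv: "(\<lambda>x. h (vec_ereal x)) \<in> borel_measurable borel"
      using measurable_compose[OF borel_measurable_vec_ereal hm] .
    have "(\<integral>x. h (vec_ereal x) \<partial>restricted \<mu>) = (\<integral>y. h (vec_ereal (real_part y)) \<partial>\<mu>)"
      unfolding restricted_def by (rule integral_distr[OF measurable_real_part_\<mu> hv])
    also have "\<dots> = (\<integral>y. h y \<partial>\<mu>)"
    proof (rule integral_cong_AE)
      show "AE y in \<mu>. h (vec_ereal (real_part y)) = h y"
        using AE_\<mu> by eventually_elim auto
      show "(\<lambda>y. h (vec_ereal (real_part y))) \<in> borel_measurable \<mu>"
        using measurable_compose[OF measurable_real_part_\<mu> hv] .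
    qed (rule measurable_\<mu>[OF hm])
    finally show ?thesis .
  qed
  ultimately show ?thesis
    by simp
qed

text \<open>Extending \<open>h\<close> by zero makes it a test function on the compactified space,
  whose support is the compact image of \<open>K\<close>.\<close>

lemma vague_limit_real:
  fixes h :: "real ^ 'd \<Rightarrow> real"
  assumes h: "continuous_on UNIV h"
    and K: "compact K" "K \<subseteq> {x. 0 < loss x}" "\<And>x. x \<notin> K \<Longrightarrow> h x = 0"
  shows "(\<lambda>n. real n * (\<integral>x. h (x /\<^sub>R a n) \<partial>Q)) \<longlonglongrightarrow> (\<integral>x. h x \<partial>restricted \<mu>)"
proof -
  let ?H = "\<lambda>y. if y \<in> range vec_ereal then h (real_part y) else 0"
  have "(\<lambda>n. real n * (\<integral>x. ?H (vec_ereal (x /\<^sub>R a n)) \<partial>Q)) \<longlonglongrightarrow> (\<integral>x. ?H (vec_ereal x) \<partial>restricted \<mu>)"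
  proof (rule vague_limit)
    show "continuous_on UNIV ?H"
      using h K(1,3) by (rule continuous_extension_by_zero)
    show "compact (vec_ereal ` K)"
      using continuous_on_subset[OF continuous_on_vec_ereal] K(1) by (intro compact_continuous_image) auto
    show "vec_ereal ` K \<subseteq> - {x. f x = 0}"
      using K(2) by (auto simp: loss_eq_0_iff[symmetric])
    show "?H y = 0" if "y \<notin> vec_ereal ` K" for y
    proof (cases "y \<in> range vec_ereal")
      case True
      then obtain x where x: "y = vec_ereal x"
        by blast
      then have "x \<notin> K"
        using that by blast
      then show ?thesis
        using K(3) x by simp
    qed simp
  qed
  then show ?thesis
    by simp
qed

text \<open>A continuous function of \<open>f\<close> between the indicators of \<open>{f \<ge> t}\<close> and \<open>{f > s}\<close>
  is an admissible test function, because \<open>{f \<ge> s}\<close> is compact in the compactified space.\<close>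
lemma tail_sandwich:
  assumes st: "0 < s" "s < t"
  obtains I :: "nat \<Rightarrow> real" and l where "I \<longlonglongrightarrow> l" "tail_const * t powr - \<alpha> \<le> l" "l \<le> tail_const * s powr - \<alpha>"
    "\<And>n. real n * measure Q {x. loss (x /\<^sub>R a n) \<ge> t} \<le> I n"
    "\<And>n. I n \<le> real n * measure Q {x. loss (x /\<^sub>R a n) > s}"
proof -
  interpret Q: prob_space Q
    using rv by (simp add: regularly_varying_law_def)
  have sQ [measurable_cong]: "sets Q = sets borel"
    using rv by (simp add: regularly_varying_law_def)
  \<comment> \<open>The truncation at \<open>t\<close> comes before \<open>enn2real\<close>, which
    sends infinity to 0 and would break continuity where \<open>f\<close> is infinite.\<close>
  define \<psi> where "\<psi> y = max 0 (min 1 ((enn2real (min (f y) (ennreal t)) - s) / (t - s)))" for y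
  define k where "k x = \<psi> (vec_ereal x)" for x
  have k: "k x = max 0 (min 1 ((min (loss x) t - s) / (t - s)))" for x
    using st by (simp add: k_def \<psi>_def f_vec_ereal min_def ennreal_le_iff)
  have cont_min: "continuous_on UNIV (\<lambda>y. enn2real (min (f y) (ennreal t)))"
    unfolding continuous_on_def
  proof
    fix y
    have "((\<lambda>y. min (f y) (ennreal t)) \<longlongrightarrow> min (f y) (ennreal t)) (at y)"
      using cont by (intro tendsto_min tendsto_const) (auto simp: continuous_on_def)
    moreover have "min (f y) (ennreal t) < \<top>"
      by (rule le_less_trans[OF min.cobounded2]) simp
    ultimately show "((\<lambda>y. enn2real (min (f y) (ennreal t))) \<longlongrightarrow> enn2real (min (f y) (ennreal t))) (at y within UNIV)"
      by (simp add: tendsto_enn2real)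
  qed
  have \<psi>_cont: "continuous_on UNIV \<psi>"
    unfolding \<psi>_def using st by (intro continuous_intros cont_min) auto
  have k_meas [measurable]: "k \<in> borel_measurable borel"
    unfolding k_def using measurable_compose[OF borel_measurable_vec_ereal borel_measurable_continuous_onI[OF \<psi>_cont]] .
  have k01: "0 \<le> k x" "k x \<le> 1" for x
    by (auto simp: k)
  have k_ge: "indicator {x. t \<le> loss x} x \<le> k x" for x
    using st by (auto simp: k indicator_def)
  have k_le: "k x \<le> indicator {x. s < loss x} x" for x
  proof (cases "s < loss x")
    case False
    then have "(min (loss x) t - s) / (t - s) \<le> 0"
      using st by (intro divide_nonpos_nonneg) auto
    then show ?thesis
      using False by (simp add: k)
  qed (use k01 in simp)
  have zero: "\<psi> y = 0" if "y \<notin> {y. ennreal s \<le> f y}" for y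
  proof -
    have "f y < ennreal s"
      using that by simp
    then have "enn2real (min (f y) (ennreal t)) \<le> enn2real (ennreal s)"
      by (intro enn2real_mono) (auto simp: min_def)
    then have "(enn2real (min (f y) (ennreal t)) - s) / (t - s) \<le> 0"
      using st by (intro divide_nonpos_nonneg) auto
    then show ?thesis
      by (simp add: \<psi>_def)
  qed
  have lim: "(\<lambda>n. real n * (\<integral>x. k (x /\<^sub>R a n) \<partial>Q)) \<longlonglongrightarrow> (\<integral>x. k x \<partial>restricted \<mu>)"
    unfolding k_def
  proof (rule vague_limit[OF \<psi>_cont compact_f_ge_level _ zero])
    show "{y. ennreal s \<le> f y} \<subseteq> - {x. f x = 0}"
      using st by auto
  qed
  have ind: "integrable (restricted \<mu>) (indicator {x. u < loss x} :: _ \<Rightarrow> real)"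
    "(\<integral>x. indicator {x. u < loss x} x \<partial>restricted \<mu>) = tail_const * u powr - \<alpha>" if u: "u > 0" for u
  proof -
    show "integrable (restricted \<mu>) (indicator {x. u < loss x} :: _ \<Rightarrow> real)"
      using emeasure_restricted_gt[OF u] by (intro integrable_real_indicator) auto
    show "(\<integral>x. indicator {x. u < loss x} x \<partial>restricted \<mu>) = tail_const * u powr - \<alpha>"
      using emeasure_restricted_gt[OF u] tail_const_pos sets_eq_imp_space_eq[OF sets_restricted]
      by (simp add: measure_def)
  qed
  have int_k: "integrable (restricted \<mu>) k"
  proof (rule Bochner_Integration.integrable_bound[OF ind(1)[OF st(1)]])
    show "AE x in restricted \<mu>. norm (k x) \<le> norm (indicator {x. s < loss x} x :: real)"
      using k_le k01 by (intro AE_I2) simp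
  qed measurable
  have gt_le_k: "indicator {x. t < loss x} x \<le> k x" for x
    using k_ge[of x] k01(1)[of x] by (auto simp: indicator_def split: if_splits)
  have st': "0 < t"
    using st by simp
  have int_Q: "integrable Q (\<lambda>x. k (x /\<^sub>R c))" for c
    using k01 by (intro Q.integrable_const_bound[where B = 1] AE_I2) auto
  have ge_m: "{x. loss (x /\<^sub>R c) \<ge> t} \<in> sets borel" and gt_m: "{x. loss (x /\<^sub>R c) > s} \<in> sets borel" for c
    by measurable
  have ge: "measure Q {x. loss (x /\<^sub>R c) \<ge> t} \<le> (\<integral>x. k (x /\<^sub>R c) \<partial>Q)" for c
  proof -
    have "(\<integral>x. indicator {x. loss (x /\<^sub>R c) \<ge> t} x \<partial>Q) \<le> (\<integral>x. k (x /\<^sub>R c) \<partial>Q)"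
      using k_ge ge_m sQ by (intro integral_mono int_Q Q.integrable_const_bound[where B = 1] AE_I2) (auto simp: indicator_def)
    then show ?thesis
      using sets_eq_imp_space_eq[OF sQ] by simp
  qed
  have gt: "(\<integral>x. k (x /\<^sub>R c) \<partial>Q) \<le> measure Q {x. loss (x /\<^sub>R c) > s}" for c
  proof -
    have "(\<integral>x. k (x /\<^sub>R c) \<partial>Q) \<le> (\<integral>x. indicator {x. loss (x /\<^sub>R c) > s} x \<partial>Q)"
      using k_le gt_m sQ by (intro integral_mono int_Q Q.integrable_const_bound[where B = 1] AE_I2) (auto simp: indicator_def)
    then show ?thesis
      using sets_eq_imp_space_eq[OF sQ] by simp
  qed
  show ?thesis
  proof (rule that[OF lim])
    show "tail_const * t powr - \<alpha> \<le> (\<integral>x. k x \<partial>restricted \<mu>)"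
      using integral_mono[OF ind(1)[OF st'] int_k gt_le_k] ind(2)[OF st'] by simp
    show "(\<integral>x. k x \<partial>restricted \<mu>) \<le> tail_const * s powr - \<alpha>"
      using integral_mono[OF int_k ind(1)[OF st(1)] k_le] ind(2)[OF st(1)] by simp
  qed (use ge gt in \<open>auto intro: mult_left_mono\<close>)
qed

text \<open>The sandwich between some \<open>s < t\<close> and \<open>t\<close> bounds the weak tail
  from above, the one between \<open>t\<close> and a larger level bounds the strict tail from below.
  The bounds meet by continuity in the level, and the strict tail never exceeds the weak
  one.\<close>

lemma tail_limits:
  assumes t: "t > 0"
  shows "(\<lambda>n. real n * measure Q {x. loss (x /\<^sub>R a n) \<ge> t}) \<longlonglongrightarrow> tail_const * t powr - \<alpha>" (is "?G \<longlonglongrightarrow> ?l")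
    and "(\<lambda>n. real n * measure Q {x. loss (x /\<^sub>R a n) > t}) \<longlonglongrightarrow> tail_const * t powr - \<alpha>" (is "?F \<longlonglongrightarrow> _")
proof -
  interpret Q: prob_space Q
    using rv by (simp add: regularly_varying_law_def)
  have sQ: "sets Q = sets borel"
    using rv by (simp add: regularly_varying_law_def)
  have FG: "?F n \<le> ?G n" for n
  proof -
    have "{x. loss (x /\<^sub>R a n) \<ge> t} \<in> sets borel"
      by measurable
    then show ?thesis
      by (intro mult_left_mono Q.finite_measure_mono) (auto simp: sQ)
  qed
  have lim: "((\<lambda>s. tail_const * s powr - \<alpha>) \<longlongrightarrow> ?l) (at t)"
    using t by (intro tendsto_intros) auto
  have up: "\<forall>\<^sub>F n in sequentially. ?G n < y" if y: "?l < y" for y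
  proof -
    have "\<forall>\<^sub>F s in at_left t. tail_const * s powr - \<alpha> < y"
      using order_tendstoD(2)[OF tendsto_within_subset[OF lim] y] by simp
    then obtain b where b: "b < t" "\<And>s. b < s \<Longrightarrow> s < t \<Longrightarrow> tail_const * s powr - \<alpha> < y"
      unfolding eventually_at_left_field by blast
    obtain s where s: "max b 0 < s" "s < t"
      using dense[of "max b 0" t] b(1) t by auto
    obtain I l where I: "I \<longlonglongrightarrow> l" "l \<le> tail_const * s powr - \<alpha>" "\<And>n. ?G n \<le> I n"
      using tail_sandwich[of s t] s by (metis max_less_iff_conj)
    have "l < y"
      using I(2) b(2)[of s] s by simp
    from order_tendstoD(2)[OF I(1) this] show ?thesis
      by eventually_elim (rule le_less_trans[OF I(3)])
  qed
  have lo: "\<forall>\<^sub>F n in sequentially. y < ?F n" if y: "y < ?l" for y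
  proof -
    have "\<forall>\<^sub>F s in at_right t. y < tail_const * s powr - \<alpha>"
      using order_tendstoD(1)[OF tendsto_within_subset[OF lim] y] by simp
    then obtain b where b: "t < b" "\<And>s. t < s \<Longrightarrow> s < b \<Longrightarrow> y < tail_const * s powr - \<alpha>"
      unfolding eventually_at_right_field by blast
    obtain s where s: "t < s" "s < b"
      using dense[OF b(1)] by auto
    obtain I l where I: "I \<longlonglongrightarrow> l" "tail_const * s powr - \<alpha> \<le> l" "\<And>n. I n \<le> ?F n"
      using tail_sandwich[OF t s(1)] by metis
    have "y < l"
      using I(2) b(2)[OF s] by simp
    from order_tendstoD(1)[OF I(1) this] show ?thesis
      by eventually_elim (erule less_le_trans, rule I(3))
  qed
  show "?G \<longlonglongrightarrow> ?l"
  proof (rule order_tendstoI)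
    show "\<forall>\<^sub>F n in sequentially. y < ?G n" if "y < ?l" for y
      using lo[OF that] by eventually_elim (erule less_le_trans, rule FG)
  qed (rule up)
  show "?F \<longlonglongrightarrow> ?l"
  proof (rule order_tendstoI)
    show "\<forall>\<^sub>F n in sequentially. ?F n < y" if "?l < y" for y
      using up[OF that] by eventually_elim (rule le_less_trans[OF FG])
  qed (rule lo)
qed

end

section \<open>The characterization\<close>

text \<open>A constant would give \<open>{x. loss x \<le> 1}\<close> probability 0 or 1, while the
  Frechet value \<open>exp (- C)\<close> lies strictly between.\<close>

lemma not_AE_const_if_frechet:
  assumes P: "prob_space P" "sets P = sets borel" and C: "C > 0"
    and F: "\<And>t. t > 0 \<Longrightarrow> measure P {x. loss x \<le> t} = exp (- (C * t powr - \<alpha>))"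
  shows "\<not> (\<exists>c. AE x in P. f (vec_ereal x) = c)"
proof
  interpret prob_space P by fact
  assume "\<exists>c. AE x in P. f (vec_ereal x) = c"
  then obtain c where c: "AE x in P. f (vec_ereal x) = c"
    by blast
  have "AE x in P. loss x = enn2real c"
    using c by eventually_elim (simp add: loss_def)
  then have "AE x in P. x \<in> {x. loss x \<le> 1} \<longleftrightarrow> enn2real c \<le> 1"
    by eventually_elim simp
  moreover have "{x. loss x \<le> 1} \<in> events"
    unfolding P(2) by measurable
  ultimately have "prob {x. loss x \<le> 1} = 1 \<or> prob {x. loss x \<le> 1} = 0"
    using prob_Collect_eq_1[of "\<lambda>x. x \<in> {x. loss x \<le> 1}"] prob_Collect_eq_0[of "\<lambda>x. x \<in> {x. loss x \<le> 1}"]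
      sets_eq_imp_space_eq[OF P(2)] by (cases "enn2real c \<le> 1") auto
  then show False
    using F[of 1] C by simp
qed

text \<open>The limit law is a Frechet-weighted version of \<open>restricted \<mu>\<close>, whose
  scaling yields stability with the constants \<open>n powr (1 / \<alpha>)\<close>; these may differ
  from the normalisation \<open>a\<close> of \<open>Q\<close>.\<close>

lemma implicit_max_stable_if_extreme_value:
  assumes P: "prob_space P" "sets P = sets borel"
    and ev: "implicit_extreme_value f \<alpha> \<mu> P"
    and supp: "emeasure \<mu> (space \<mu> - vec_ereal ` {x. f (vec_ereal x) \<noteq> 0}) = 0"
    and scaling: "scaling_property \<alpha> \<mu>"
  shows "implicit_max_stable f P \<and> \<not> (\<exists>c. AE x in P. f (vec_ereal x) = c)"
proof -
  obtain Q a where rv: "regularly_varying_law \<alpha> a {x. f x = 0} \<mu> Q"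
    and conv: "conv_in_distribution (\<lambda>n. implicit_max_law f Q n (a n)) P"
    using ev unfolding implicit_extreme_value_def by blast
  have Q: "prob_space Q" "sets Q = sets borel" and \<alpha>: "\<alpha> > 0" and a: "\<And>n. n \<ge> 1 \<Longrightarrow> a n > 0"
    using rv by (auto simp: regularly_varying_law_def regularly_varying_seq_def)
  note sv = rv supp scaling
  let ?\<kappa> = "restricted \<mu>" and ?C = "tail_const \<mu>"
  have C: "?C > 0"
    using tail_const_pos[OF sv] .
  have fin: "emeasure ?\<kappa> {x. s < loss x} < \<infinity>" if "s > 0" for s
    using emeasure_restricted_gt[OF sv that] by simp
  have vague: "(\<lambda>n. real n * (\<integral>x. h (x /\<^sub>R a n) \<partial>Q)) \<longlonglongrightarrow> (\<integral>x. h x \<partial>?\<kappa>)"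
    if "continuous_on UNIV h" "\<And>x. 0 \<le> h x" "\<And>x. h x \<le> 1" "compact K" "K \<subseteq> {x. 0 < loss x}"
      "\<And>x. x \<notin> K \<Longrightarrow> h x = 0" for h K
    using that(1,4-6) by (rule vague_limit_real[OF sv])
  note lim = P Q sets_restricted fin emeasure_restricted_zero[OF sv] a C \<alpha> tail_limits[OF sv]
    vague conv
  have F: "measure P {x. loss x \<le> t} = exp (- (?C * t powr - \<alpha>))" if "t > 0" for t
    by (rule cdf_implicit_limit[where Q = Q and \<kappa> = ?\<kappa> and a = a]) (fact lim that)+
  have dens: "P = density ?\<kappa> (\<lambda>x. ennreal (frechet_weight ?C \<alpha> x))"
    by (rule implicit_limit_eq_density[where Q = Q and a = a]) (fact lim)+
  have "implicit_max_law f P n (real n powr (1 / \<alpha>)) = P" if "n \<ge> 1" for n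
    by (rule implicit_max_law_eq_if_scaling[where \<kappa> = ?\<kappa>])
      (fact sets_restricted nn_integral_restricted_scale[OF sv] dens P(1) C \<alpha> F that)+
  then have "\<exists>a>0. implicit_max_law f P n a = P" if "n \<ge> 1" for n
    using that by (intro exI[of _ "real n powr (1 / \<alpha>)"]) auto
  then have "implicit_max_stable f P"
    unfolding implicit_max_stable_def by blast
  with not_AE_const_if_frechet[OF P C F] show ?thesis
    by blast
qed

text \<open>Almost every point meets the threshold equivalence at all rational levels at once. Two
  such points have equal loss, since a rational would separate different ones; so any single such
  point supplies the constant.\<close>

lemma AE_const_if_cdf_degenerate:
  assumes P: "prob_space P" "sets P = sets borel"
    and deg: "\<And>t. measure P {x. loss x \<le> t} \<in> {0, 1}"
  shows "\<exists>c. AE x in P. f (vec_ereal x) = c"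
proof -
  interpret prob_space P by fact
  have sp: "space P = UNIV"
    using sets_eq_imp_space_eq[OF P(2)] by simp
  have ev: "{x. loss x \<le> t} \<in> events" for t
    unfolding P(2) by measurable
  have "AE x in P. loss x \<le> q \<longleftrightarrow> prob {x. loss x \<le> q} = 1" for q
  proof (cases "prob {x. loss x \<le> q} = 1")
    case True
    then show ?thesis
      using prob_Collect_eq_1[of "\<lambda>x. loss x \<le> q"] ev sp by simp
  next
    case False
    then show ?thesis
      using deg[of q] prob_Collect_eq_0[of "\<lambda>x. loss x \<le> q"] ev sp by simp
  qed
  then have ae: "AE x in P. \<forall>q\<in>\<rat>. loss x \<le> q \<longleftrightarrow> prob {x. loss x \<le> q} = 1"
    by (subst AE_ball_countable) (auto simp: countable_rat)
  have "\<exists>x. \<forall>q\<in>\<rat>. loss x \<le> q \<longleftrightarrow> prob {x. loss x \<le> q} = 1"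
  proof (rule ccontr)
    assume no: "\<not> ?thesis"
    have "AE x in P. False"
      using ae by eventually_elim (use no in blast)
    then show False
      by simp
  qed
  then obtain x\<^sub>0 where x0: "\<forall>q\<in>\<rat>. loss x\<^sub>0 \<le> q \<longleftrightarrow> prob {x. loss x \<le> q} = 1"
    by blast
  have "AE x in P. f (vec_ereal x) = f (vec_ereal x\<^sub>0)"
    using ae
  proof eventually_elim
    case (elim x)
    have "loss x = loss x\<^sub>0"
    proof (rule ccontr)
      assume "loss x \<noteq> loss x\<^sub>0"
      then consider "loss x < loss x\<^sub>0" | "loss x\<^sub>0 < loss x"
        by linarith
      then show False
      proof cases
        case 1
        then obtain q where "q \<in> \<rat>" "loss x < q" "q < loss x\<^sub>0"
          using Rats_dense_in_real by blast
        then show False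
          using elim x0 by force
      next
        case 2
        then obtain q where "q \<in> \<rat>" "loss x\<^sub>0 < q" "q < loss x"
          using Rats_dense_in_real by blast
        then show False
          using elim x0 by force
      qed
    qed
    then show ?case
      by (simp add: f_vec_ereal)
  qed
  then show ?thesis
    by blast
qed

lemma extreme_value_if_implicit_max_stable:
  assumes P: "prob_space P" "sets P = sets borel"
    and stable: "implicit_max_stable f P"
    and nondeg: "\<not> (\<exists>c. AE x in P. f (vec_ereal x) = c)"
  shows "\<exists>\<mu> \<alpha>. \<alpha> > 0 \<and> implicit_extreme_value f \<alpha> \<mu> P \<and>
    emeasure \<mu> (space \<mu> - vec_ereal ` {x. f (vec_ereal x) \<noteq> 0}) = 0 \<and> scaling_property \<alpha> \<mu>"
proof -
  interpret prob_space P by fact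
  have sp: "space P = UNIV"
    using sets_eq_imp_space_eq[OF P(2)] by simp
  have ev: "{x. loss x \<le> t} \<in> events" for t
    unfolding P(2) by measurable
  obtain a where a: "\<And>n. n \<ge> 1 \<Longrightarrow> a n > 0" "\<And>n. n \<ge> 1 \<Longrightarrow> implicit_max_law f P n (a n) = P"
    using stable unfolding implicit_max_stable_def by metis
  define F where "F t = prob {x. loss x \<le> t}" for t
  have F_eq: "F (a n * t) ^ n = F t" if n: "n \<ge> 1" for n t
  proof -
    have "ennreal (F t) = ennreal (F (a n * t) ^ n)"
      using emeasure_implicit_max_law_loss_le[OF P n a(1)[OF n], of t] a(2)[OF n]
      by (simp add: F_def emeasure_eq_measure ennreal_power)
    then show ?thesis
      by (simp add: F_def)
  qed
  have F_neg: "F t = 0" if "t < 0" for t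
  proof -
    have "{x. loss x \<le> t} = {}"
      using that loss_nonneg by (auto simp: not_le intro: less_le_trans)
    then show ?thesis
      by (simp add: F_def)
  qed
  \<comment> \<open>Level 0 is fixed by every rescaling, so stability with \<open>n = 2\<close>
    makes \<open>F 0\<close> idempotent. Hence a level with \<open>F\<close> strictly between 0 and
    1 has to be positive.\<close>
  have F0: "F 0 \<in> {0, 1}"
  proof -
    have "F 0 * F 0 = F 0"
      using F_eq[of 2 0] by (simp add: power2_eq_square)
    then show ?thesis
      by auto
  qed
  have lim: "(F \<longlongrightarrow> 1) at_top"
  proof -
    have "loss \<in> borel_measurable P"
      using measurable_loss by (simp add: P(2) cong: measurable_cong_sets)
    then interpret D: real_distribution "distr P borel loss"
      by (intro real_distribution_distr)
    have "cdf (distr P borel loss) = F"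
      using \<open>loss \<in> borel_measurable P\<close>
      by (auto simp: cdf_def F_def measure_distr sp vimage_def fun_eq_iff)
    with D.cdf_lim_at_top_prob show ?thesis
      by simp
  qed
  have "\<exists>t>0. 0 < F t \<and> F t < 1"
  proof (rule ccontr)
    assume no: "\<not> ?thesis"
    have "F t \<in> {0, 1}" for t
    proof -
      have "0 \<le> F t" "F t \<le> 1"
        by (simp_all add: F_def)
      with no F0 F_neg[of t] show ?thesis
        by (cases t "0 :: real" rule: linorder_cases) force+
    qed
    then show False
      using AE_const_if_cdf_degenerate[OF P] nondeg by (simp add: F_def)
  qed
  then obtain t\<^sub>0 where t0: "t\<^sub>0 > 0" "0 < F t\<^sub>0" "F t\<^sub>0 < 1"
    by blast
  have mono: "F s \<le> F t" if "s \<le> t" for s t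
    unfolding F_def using that ev by (intro finite_measure_mono) auto
  obtain C \<alpha> where C: "C > 0" "\<alpha> > 0" and a_eq: "\<forall>n\<ge>1. a n = real n powr (1 / \<alpha>)"
    and cdf: "\<forall>t>0. F t = exp (- (C * t powr - \<alpha>))"
    using frechet_functional_equation[OF mono _ lim t0 a(1) F_eq] by (auto simp: F_def)
  have st: "implicit_max_law f P n (real n powr (1 / \<alpha>)) = P" if "n \<ge> 1" for n
    using a(2)[OF that] a_eq that by simp
  have F': "measure P {x. loss x \<le> t} = exp (- (C * t powr - \<alpha>))" if "t > 0" for t
    using cdf that by (simp add: F_def)
  show ?thesis
    using C implicit_extreme_value_if_stable[OF P C F' st] by blast
qed

end

theorem theorem4p2:
  fixes f :: "ereal ^ 'd::finite \<Rightarrow> ennreal"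
    and P :: "(real ^ 'd) measure"
  assumes "continuous_on UNIV f"
    and "one_homogeneous f"
    and "\<And>x :: real ^ 'd. f (vec_ereal x) < \<infinity>"
    and "prob_space P" and "sets P = sets borel"
  shows "implicit_max_stable f P \<and> \<not> (\<exists>c. AE x in P. f (vec_ereal x) = c) \<longleftrightarrow>
    (\<exists>\<mu> \<alpha>. \<alpha> > 0 \<and> implicit_extreme_value f \<alpha> \<mu> P \<and>
       emeasure \<mu> (space \<mu> - vec_ereal ` {x. f (vec_ereal x) \<noteq> 0}) = 0 \<and>
       scaling_property \<alpha> \<mu>)"
proof -
  interpret homogeneous_loss f
    using assms(1-3) by unfold_locales
  show ?thesis
    using implicit_max_stable_if_extreme_value[OF assms(4,5)]
      extreme_value_if_implicit_max_stable[OF assms(4,5)] by blast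
qed

end
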